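(* Let $S\subseteq \mathbb{N}^d$ be a Buchsbaum simplicial affine semigroup having maximal embedding dimension. Assume $\mathrm{msg}(S)=\{\mathbf{a}_1, \ldots, \mathbf{a}_d\}\sqcup \{\mathbf{a}_{d+1},\ldots,\mathbf{a}_{d+m}\}$ (with $d+m$ distinct elements), where $\{\mathbf{a}_1, \ldots, \mathbf{a}_d\}$ is a set of extremal rays of $S$. If $S$ is a $\mathcal{C}$-semigroup, then $$\mu(I_S) = \frac{1}{2}\left(m(m+1)+d(d-1)\operatorname{g}(S)\right).$$
   Context: $\mathbb{N}$ denotes the nonnegative integers. An affine semigroup is a finitely generated submonoid $S$ of $\mathbb{N}^d$ (containing $\mathbf{0}$); $\mathrm{msg}(S)$ denotes its unique minimal set of generators. Set $\mathrm{cone}(S)=\{\sum_{i} q_i\mathbf{s}_i \mid \mathbf{s}_i\in S,\ q_i\in\mathbb{Q}_{\ge 0}\}$ (finite sums) and $\mathcal{C}=\mathrm{cone}(S)\cap\mathbb{N}^d$. $S$ is a $\mathcal{C}$-semigroup if it is an affine semigroup and $\mathcal{C}\setminus S$ is finite. The set of gaps is $\mathcal{H}(S)=(\mathrm{cone}(S)\setminus S)\cap\mathbb{N}^d$ and the genus is $\operatorname{g}(S)=|\mathcal{H}(S)|$. A set of extremal rays of $S$ is a finite set $B\subseteq S$ whose nonnegative rational span is $\mathrm{cone}(S)$ and such that no proper subset of $B$ has this property. Let $\operatorname{G}(S)=\{\mathbf{a}-\mathbf{b}\mid \mathbf{a},\mathbf{b}\in S\}$. $S\subseteq\mathbb{N}^d$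 is simplicial if the number of its extremal rays equals the rank of $\operatorname{G}(S)$; by standing convention this number is $d$. The set $E$ of minimal extremal rays of $S$ consists, for each extremal ray (half-line) of $\mathrm{cone}(S)$, of the smallest nonzero element of $S$ on that half-line. For nonempty $X\subseteq S$, $\operatorname{Ap}(S,X)=\{\mathbf{s}\in S\mid \mathbf{s}-\mathbf{x}\notin S\text{ for all }\mathbf{x}\in X\}$. $S$ has maximal embedding dimension if $\mathrm{msg}(S)\setminus E=\operatorname{Ap}(S,E)\setminus\{\mathbf{0}\}$, where $E$ is the set of minimal extremal rays. Let $\mathbb{K}$ be a field and $\mathbb{K}[S]=\mathbb{K}[\mathbf{t}^{\mathbf{a}}\mid \mathbf{a}\in S]\subseteq\mathbb{K}[t_1,\dots,t_d]$. If $\mathrm{msg}(S)=\{\mathbf{a}_1,\dots,\mathbf{a}_n\}$, the defining ideal $I_S$ is the kernel of the $\mathbb{K}$-algebra map $\mathbb{K}[x_1,\dots,x_n]\to\mathbb{K}[S]$, $x_i\mapsto\mathbf{t}^{\mathbf{a}_i}$, and $\mu(I_S)$ is the cardinality of a minimal set of generators of $I_S$ (homogeneous for the grading $\deg x_i=\mathbf{a}_i$); equivalently, the cardinality of a minimal presentation of $S$, i.e. of an inclusion-minimal generating set of the congruence $\{(\mathbf{u},\mathbf{v})\in\mathbb{N}^n\times\mathbb{N}^n\mid \sum u_i\mathbf{a}_i=\sum v_i\mathbf{a}_i\}$. A Noetherian local ring $(A,\mathfrak{m})$ of dimension $e$ is Buchsbaum if every system of parameters $x_1,\dots,x_e$ of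 $A$ satisfies $\mathfrak{m}\cdot\big((x_1,\dots,x_{i-1}):x_i\big)\subseteq (x_1,\dots,x_{i-1})$ for every $i=1,\dots,e$. $S$ is called Buchsbaum if the localization of $\mathbb{K}[S]$ at its maximal homogeneous ideal $(\mathbf{t}^{\mathbf{a}}\mid \mathbf{a}\in S\setminus\{\mathbf{0}\})$ is a Buchsbaum local ring. *)

theory Defs
  imports
    "HOL-Analysis.Analysis"
    "HOL-Algebra.Ring_Divisibility"
    "HOL-Algebra.Ideal_Product"
    "HOL-Library.Poly_Mapping"
    "HOL-Library.Extended_Nat"
begin

section \<open>Affine semigroups in \<open>\<nat>\<^sup>d\<close>\<close>

text \<open>
  \<open>\<nat>\<^sup>d\<close> is the type \<open>nat ^ 'd\<close>, so \<open>d\<close> is \<open>CARD('d)\<close>. Subtraction on that type truncates;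
  differences are therefore taken in \<open>\<int>\<^sup>d\<close>, and cones live in \<open>\<rat>\<^sup>d\<close>.
\<close>

definition vec_of_nat :: "nat ^ 'd \<Rightarrow> 'a::semiring_1 ^ 'd"
  where "vec_of_nat x = (\<chi> i. of_nat (x $ i))"

definition vec_of_int :: "int ^ 'd \<Rightarrow> 'a::ring_1 ^ 'd"
  where "vec_of_int x = (\<chi> i. of_int (x $ i))"

definition add_submonoid :: "'a::monoid_add set \<Rightarrow> bool"
  where "add_submonoid M \<longleftrightarrow> 0 \<in> M \<and> (\<forall>x\<in>M. \<forall>y\<in>M. x + y \<in> M)"

definition generates :: "'a::monoid_add set \<Rightarrow> 'a set \<Rightarrow> bool"
  where "generates A S \<longleftrightarrow> add_submonoid hull A = S"

definition affine_semigroup :: "(nat ^ 'd) set \<Rightarrow> bool"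
  where "affine_semigroup S \<longleftrightarrow> (\<exists>A. finite A \<and> generates A S)"

definition msg :: "(nat ^ 'd) set \<Rightarrow> (nat ^ 'd) set"
  where "msg S = (THE A. generates A S \<and> (\<forall>B. B \<subset> A \<longrightarrow> \<not> generates B S))"

lemma msg_welldef:
  assumes "add_submonoid (S :: (nat ^ 'd) set)"
  shows "\<exists>!A. generates A S \<and> (\<forall>B. B \<subset> A \<longrightarrow> \<not> generates B S)"
proof -
  let ?I = "{s \<in> S. s \<noteq> 0 \<and> (\<forall>x\<in>S. \<forall>y\<in>S. s = x + y \<longrightarrow> x = 0 \<or> y = 0)}"
  have S0: "0 \<in> S" and Sadd: "\<And>x y. x \<in> S \<Longrightarrow> y \<in> S \<Longrightarrow> x + y \<in> S"
    using assms by (auto simp: add_submonoid_def)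
  have gen_iff: "generates A S \<longleftrightarrow> A \<subseteq> S \<and> (\<forall>M. add_submonoid M \<and> A \<subseteq> M \<longrightarrow> S \<subseteq> M)" for A
    using assms unfolding generates_def hull_def by blast
  have pos: "0 < (\<Sum>i\<in>UNIV. x $ i)" if "x \<noteq> 0" for x :: "nat ^ 'd"
  proof -
    from that obtain i where "x $ i \<noteq> 0" by (auto simp: vec_eq_iff)
    thus ?thesis by (intro sum_pos2[of _ i]) auto
  qed
  have "S \<subseteq> M" if M: "add_submonoid M" "?I \<subseteq> M" for M
  proof
    fix s assume "s \<in> S"
    thus "s \<in> M"
    proof (induction "\<Sum>i\<in>UNIV. s $ i" arbitrary: s rule: less_induct)
      case less
      show ?case
      proof (cases "s = 0 \<or> s \<in> ?I")
        case True thus ?thesis using M by (auto simp: add_submonoid_def)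
      next
        case False
        then obtain x y where xy: "x \<in> S" "y \<in> S" "s = x + y" "x \<noteq> 0" "y \<noteq> 0" using less.prems by blast
        have "x \<in> M" using less.hyps[OF _ xy(1)] pos[OF xy(5)] by (simp add: xy(3) sum.distrib)
        moreover have "y \<in> M" using less.hyps[OF _ xy(2)] pos[OF xy(4)] by (simp add: xy(3) sum.distrib)
        ultimately show ?thesis using M xy by (auto simp: add_submonoid_def)
      qed
    qed
  qed
  hence gI: "generates ?I S" by (auto simp: gen_iff)
  have sub: "?I \<subseteq> A" if "generates A S" for A
  proof
    fix s assume s: "s \<in> ?I"
    show "s \<in> A"
    proof (rule ccontr)
      assume n: "s \<notin> A"
      have "add_submonoid (S - {s})" using s S0 Sadd unfolding add_submonoid_def
        by auto
      thus False using that n s unfolding gen_iff by blast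
    qed
  qed
  show ?thesis
  proof (rule ex1I[of _ ?I])
    show "generates ?I S \<and> (\<forall>B. B \<subset> ?I \<longrightarrow> \<not> generates B S)"
      using gI sub by (meson psubsetE)
    show "A = ?I" if "generates A S \<and> (\<forall>B. B \<subset> A \<longrightarrow> \<not> generates B S)" for A
    proof (rule ccontr)
      assume ne: "A \<noteq> ?I"
      have "?I \<subset> A" using sub[OF conjunct1[OF that]] ne by (rule psubsetI[OF _ not_sym])
      thus False using conjunct2[OF that] gI by (elim allE impE notE) assumption+
    qed
  qed
qed

definition qcone :: "(nat ^ 'd) set \<Rightarrow> (rat ^ 'd) set"
  where "qcone A = {\<Sum>s\<in>F. q s *s vec_of_nat s | F q. finite F \<and> F \<subseteq> A \<and> (\<forall>s\<in>F. 0 \<le> q s)}"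

definition gaps :: "(nat ^ 'd) set \<Rightarrow> (nat ^ 'd) set"
  where "gaps S = {x. vec_of_nat x \<in> qcone S} - S"

definition genus :: "(nat ^ 'd) set \<Rightarrow> nat"
  where "genus S = card (gaps S)"

definition C_semigroup :: "(nat ^ 'd) set \<Rightarrow> bool"
  where "C_semigroup S \<longleftrightarrow> affine_semigroup S \<and> finite (gaps S)"

definition extremal_rays :: "(nat ^ 'd) set \<Rightarrow> (nat ^ 'd) set \<Rightarrow> bool"
  where "extremal_rays S B \<longleftrightarrow>
    finite B \<and> B \<subseteq> S \<and> qcone B = qcone S \<and> (\<forall>B'. B' \<subset> B \<longrightarrow> qcone B' \<noteq> qcone S)"

definition group_of :: "(nat ^ 'd) set \<Rightarrow> (int ^ 'd) set"
  where "group_of S = {vec_of_nat a - vec_of_nat b | a b. a \<in> S \<and> b \<in> S}"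

text \<open>The rank of a subgroup \<open>G\<close> of \<open>\<int>\<^sup>d\<close> is \<open>dim\<^sub>\<rat> (G \<otimes> \<rat>)\<close>, and \<open>G \<otimes> \<rat>\<close> is the span of \<open>G\<close> in \<open>\<rat>\<^sup>d\<close>.\<close>

definition group_rank :: "(int ^ 'd) set \<Rightarrow> nat"
  where "group_rank G = vec.dim (vec_of_int ` G :: (rat ^ 'd) set)"

definition simplicial :: "(nat ^ 'd) set \<Rightarrow> bool"
  where "simplicial S \<longleftrightarrow>
    (\<exists>B. extremal_rays S B \<and> card B = group_rank (group_of S) \<and> card B = CARD('d))"

text \<open>The extremal half-lines of the cone are those spanned by the members \<open>b\<close> of a set of
  extremal rays. On each of them the componentwise order of \<open>nat ^ 'd\<close> is total.\<close>

definition minimal_extremal_rays :: "(nat ^ 'd) set \<Rightarrow> (nat ^ 'd) set"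
  where "minimal_extremal_rays S =
    {s. \<exists>B. \<exists>b\<in>B. extremal_rays S B \<and>
      s \<in> S \<and> s \<noteq> 0 \<and> vec_of_nat s \<in> qcone {b} \<and>
      (\<forall>t\<in>S. t \<noteq> 0 \<and> vec_of_nat t \<in> qcone {b} \<longrightarrow> s \<le> t)}"

definition Ap :: "(nat ^ 'd) set \<Rightarrow> (nat ^ 'd) set \<Rightarrow> (nat ^ 'd) set"
  where "Ap S X = {s \<in> S. \<forall>x\<in>X. (vec_of_nat s - vec_of_nat x :: int ^ 'd) \<notin> vec_of_nat ` S}"

definition maximal_embedding_dimension :: "(nat ^ 'd) set \<Rightarrow> bool"
  where "maximal_embedding_dimension S \<longleftrightarrow>
    msg S - minimal_extremal_rays S = Ap S (minimal_extremal_rays S) - {0}"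


section \<open>Localization and Buchsbaum local rings\<close>

definition fraction :: "('a, 'b) ring_scheme \<Rightarrow> 'a set \<Rightarrow> 'a \<Rightarrow> 'a \<Rightarrow> ('a \<times> 'a) set"
  where "fraction R U a s =
    {(b, t). b \<in> carrier R \<and> t \<in> U \<and>
      (\<exists>u\<in>U. u \<otimes>\<^bsub>R\<^esub> (t \<otimes>\<^bsub>R\<^esub> a) = u \<otimes>\<^bsub>R\<^esub> (s \<otimes>\<^bsub>R\<^esub> b))}"

text \<open>The elements of \<open>U\<^sup>-\<^sup>1 R\<close> are the equivalence classes \<open>fraction R U a s\<close>; the unions lift
  the operations on representatives to classes, each union being over equal sets.\<close>

definition ring_of_fractions :: "('a, 'b) ring_scheme \<Rightarrow> 'a set \<Rightarrow> ('a \<times> 'a) set ring"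
  where "ring_of_fractions R U =
    \<lparr>carrier = {fraction R U a s | a s. a \<in> carrier R \<and> s \<in> U},
     mult = (\<lambda>X Y. \<Union>(a, s)\<in>X. \<Union>(b, t)\<in>Y. fraction R U (a \<otimes>\<^bsub>R\<^esub> b) (s \<otimes>\<^bsub>R\<^esub> t)),
     one = fraction R U \<one>\<^bsub>R\<^esub> \<one>\<^bsub>R\<^esub>,
     zero = fraction R U \<zero>\<^bsub>R\<^esub> \<one>\<^bsub>R\<^esub>,
     add = (\<lambda>X Y. \<Union>(a, s)\<in>X. \<Union>(b, t)\<in>Y.
       fraction R U ((t \<otimes>\<^bsub>R\<^esub> a) \<oplus>\<^bsub>R\<^esub> (s \<otimes>\<^bsub>R\<^esub> b)) (s \<otimes>\<^bsub>R\<^esub> t))\<rparr>"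

locale mult_closed = cring R for R (structure) +
  fixes U
  assumes U_sub: "U \<subseteq> carrier R" and one_U: "\<one> \<in> U"
    and mult_U: "\<lbrakk>s \<in> U; t \<in> U\<rbrakk> \<Longrightarrow> s \<otimes> t \<in> U"
begin

lemma U_carr [simp]: "s \<in> U \<Longrightarrow> s \<in> carrier R" using U_sub by blast

lemma frac_iff: "(b, t) \<in> fraction R U a s \<longleftrightarrow>
   b \<in> carrier R \<and> t \<in> U \<and> (\<exists>u\<in>U. u \<otimes> (t \<otimes> a) = u \<otimes> (s \<otimes> b))"
  by (auto simp: fraction_def)

lemma frac_subset:
  assumes a: "a \<in> carrier R" "s \<in> U" and b: "b \<in> carrier R" "t \<in> U"
    and u: "u \<in> U" "u \<otimes> (t \<otimes> a) = u \<otimes> (s \<otimes> b)"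
  shows "fraction R U a s \<subseteq> fraction R U b t"
proof
  fix z assume "z \<in> fraction R U a s"
  then obtain c r v where z: "z = (c, r)" "c \<in> carrier R" "r \<in> U" "v \<in> U"
    "v \<otimes> (r \<otimes> a) = v \<otimes> (s \<otimes> c)" by (cases z) (auto simp: frac_iff)
  note [simp] = a b u(1) z(2-4)
  have "(u \<otimes> v \<otimes> s) \<otimes> (r \<otimes> b) = (v \<otimes> r) \<otimes> (u \<otimes> (s \<otimes> b))"
    by (simp add: m_ac)
  also have "\<dots> = (u \<otimes> t) \<otimes> (v \<otimes> (r \<otimes> a))" unfolding u(2)[symmetric] by (simp add: m_ac)
  also have "\<dots> = (u \<otimes> v \<otimes> s) \<otimes> (t \<otimes> c)" unfolding z(5) by (simp add: m_ac)
  finally show "z \<in> fraction R U b t" unfolding z(1) frac_iff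
    using mult_U[OF mult_U[OF u(1) z(4)] a(2)] z by blast
qed

lemma frac_eq:
  assumes a: "a \<in> carrier R" "s \<in> U" and b: "b \<in> carrier R" "t \<in> U"
    and u: "u \<in> U" "u \<otimes> (t \<otimes> a) = u \<otimes> (s \<otimes> b)"
  shows "fraction R U a s = fraction R U b t"
  using frac_subset[OF a b u] frac_subset[OF b a u(1) u(2)[symmetric]] by blast

lemma frac_eqI:
  assumes a: "a \<in> carrier R" "s \<in> U" and b: "b \<in> carrier R" "t \<in> U"
    and u: "t \<otimes> a = s \<otimes> b"
  shows "fraction R U a s = fraction R U b t"
  by (rule frac_eq[OF a b one_U]) (simp add: u)

lemma frac_self: "a \<in> carrier R \<Longrightarrow> s \<in> U \<Longrightarrow> (a, s) \<in> fraction R U a s"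
  using one_U by (auto simp: frac_iff)

lemma const_Union:
  assumes "(a, s) \<in> X" "(b, t) \<in> Y"
    and "\<And>a s b t. (a, s) \<in> X \<Longrightarrow> (b, t) \<in> Y \<Longrightarrow> f a s b t = C"
  shows "(\<Union>(a, s)\<in>X. \<Union>(b, t)\<in>Y. f a s b t) = C"
proof (rule SUP_eq_const)
  show "X \<noteq> {}" using assms(1) by blast
  show "(case p of (a, s) \<Rightarrow> \<Union>(b, t)\<in>Y. f a s b t) = C" if p: "p \<in> X" for p
  proof (cases p)
    case (Pair a s)
    have "(\<Union>(b, t)\<in>Y. f a s b t) = C"
    proof (rule SUP_eq_const)
      show "Y \<noteq> {}" using assms(2) by blast
      show "(case q of (b, t) \<Rightarrow> f a s b t) = C" if "q \<in> Y" for q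
        using that p Pair assms(3) by (cases q) simp
    qed
    thus ?thesis using Pair by simp
  qed
qed

lemma frac_mult:
  assumes a: "a \<in> carrier R" "s \<in> U" and b: "b \<in> carrier R" "t \<in> U"
  shows "fraction R U a s \<otimes>\<^bsub>ring_of_fractions R U\<^esub> fraction R U b t = fraction R U (a \<otimes> b) (s \<otimes> t)"
proof -
  have *: "fraction R U (a' \<otimes> b') (s' \<otimes> t') = fraction R U (a \<otimes> b) (s \<otimes> t)"
    if h: "(a',s') \<in> fraction R U a s" "(b',t') \<in> fraction R U b t" for a' s' b' t'
  proof -
    from h obtain u v where h1: "a' \<in> carrier R" "s' \<in> U" "b' \<in> carrier R" "t' \<in> U" "u \<in> U" "v \<in> U"
      and e: "u \<otimes> (s' \<otimes> a) = u \<otimes> (s \<otimes> a')" "v \<otimes> (t' \<otimes> b) = v \<otimes> (t \<otimes> b')" by (auto simp: frac_iff)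
    note [simp] = a b h1
    have "u \<otimes> v \<otimes> ((s \<otimes> t) \<otimes> (a' \<otimes> b')) = (u \<otimes> (s \<otimes> a')) \<otimes> (v \<otimes> (t \<otimes> b'))" by (simp add: m_ac)
    also have "\<dots> = u \<otimes> v \<otimes> ((s' \<otimes> t') \<otimes> (a \<otimes> b))" unfolding e[symmetric] by (simp add: m_ac)
    finally show ?thesis
      by (intro frac_eq[where u = "u \<otimes> v"]) (auto intro: mult_U)
  qed
  show ?thesis
    unfolding ring_of_fractions_def
    by (simp, rule const_Union[OF frac_self[OF a] frac_self[OF b]]) (rule *)
qed

lemma frac_add:
  assumes a: "a \<in> carrier R" "s \<in> U" and b: "b \<in> carrier R" "t \<in> U"
  shows "fraction R U a s \<oplus>\<^bsub>ring_of_fractions R U\<^esub> fraction R U b t =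
    fraction R U ((t \<otimes> a) \<oplus> (s \<otimes> b)) (s \<otimes> t)"
proof -
  have *: "fraction R U ((t' \<otimes> a') \<oplus> (s' \<otimes> b')) (s' \<otimes> t') =
      fraction R U ((t \<otimes> a) \<oplus> (s \<otimes> b)) (s \<otimes> t)"
    if h: "(a',s') \<in> fraction R U a s" "(b',t') \<in> fraction R U b t" for a' s' b' t'
  proof -
    from h obtain u v where h1: "a' \<in> carrier R" "s' \<in> U" "b' \<in> carrier R" "t' \<in> U" "u \<in> U" "v \<in> U"
      and e: "u \<otimes> (s' \<otimes> a) = u \<otimes> (s \<otimes> a')" "v \<otimes> (t' \<otimes> b) = v \<otimes> (t \<otimes> b')" by (auto simp: frac_iff)
    note [simp] = a b h1
    have "u \<otimes> v \<otimes> ((s \<otimes> t) \<otimes> ((t' \<otimes> a') \<oplus> (s' \<otimes> b')))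
      = (v \<otimes> t \<otimes> t') \<otimes> (u \<otimes> (s \<otimes> a')) \<oplus> (u \<otimes> s \<otimes> s') \<otimes> (v \<otimes> (t \<otimes> b'))"
      by (simp add: m_ac r_distr)
    also have "\<dots> = u \<otimes> v \<otimes> ((s' \<otimes> t') \<otimes> ((t \<otimes> a) \<oplus> (s \<otimes> b)))"
      unfolding e[symmetric] by (simp add: m_ac r_distr)
    finally show ?thesis
      by (intro frac_eq[where u = "u \<otimes> v"]) (auto intro: mult_U)
  qed
  show ?thesis
    unfolding ring_of_fractions_def
    by (simp, rule const_Union[OF frac_self[OF a] frac_self[OF b]]) (rule *)
qed

lemma frac_cases:
  assumes "X \<in> carrier (ring_of_fractions R U)"
  obtains a s where "a \<in> carrier R" "s \<in> U" "X = fraction R U a s"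
  using assms by (auto simp: ring_of_fractions_def)

lemma frac_carr: "a \<in> carrier R \<Longrightarrow> s \<in> U \<Longrightarrow> fraction R U a s \<in> carrier (ring_of_fractions R U)"
  by (auto simp: ring_of_fractions_def)

lemma frac_one: "\<one>\<^bsub>ring_of_fractions R U\<^esub> = fraction R U \<one> \<one>"
  and frac_zero: "\<zero>\<^bsub>ring_of_fractions R U\<^esub> = fraction R U \<zero> \<one>"
  by (simp_all add: ring_of_fractions_def)

lemma ring_of_fractions_cring: "cring (ring_of_fractions R U)"
proof (rule cringI)
  let ?Q = "ring_of_fractions R U"
  note [simp] = frac_add frac_mult frac_one frac_zero one_U mult_U
  show "abelian_group ?Q"
  proof (rule abelian_groupI)
    show "x \<oplus>\<^bsub>?Q\<^esub> y \<in> carrier ?Q" if "x \<in> carrier ?Q" "y \<in> carrier ?Q" for x y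
      using that by (elim frac_cases) (simp add: frac_carr)
    show "\<zero>\<^bsub>?Q\<^esub> \<in> carrier ?Q" by (simp add: frac_carr)
    show "(x \<oplus>\<^bsub>?Q\<^esub> y) \<oplus>\<^bsub>?Q\<^esub> z = x \<oplus>\<^bsub>?Q\<^esub> (y \<oplus>\<^bsub>?Q\<^esub> z)"
      if "x \<in> carrier ?Q" "y \<in> carrier ?Q" "z \<in> carrier ?Q" for x y z
      using that by (elim frac_cases) (simp, rule frac_eqI, auto simp: r_distr m_ac a_ac)
    show "x \<oplus>\<^bsub>?Q\<^esub> y = y \<oplus>\<^bsub>?Q\<^esub> x" if "x \<in> carrier ?Q" "y \<in> carrier ?Q" for x y
      using that by (elim frac_cases) (simp, rule frac_eqI, auto simp: r_distr m_ac a_ac)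
    show "\<zero>\<^bsub>?Q\<^esub> \<oplus>\<^bsub>?Q\<^esub> x = x" if "x \<in> carrier ?Q" for x
      using that by (elim frac_cases) (simp)
    show "\<exists>y\<in>carrier ?Q. y \<oplus>\<^bsub>?Q\<^esub> x = \<zero>\<^bsub>?Q\<^esub>" if "x \<in> carrier ?Q" for x
    proof -
      from that obtain a s where x: "a \<in> carrier R" "s \<in> U" "x = fraction R U a s" by (elim frac_cases)
      have "fraction R U (\<ominus> a) s \<oplus>\<^bsub>?Q\<^esub> x = \<zero>\<^bsub>?Q\<^esub>"
        using x by simp (rule frac_eqI, auto simp: r_minus l_neg)
      thus ?thesis using x frac_carr[of "\<ominus> a" s] by blast
    qed
  qed
  show "comm_monoid ?Q"
  proof (rule comm_monoidI)
    show "x \<otimes>\<^bsub>?Q\<^esub> y \<in> carrier ?Q" if "x \<in> carrier ?Q" "y \<in> carrier ?Q" for x y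
      using that by (elim frac_cases) (simp add: frac_carr)
    show "\<one>\<^bsub>?Q\<^esub> \<in> carrier ?Q" by (simp add: frac_carr)
    show "(x \<otimes>\<^bsub>?Q\<^esub> y) \<otimes>\<^bsub>?Q\<^esub> z = x \<otimes>\<^bsub>?Q\<^esub> (y \<otimes>\<^bsub>?Q\<^esub> z)"
      if "x \<in> carrier ?Q" "y \<in> carrier ?Q" "z \<in> carrier ?Q" for x y z
      using that by (elim frac_cases) (simp add: m_assoc)
    show "x \<otimes>\<^bsub>?Q\<^esub> y = y \<otimes>\<^bsub>?Q\<^esub> x" if "x \<in> carrier ?Q" "y \<in> carrier ?Q" for x y
      using that by (elim frac_cases) (simp add: m_comm)
    show "\<one>\<^bsub>?Q\<^esub> \<otimes>\<^bsub>?Q\<^esub> x = x" if "x \<in> carrier ?Q" for x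
      using that by (elim frac_cases) simp
  qed
  show "(x \<oplus>\<^bsub>?Q\<^esub> y) \<otimes>\<^bsub>?Q\<^esub> z = x \<otimes>\<^bsub>?Q\<^esub> z \<oplus>\<^bsub>?Q\<^esub> y \<otimes>\<^bsub>?Q\<^esub> z"
    if "x \<in> carrier ?Q" "y \<in> carrier ?Q" "z \<in> carrier ?Q" for x y z
    using that by (elim frac_cases) (simp, rule frac_eqI, auto simp: r_distr l_distr m_ac)
qed
end

definition localization_at :: "('a, 'b) ring_scheme \<Rightarrow> 'a set \<Rightarrow> ('a \<times> 'a) set ring"
  where "localization_at R P = ring_of_fractions R (carrier R - P)"

definition krull_dim :: "('a, 'b) ring_scheme \<Rightarrow> enat"
  where "krull_dim R = Sup {enat n | n.
    \<exists>P. (\<forall>i\<le>n. primeideal (P i) R) \<and> (\<forall>i<n. P i \<subset> P (Suc i))}"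

definition radical :: "('a, 'b) ring_scheme \<Rightarrow> 'a set \<Rightarrow> 'a set"
  where "radical R I = {r \<in> carrier R. \<exists>n::nat. r [^]\<^bsub>R\<^esub> n \<in> I}"

definition colon :: "('a, 'b) ring_scheme \<Rightarrow> 'a set \<Rightarrow> 'a \<Rightarrow> 'a set"
  where "colon R I x = {r \<in> carrier R. r \<otimes>\<^bsub>R\<^esub> x \<in> I}"

definition noetherian_local_ring :: "('a, 'b) ring_scheme \<Rightarrow> 'a set \<Rightarrow> bool"
  where "noetherian_local_ring R \<mm> \<longleftrightarrow>
    cring R \<and> noetherian_ring R \<and> maximalideal \<mm> R \<and> (\<forall>J. maximalideal J R \<longrightarrow> J = \<mm>)"

text \<open>\<open>dim R\<close> elements of \<open>\<mm>\<close> that generate an \<open>\<mm>\<close>-primary ideal; as \<open>\<mm>\<close> is maximal, being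
  \<open>\<mm>\<close>-primary means having radical \<open>\<mm>\<close>.\<close>

definition system_of_parameters :: "('a, 'b) ring_scheme \<Rightarrow> 'a set \<Rightarrow> 'a list \<Rightarrow> bool"
  where "system_of_parameters R \<mm> xs \<longleftrightarrow>
    enat (length xs) = krull_dim R \<and> set xs \<subseteq> \<mm> \<and> radical R (Idl\<^bsub>R\<^esub> (set xs)) = \<mm>"

definition buchsbaum_ring :: "('a, 'b) ring_scheme \<Rightarrow> bool"
  where "buchsbaum_ring R \<longleftrightarrow> (\<exists>\<mm>. noetherian_local_ring R \<mm> \<and>
    (\<forall>xs. system_of_parameters R \<mm> xs \<longrightarrow>
      (\<forall>i<length xs.
        \<mm> \<cdot>\<^bsub>R\<^esub> colon R (Idl\<^bsub>R\<^esub> (set (take i xs))) (xs ! i) \<subseteq> Idl\<^bsub>R\<^esub> (set (take i xs)))))"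


section \<open>Semigroup rings\<close>

definition monomial :: "'a \<Rightarrow> 'a \<Rightarrow>\<^sub>0 'k::field"
  where "monomial a = Poly_Mapping.single a 1"

text \<open>\<open>\<bbbK>[t\<^sub>1,\<dots>,t\<^sub>d]\<close> is the type \<open>nat ^ 'd \<Rightarrow>\<^sub>0 'k\<close> with its convolution product.\<close>

definition semigroup_ring :: "(nat ^ 'd) set \<Rightarrow> (nat ^ 'd \<Rightarrow>\<^sub>0 'k::field) ring"
  where "semigroup_ring S =
    \<lparr>carrier = {p. Poly_Mapping.keys p \<subseteq> S}, mult = (*), one = 1, zero = 0, add = (+)\<rparr>"

lemma semigroup_ring_cring:
  assumes "add_submonoid S"
  shows "cring (semigroup_ring S :: (nat ^ 'd \<Rightarrow>\<^sub>0 'k::field) ring)"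
proof -
  have k: "Poly_Mapping.keys (p * q) \<subseteq> S" if "Poly_Mapping.keys p \<subseteq> S" "Poly_Mapping.keys q \<subseteq> S"
    for p q :: "nat ^ 'd \<Rightarrow>\<^sub>0 'k"
  proof
    fix x assume "x \<in> Poly_Mapping.keys (p * q)"
    then obtain a b where "x = a + b" "a \<in> Poly_Mapping.keys p" "b \<in> Poly_Mapping.keys q"
      using keys_mult[of p q] by blast
    thus "x \<in> S" using that assms by (auto simp: add_submonoid_def)
  qed
  have a: "Poly_Mapping.keys (p + q) \<subseteq> S" if "Poly_Mapping.keys p \<subseteq> S" "Poly_Mapping.keys q \<subseteq> S"
    for p q :: "nat ^ 'd \<Rightarrow>\<^sub>0 'k"
    using Poly_Mapping.keys_add[of p q] that by blast
  have 0: "0 \<in> S" using assms by (simp add: add_submonoid_def)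
  let ?R = "semigroup_ring S :: (nat ^ 'd \<Rightarrow>\<^sub>0 'k) ring"
  have m: "Poly_Mapping.keys (- p) \<subseteq> S" if "Poly_Mapping.keys p \<subseteq> S" for p :: "nat ^ 'd \<Rightarrow>\<^sub>0 'k"
    using that by (simp add: keys_minus)
  show ?thesis
  proof (rule cringI)
    show "abelian_group ?R"
    proof (rule abelian_groupI)
      show "\<exists>y\<in>carrier ?R. y \<oplus>\<^bsub>?R\<^esub> x = \<zero>\<^bsub>?R\<^esub>" if "x \<in> carrier ?R" for x
        by (rule bexI[of _ "- x"]) (use that m in \<open>simp_all add: semigroup_ring_def\<close>)
    qed (simp_all add: semigroup_ring_def a add.assoc add.commute)
    show "comm_monoid ?R"
      by (rule comm_monoidI) (simp_all add: semigroup_ring_def k 0 mult.assoc mult.commute)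
  qed (simp add: semigroup_ring_def distrib_right)
qed

definition maximal_homogeneous_ideal :: "(nat ^ 'd) set \<Rightarrow> (nat ^ 'd \<Rightarrow>\<^sub>0 'k::field) set"
  where "maximal_homogeneous_ideal S = Idl\<^bsub>semigroup_ring S\<^esub> (monomial ` (S - {0}))"

definition buchsbaum_semigroup :: "'k::field itself \<Rightarrow> (nat ^ 'd) set \<Rightarrow> bool"
  where "buchsbaum_semigroup K S \<longleftrightarrow>
    buchsbaum_ring (localization_at
      (semigroup_ring S :: (nat ^ 'd \<Rightarrow>\<^sub>0 'k) ring) (maximal_homogeneous_ideal S))"


section \<open>The defining ideal\<close>

text \<open>The variables \<open>x\<^sub>i\<close> are indexed by the minimal generators \<open>a\<^sub>i\<close> themselves: a monomial is a
  finitely supported exponent function \<open>nat ^ 'd \<Rightarrow>\<^sub>0 nat\<close> whose support lies in \<open>msg S\<close>.\<close>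

definition presentation_ring :: "(nat ^ 'd) set \<Rightarrow> ((nat ^ 'd \<Rightarrow>\<^sub>0 nat) \<Rightarrow>\<^sub>0 'k::field) ring"
  where "presentation_ring S =
    \<lparr>carrier = {p. \<forall>u\<in>Poly_Mapping.keys p. Poly_Mapping.keys u \<subseteq> msg S},
     mult = (*), one = 1, zero = 0, add = (+)\<rparr>"

definition presentation_map :: "((nat ^ 'd \<Rightarrow>\<^sub>0 nat) \<Rightarrow>\<^sub>0 'k::field) \<Rightarrow> (nat ^ 'd \<Rightarrow>\<^sub>0 'k)"
  where "presentation_map p =
    (\<Sum>u\<in>Poly_Mapping.keys p. Poly_Mapping.single 0 (Poly_Mapping.lookup p u) *
      (\<Prod>a\<in>Poly_Mapping.keys u. monomial a ^ Poly_Mapping.lookup u a))"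

definition defining_ideal :: "(nat ^ 'd) set \<Rightarrow> ((nat ^ 'd \<Rightarrow>\<^sub>0 nat) \<Rightarrow>\<^sub>0 'k::field) set"
  where "defining_ideal S = a_kernel (presentation_ring S) (semigroup_ring S) presentation_map"

definition semigroup_degree :: "(nat ^ 'd \<Rightarrow>\<^sub>0 nat) \<Rightarrow> nat ^ 'd"
  where "semigroup_degree u = (\<Sum>a\<in>Poly_Mapping.keys u. Poly_Mapping.lookup u a *s a)"

definition homogeneous :: "((nat ^ 'd \<Rightarrow>\<^sub>0 nat) \<Rightarrow>\<^sub>0 'k::field) \<Rightarrow> bool"
  where "homogeneous p \<longleftrightarrow> (\<exists>s. \<forall>u\<in>Poly_Mapping.keys p. semigroup_degree u = s)"

definition minimal_homogeneous_generators ::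
    "(nat ^ 'd) set \<Rightarrow> ((nat ^ 'd \<Rightarrow>\<^sub>0 nat) \<Rightarrow>\<^sub>0 'k::field) set \<Rightarrow> bool"
  where "minimal_homogeneous_generators S F \<longleftrightarrow>
    F \<subseteq> carrier (presentation_ring S) \<and> (\<forall>f\<in>F. homogeneous f) \<and>
    Idl\<^bsub>presentation_ring S\<^esub> F = defining_ideal S \<and>
    (\<forall>F'. F' \<subset> F \<longrightarrow> Idl\<^bsub>presentation_ring S\<^esub> F' \<noteq> defining_ideal S)"

text \<open>By the graded Nakayama lemma all minimal sets of homogeneous generators are finite and
  equinumerous, so the description is definite.\<close>

definition mu :: "'k::field itself \<Rightarrow> (nat ^ 'd) set \<Rightarrow> nat"
  where "mu K S = (THE r. \<exists>F :: ((nat ^ 'd \<Rightarrow>\<^sub>0 nat) \<Rightarrow>\<^sub>0 'k) set.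
    minimal_homogeneous_generators S F \<and> finite F \<and> card F = r)"

end

theory Submission
  imports Defs
begin

text \<open>
  Write \<open>e\<^sub>i\<close> for the minimal extremal rays of \<open>S\<close> and \<open>C\<close> for the lattice points of its cone. The
  \<open>e\<^sub>i\<close> are a basis of \<open>\<rat>\<^sup>d\<close>, so every point of \<open>C\<close> is uniquely \<open>w + \<Sum> n\<^sub>i e\<^sub>i\<close> with \<open>w\<close> in the
  half-open parallelepiped \<open>0 \<le> L\<^sub>i < 1\<close>, where \<open>L\<close> denotes coordinates in this basis.

  For \<open>d \<ge> 2\<close> the Buchsbaum property forces \<open>h + s \<in> S\<close> for every gap \<open>h\<close> and every nonzero
  \<open>s \<in> S\<close> (\<open>buchsbaum_gap_shift\<close>). To see this, take the monomials \<open>t\<close> to the \<open>N e\<^sub>i\<close> as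
  parameters. For large \<open>N\<close> both \<open>h + N e\<^sub>0\<close> and \<open>h + N e\<^sub>1\<close> lie in \<open>S\<close>, so the monomial of
  \<open>h + N e\<^sub>0\<close> lies in the colon ideal of the first two parameters; multiplied by the monomial of
  \<open>s\<close> it must be divisible by the first parameter, and this says \<open>h + s \<in> S\<close>. That these monomials
  form a system of parameters requires that the local ring has dimension exactly \<open>d\<close>: the ideals of
  the faces of the cone give a chain of \<open>d\<close> steps, and a longer chain would yield more than \<open>d\<close>
  algebraically independent polynomials in \<open>d\<close> variables.

  Hence every gap lies in the parallelepiped, and the nonzero elements of the Apery set, which are
  the generators other than the \<open>e\<^sub>i\<close> by maximal embedding dimension, are the nonzero points of
  \<open>S\<close> in the parallelepiped together with the sums \<open>h + e\<^sub>i\<close>. Over the polynomial ring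
  \<open>A = K[x\<^sub>1,\<dots>,x\<^sub>d]\<close> of the rays, \<open>K[S]\<close> is thus a direct sum of copies of \<open>A\<close> and of one copy of
  the maximal ideal of \<open>A\<close> for each gap. The relations of \<open>S\<close> are therefore of two kinds: each of
  the \<open>m(m+1)/2\<close> products of two generators outside the rays is rewritten to a normal form, and each
  gap contributes the \<open>d(d-1)/2\<close> syzygies of the maximal ideal. If \<open>d = 1\<close>, the second kind is
  absent and each class modulo \<open>e\<^sub>1\<close> contains one element of the Apery set. The locale
  \<open>layered_semigroup\<close> covers both situations.

  These relations are minimal because their left sides are products of two minimal generators. Such
  a product is the only factorization in its connected component, so its coefficient is a linear
  functional on the defining ideal that vanishes on the product of this ideal with the irrelevant
  ideal. The relations and these functionals are dual bases, and the graded Nakayama lemma shows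
  that all minimal homogeneous generating sets have the same size (\<open>card_minimal_generators\<close>).
\<close>

section \<open>Coefficients and supports of polynomials\<close>

abbreviation "keys \<equiv> Poly_Mapping.keys"
abbreviation "lookup \<equiv> Poly_Mapping.lookup"
abbreviation "single \<equiv> Poly_Mapping.single"

lemma lookup_scale: "lookup (single 0 c * p) x = c * lookup p x"
  for p :: "'a::monoid_add \<Rightarrow>\<^sub>0 'k::field"
  by (simp flip: mult_map_scale_conv_mult add: Poly_Mapping.map.rep_eq when_def)

lemma keys_subset_diff:
  "keys p \<subseteq> A \<Longrightarrow> keys q \<subseteq> A \<Longrightarrow> keys (p - q) \<subseteq> A"
  for p q :: "'a \<Rightarrow>\<^sub>0 'k::field"
  using keys_diff[of p q] by blast

definition restrict_keys :: "('a \<Rightarrow> bool) \<Rightarrow> ('a \<Rightarrow>\<^sub>0 'k) \<Rightarrow> ('a \<Rightarrow>\<^sub>0 'k::field)"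
  where "restrict_keys P = Poly_Mapping.mapp (\<lambda>k c. c when P k)"

lemma lookup_restrict_keys: "lookup (restrict_keys P p) k = (lookup p k when P k)"
  by (auto simp: restrict_keys_def lookup_mapp when_def in_keys_iff)

lemma keys_restrict_keys: "keys (restrict_keys P p) = {k \<in> keys p. P k}"
  by (auto simp: in_keys_iff lookup_restrict_keys)

lemma restrict_keys_split: "p = restrict_keys P p + restrict_keys (\<lambda>k. \<not> P k) p"
  by (rule poly_mapping_eqI) (auto simp: lookup_add lookup_restrict_keys when_def)

lemma restrict_keys_sum: "restrict_keys P (\<Sum>i\<in>I. f i) = (\<Sum>i\<in>I. restrict_keys P (f i))"
  by (rule poly_mapping_eqI) (auto simp: lookup_sum lookup_restrict_keys when_def)

lemma restrict_keys_id: "(\<And>k. k \<in> keys p \<Longrightarrow> P k) \<Longrightarrow> restrict_keys P p = p"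
  by (rule poly_mapping_eqI) (auto simp: lookup_restrict_keys when_def in_keys_iff)

lemma restrict_keys_none: "(\<And>k. k \<in> keys p \<Longrightarrow> \<not> P k) \<Longrightarrow> restrict_keys P p = 0"
  by (rule poly_mapping_eqI) (auto simp: lookup_restrict_keys when_def in_keys_iff)

lemma restrict_keys_add: "restrict_keys P (f + g) = restrict_keys P f + restrict_keys P g"
  by (rule poly_mapping_eqI) (auto simp: lookup_add lookup_restrict_keys when_def)

lemma poly_mapping_sum_single: "p = (\<Sum>u\<in>keys p. single u (lookup p u))"
  for p :: "'a \<Rightarrow>\<^sub>0 'k::field"
proof (rule poly_mapping_eqI)
  fix k
  have "(\<Sum>u\<in>keys p. lookup p u when u = k)
      = (\<Sum>u\<in>keys p. if k = u then lookup p u else 0)"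
    by (intro sum.cong) (auto simp: when_def)
  thus "lookup p k = lookup (\<Sum>u\<in>keys p. single u (lookup p u)) k"
    by (simp add: lookup_sum lookup_single sum.delta' in_keys_iff)
qed

lemma lookup_times_single:
  fixes p :: "'a::cancel_comm_monoid_add \<Rightarrow>\<^sub>0 'k::field"
  shows "lookup (p * single v c) (u + v) = lookup p u * c"
proof -
  let ?r = "restrict_keys (\<lambda>w. w \<noteq> u) p"
  have "u + v \<notin> keys (?r * single v c)"
    using keys_mult[of ?r "single v c"] by (auto simp: keys_restrict_keys split: if_splits)
  moreover have "p = single u (lookup p u) + ?r"
    by (rule poly_mapping_eqI) (auto simp: lookup_add lookup_restrict_keys when_def lookup_single)
  hence "p * single v c = single u (lookup p u) * single v c
      + ?r * single v c"
    by (metis distrib_right)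
  ultimately show ?thesis by (simp add: lookup_add mult_single in_keys_iff)
qed

lemma lookup_mult_unique_pair:
  fixes p q :: "'a::cancel_comm_monoid_add \<Rightarrow>\<^sub>0 'k::field"
  assumes uniq: "\<And>a b. a \<in> keys p \<Longrightarrow> b \<in> keys q \<Longrightarrow> a + b = a0 + b0 \<Longrightarrow> a = a0"
  shows "lookup (p * q) (a0 + b0) = lookup p a0 * lookup q b0"
proof -
  let ?r = "restrict_keys (\<lambda>u. u \<noteq> a0) p"
  have "a0 + b0 \<notin> keys (?r * q)"
  proof
    assume "a0 + b0 \<in> keys (?r * q)"
    then obtain u v where "a0 + b0 = u + v" "u \<in> keys ?r" "v \<in> keys q"
      using keys_mult by blast
    thus False using uniq[of u v] by (simp add: keys_restrict_keys)
  qed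
  moreover have "p = single a0 (lookup p a0) + ?r"
    by (rule poly_mapping_eqI) (auto simp: lookup_add lookup_restrict_keys when_def lookup_single)
  hence "p * q = single a0 (lookup p a0) * q + ?r * q"
    by (metis distrib_right)
  moreover have "lookup (single a0 (lookup p a0) * q) (a0 + b0)
      = lookup p a0 * lookup q b0"
    using lookup_times_single[of q a0 "lookup p a0" b0] by (simp add: ac_simps)
  ultimately show ?thesis by (simp add: lookup_add in_keys_iff)
qed

lemma lookup_mult_unit_factor:
  fixes p q :: "'a::cancel_comm_monoid_add \<Rightarrow>\<^sub>0 'k::field"
  assumes "\<And>u v. u \<in> keys p \<Longrightarrow> v \<in> keys q \<Longrightarrow> u + v = x \<Longrightarrow> u = 0"
  shows "lookup (p * q) x = lookup p 0 * lookup q x"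
  using lookup_mult_unique_pair[of p q 0 x] assms by simp

interpretation coeff_space: vector_space "\<lambda>c p. single 0 c * p ::
    'a::comm_monoid_add \<Rightarrow>\<^sub>0 'k::field"
  by unfold_locales (simp_all add: distrib_left distrib_right single_add mult_single flip: mult.assoc)

lemma in_coeff_span:
  fixes p :: "'a::comm_monoid_add \<Rightarrow>\<^sub>0 'k::field"
  assumes "keys p \<subseteq> A"
  shows "p \<in> coeff_space.span ((\<lambda>u. single u 1) ` A)"
proof -
  have "p = (\<Sum>u\<in>keys p. single 0 (lookup p u) * single u 1)"
    using poly_mapping_sum_single[of p] by (simp add: mult_single)
  also have "\<dots> \<in> coeff_space.span ((\<lambda>u. single u 1) ` A)"
    using assms by (intro coeff_space.span_sum coeff_space.span_scale coeff_space.span_base) auto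
  finally show ?thesis .
qed

lemma vec_nat_add_eq_0_iff: "x + y = 0 \<longleftrightarrow> x = 0 \<and> y = 0" for x y :: "nat ^ 'd"
  by (auto simp: vec_eq_iff)

lemma add_submonoid_sum:
  "add_submonoid S \<Longrightarrow> (\<And>i. i \<in> I \<Longrightarrow> f i \<in> S) \<Longrightarrow> (\<Sum>i\<in>I. f i) \<in> S"
  for f :: "'a \<Rightarrow> nat ^ 'd"
  by (induction I rule: infinite_finite_induct) (auto simp: add_submonoid_def)

lemma smult_vec_nat_eq_sum: "n *s x = (\<Sum>k<n. x)" for x :: "nat ^ 'd"
  by (induction n) (simp_all add: vec_eq_iff algebra_simps del: sum_constant)

lemma add_submonoid_smult: "add_submonoid S \<Longrightarrow> x \<in> S \<Longrightarrow> n *s x \<in> S" for x :: "nat ^ 'd"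
  unfolding smult_vec_nat_eq_sum by (rule add_submonoid_sum)

section \<open>Rings of polynomials with restricted support\<close>

lemma (in cring) idealI_comm:
  assumes "J \<subseteq> carrier R" "\<zero> \<in> J" "\<And>x y. x \<in> J \<Longrightarrow> y \<in> J \<Longrightarrow> x \<oplus> y \<in> J"
    and mult: "\<And>r x. r \<in> carrier R \<Longrightarrow> x \<in> J \<Longrightarrow> r \<otimes> x \<in> J"
  shows "ideal J R"
proof (rule idealI)
  show "ring R" by unfold_locales
  have minus: "\<ominus> x \<in> J" if "x \<in> J" for x
  proof -
    have "\<ominus> x = (\<ominus> \<one>) \<otimes> x" using that assms(1) by (simp add: l_minus subset_iff)
    thus ?thesis using mult[of "\<ominus> \<one>" x] that by simp
  qed
  show "subgroup J (add_monoid R)"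
    using assms minus by (intro subgroup.intro) (auto simp: a_inv_def)
  show "x \<otimes> r \<in> J" "r \<otimes> x \<in> J" if "x \<in> J" "r \<in> carrier R" for x r
    using mult[OF that(2,1)] that assms(1) m_comm[of x r] by auto
qed

text \<open>The semigroup ring and the presentation ring are both of this form, for the submonoids \<open>S\<close> and
  the monomials in the minimal generators.\<close>

definition supported_ring :: "'a::comm_monoid_add set \<Rightarrow> ('a \<Rightarrow>\<^sub>0 'k::field) ring"
  where "supported_ring M =
    \<lparr>carrier = {p. keys p \<subseteq> M}, mult = (*), one = 1, zero = 0, add = (+)\<rparr>"

lemma supported_ring_simps [simp]:
  "mult (supported_ring M) = (*)" "one (supported_ring M) = 1"
  "zero (supported_ring M) = 0" "add (supported_ring M) = (+)"
  "p \<in> carrier (supported_ring M) \<longleftrightarrow> keys p \<subseteq> M"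
  by (simp_all add: supported_ring_def)

lemma semigroup_ring_eq: "semigroup_ring S = supported_ring S"
  by (simp add: semigroup_ring_def supported_ring_def)

lemma presentation_ring_eq: "presentation_ring S = supported_ring {u. keys u \<subseteq> msg S}"
  by (auto simp: presentation_ring_def supported_ring_def)

locale supported =
  fixes M :: "'a::cancel_comm_monoid_add set" and R :: "('a \<Rightarrow>\<^sub>0 'k::field) ring"
  defines "R \<equiv> supported_ring M"
  assumes M0: "0 \<in> M" and M_add: "x \<in> M \<Longrightarrow> y \<in> M \<Longrightarrow> x + y \<in> M"
begin

lemma R_simps [simp]: "mult R = (*)" "one R = 1" "zero R = 0" "add R = (+)"
  and carrier_R: "p \<in> carrier R \<longleftrightarrow> keys p \<subseteq> M"
  by (simp_all add: R_def)

lemma add_carrier [intro]: "p \<in> carrier R \<Longrightarrow> q \<in> carrier R \<Longrightarrow> p + q \<in> carrier R"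
  using Poly_Mapping.keys_add[of p q] by (auto simp: carrier_R)

lemma mult_carrier [intro]: "p \<in> carrier R \<Longrightarrow> q \<in> carrier R \<Longrightarrow> p * q \<in> carrier R"
  using keys_mult[of p q] M_add by (fastforce simp: carrier_R)

lemma uminus_carrier [intro]: "p \<in> carrier R \<Longrightarrow> - p \<in> carrier R"
  by (simp add: carrier_R keys_minus)

lemma diff_carrier [intro]: "p \<in> carrier R \<Longrightarrow> q \<in> carrier R \<Longrightarrow> p - q \<in> carrier R"
  by (simp add: carrier_R keys_subset_diff)

lemma zero_carrier [simp]: "0 \<in> carrier R" and one_carrier [simp]: "1 \<in> carrier R"
  by (simp_all add: carrier_R M0)

lemma single_carrier [intro]: "u \<in> M \<Longrightarrow> single u c \<in> carrier R"
  by (simp add: carrier_R)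

lemma const_carrier [simp]: "single 0 c \<in> carrier R"
  by (simp add: carrier_R M0)

lemma sum_carrier [intro]: "(\<And>i. i \<in> I \<Longrightarrow> f i \<in> carrier R) \<Longrightarrow> (\<Sum>i\<in>I. f i) \<in> carrier R"
  by (induction I rule: infinite_finite_induct) auto

lemma power_carrier [intro]: "p \<in> carrier R \<Longrightarrow> p ^ n \<in> carrier R"
  by (induction n) auto

lemma restrict_carrier [intro]: "p \<in> carrier R \<Longrightarrow> restrict_keys P p \<in> carrier R"
  by (auto simp: carrier_R keys_restrict_keys)

lemma is_cring: "cring R"
proof (rule cringI)
  show "abelian_group R"
  proof (rule abelian_groupI)
    show "\<exists>y\<in>carrier R. y \<oplus>\<^bsub>R\<^esub> x = \<zero>\<^bsub>R\<^esub>" if "x \<in> carrier R" for x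
      by (rule bexI[of _ "- x"]) (use that in auto)
  qed (auto simp: add.assoc add.commute)
  show "comm_monoid R"
    by (rule comm_monoidI) (auto simp: mult.assoc mult.commute)
qed (simp add: distrib_right)

sublocale R: cring R by (rule is_cring)

lemma nat_pow_R [simp]: "p [^]\<^bsub>R\<^esub> (n::nat) = p ^ n"
  by (induction n) (simp_all add: mult.commute)

lemma idealI_supported:
  assumes "J \<subseteq> carrier R" "0 \<in> J" "\<And>p q. p \<in> J \<Longrightarrow> q \<in> J \<Longrightarrow> p + q \<in> J"
    and "\<And>r p. r \<in> carrier R \<Longrightarrow> p \<in> J \<Longrightarrow> r * p \<in> J"
  shows "ideal J R"
  by (rule R.idealI_comm) (simp_all add: assms)

lemma ideal_add: "ideal J R \<Longrightarrow> p \<in> J \<Longrightarrow> q \<in> J \<Longrightarrow> p + q \<in> J"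
  using additive_subgroup.a_closed[OF ideal.axioms(1)] by fastforce

lemma ideal_mult: "ideal J R \<Longrightarrow> r \<in> carrier R \<Longrightarrow> p \<in> J \<Longrightarrow> r * p \<in> J"
  using ideal.I_l_closed by fastforce

lemma ideal_zero: "ideal J R \<Longrightarrow> 0 \<in> J"
  using additive_subgroup.zero_closed[OF ideal.axioms(1)] by fastforce

lemma ideal_sum: "ideal J R \<Longrightarrow> (\<And>i. i \<in> I \<Longrightarrow> f i \<in> J) \<Longrightarrow> (\<Sum>i\<in>I. f i) \<in> J"
  by (induction I rule: infinite_finite_induct) (auto intro: ideal_add ideal_zero)

lemma ideal_diff: "ideal J R \<Longrightarrow> p \<in> J \<Longrightarrow> q \<in> J \<Longrightarrow> p - q \<in> J"
  using ideal_add[of J p "(- 1) * q"] ideal_mult[of J "- 1" q] by fastforce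

lemma ideal_carrier: "ideal J R \<Longrightarrow> J \<subseteq> carrier R"
  using additive_subgroup.a_subset[OF ideal.axioms(1)] by auto

lemma Idl_finite_combination:
  assumes F: "F \<subseteq> carrier R" "finite F" and p: "p \<in> Idl\<^bsub>R\<^esub> F"
  obtains r where "p = (\<Sum>f\<in>F. r f * f)" "\<And>f. f \<in> F \<Longrightarrow> r f \<in> carrier R"
proof -
  let ?J = "{p. \<exists>r. p = (\<Sum>f\<in>F. r f * f) \<and> (\<forall>f\<in>F. r f \<in> carrier R)}"
  have "f \<in> ?J" if f: "f \<in> F" for f
  proof (intro CollectI exI conjI)
    have "f = (\<Sum>g\<in>{f}. (if g = f then 1 else 0) * g)" by simp
    also have "\<dots> = (\<Sum>g\<in>F. (if g = f then 1 else 0) * g)"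
      by (rule sum.mono_neutral_left) (use f F in auto)
    finally show "f = (\<Sum>g\<in>F. (if g = f then 1 else 0) * g)" .
  qed auto
  moreover have "ideal ?J R"
  proof (rule idealI_supported)
    show "?J \<subseteq> carrier R" using F by (auto intro!: sum_carrier mult_carrier)
    show "0 \<in> ?J" by (intro CollectI exI[of _ "\<lambda>_. 0"]) simp
    fix p assume "p \<in> ?J"
    then obtain r1 where p: "p = (\<Sum>f\<in>F. r1 f * f)" "\<forall>f\<in>F. r1 f \<in> carrier R"
      by blast
    show "p + q \<in> ?J" if "q \<in> ?J" for q
    proof -
      from that obtain r2 where q: "q = (\<Sum>f\<in>F. r2 f * f)" "\<forall>f\<in>F. r2 f \<in> carrier R"
        by blast
      have "p + q = (\<Sum>f\<in>F. (r1 f + r2 f) * f)"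
        unfolding p q by (simp add: distrib_right sum.distrib)
      thus ?thesis using p(2) q(2) by (intro CollectI exI[of _ "\<lambda>f. r1 f + r2 f"]) auto
    qed
    show "r * p \<in> ?J" if "r \<in> carrier R" for r
    proof -
      have "r * p = (\<Sum>f\<in>F. (r * r1 f) * f)"
        unfolding p(1) by (simp add: sum_distrib_left mult.assoc)
      thus ?thesis using p(2) that by (intro CollectI exI[of _ "\<lambda>f. r * r1 f"]) auto
    qed
  qed
  ultimately have "Idl\<^bsub>R\<^esub> F \<subseteq> ?J" using R.genideal_minimal by blast
  thus ?thesis using p that by blast
qed

text \<open>Compare the components of degree \<open>deg f\<^sub>0\<close>. The coefficient of \<open>f\<^sub>0\<close> on the right-hand side
  contributes only its component of degree zero, which is its constant term and hence vanishes.\<close>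

lemma graded_nakayama:
  fixes deg :: "'a \<Rightarrow> 'b::cancel_comm_monoid_add"
  assumes deg_add: "\<And>u v. deg (u + v) = deg u + deg v"
    and deg_zero: "\<And>u. u \<in> M \<Longrightarrow> deg u = 0 \<Longrightarrow> u = 0"
    and F: "F \<subseteq> carrier R" "finite F"
    and homog: "\<And>f. f \<in> F \<Longrightarrow> \<exists>s. \<forall>u\<in>keys f. deg u = s"
    and f0: "f0 \<in> F" "f0 = (\<Sum>f\<in>F. r f * f)" "\<And>f. f \<in> F \<Longrightarrow> r f \<in> carrier R"
      "lookup (r f0) 0 = 0"
  shows "f0 \<in> Idl\<^bsub>R\<^esub> (F - {f0})"
proof -
  obtain d where d: "\<And>f u. f \<in> F \<Longrightarrow> u \<in> keys f \<Longrightarrow> deg u = d f"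
    using homog by metis
  define r' where "r' f = restrict_keys (\<lambda>u. deg u + d f = d f0) (r f)" for f
  have part: "restrict_keys (\<lambda>u. deg u = d f0) (r f * f) = r' f * f" if f: "f \<in> F" for f
  proof -
    let ?s = "restrict_keys (\<lambda>u. \<not> deg u + d f = d f0) (r f)"
    have "r f = r' f + ?s" unfolding r'_def by (rule restrict_keys_split)
    hence "r f * f = r' f * f + ?s * f" by (metis distrib_right)
    moreover have "restrict_keys (\<lambda>u. deg u = d f0) (r' f * f) = r' f * f"
    proof (rule restrict_keys_id)
      fix k assume "k \<in> keys (r' f * f)"
      then obtain u v where "k = u + v" "u \<in> keys (r' f)" "v \<in> keys f"
        using keys_mult by blast
      thus "deg k = d f0" by (simp add: r'_def keys_restrict_keys deg_add d[OF f])
    qed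
    moreover have "restrict_keys (\<lambda>u. deg u = d f0) (?s * f) = 0"
    proof (rule restrict_keys_none)
      fix k assume "k \<in> keys (?s * f)"
      then obtain u v where "k = u + v" "u \<in> keys ?s" "v \<in> keys f"
        using keys_mult by blast
      thus "deg k \<noteq> d f0" by (simp add: keys_restrict_keys deg_add d[OF f])
    qed
    ultimately show ?thesis by (simp add: restrict_keys_add)
  qed
  have "f0 = restrict_keys (\<lambda>u. deg u = d f0) f0"
    using d f0(1) by (intro restrict_keys_id[symmetric]) auto
  also have "\<dots> = (\<Sum>f\<in>F. r' f * f)"
    using arg_cong[OF f0(2), of "restrict_keys (\<lambda>u. deg u = d f0)"]
    by (simp only: restrict_keys_sum part cong: sum.cong)
  also have "\<dots> = (\<Sum>f\<in>F - {f0}. r' f * f) + r' f0 * f0"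
    by (rule sum.remove[OF F(2) f0(1), THEN trans]) (rule add.commute)
  also have "r' f0 = 0"
    unfolding r'_def
  proof (rule restrict_keys_none)
    fix u assume "u \<in> keys (r f0)"
    hence "u \<in> M" "u \<noteq> 0" using f0(3)[OF f0(1)] f0(4) by (auto simp: carrier_R in_keys_iff)
    thus "\<not> deg u + d f0 = d f0" using deg_zero by auto
  qed
  finally have eq: "f0 = (\<Sum>f\<in>F - {f0}. r' f * f)" by simp
  have F': "F - {f0} \<subseteq> carrier R" using F by blast
  have "(\<Sum>f\<in>F - {f0}. r' f * f) \<in> Idl\<^bsub>R\<^esub> (F - {f0})"
    using R.genideal_self[OF F'] f0(3)
    by (intro ideal_sum[OF R.genideal_ideal[OF F']] ideal_mult[OF R.genideal_ideal[OF F']])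
      (auto simp: r'_def)
  thus ?thesis unfolding eq[symmetric] .
qed

end

section \<open>Counting minimal homogeneous generators\<close>

context supported
begin

text \<open>The hypothesis \<open>residue\<close> says that the coefficient at \<open>q \<in> Q\<close> kills the product of \<open>I\<close> with the
  ideal of polynomials without constant term. By \<open>dual\<close>, the coefficients at \<open>Q\<close> are coordinates on
  the quotient of \<open>I\<close> by that product. A generating set spans this quotient. If it is minimal and
  homogeneous, it is also linearly independent there, because a linear dependence would make one
  generator redundant by Nakayama's lemma.\<close>

lemma card_minimal_generators:
  fixes deg :: "'a \<Rightarrow> 'b::cancel_comm_monoid_add"
  assumes deg_add: "\<And>u v. deg (u + v) = deg u + deg v"
    and deg_zero: "\<And>u. u \<in> M \<Longrightarrow> deg u = 0 \<Longrightarrow> u = 0"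
    and pointed: "\<And>u v. u \<in> M \<Longrightarrow> v \<in> M \<Longrightarrow> u + v = 0 \<Longrightarrow> u = 0"
    and g: "finite Q" "g ` Q \<subseteq> carrier R" "Idl\<^bsub>R\<^esub> (g ` Q) = I"
    and dual: "\<And>q q'. q \<in> Q \<Longrightarrow> q' \<in> Q \<Longrightarrow> lookup (g q) q' = (if q = q' then 1 else 0)"
    and residue: "\<And>f r q. f \<in> I \<Longrightarrow> r \<in> carrier R \<Longrightarrow> q \<in> Q \<Longrightarrow>
      lookup (r * f) q = lookup r 0 * lookup f q"
    and F: "F \<subseteq> carrier R" "finite F" "Idl\<^bsub>R\<^esub> F = I"
    and minimal: "\<And>F'. F' \<subset> F \<Longrightarrow> Idl\<^bsub>R\<^esub> F' \<noteq> I"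
    and homog: "\<And>f. f \<in> F \<Longrightarrow> \<exists>s. \<forall>u\<in>keys f. deg u = s"
  shows "card F = card Q"
proof -
  define \<pi> :: "('a \<Rightarrow>\<^sub>0 'k) \<Rightarrow> ('a \<Rightarrow>\<^sub>0 'k)" where "\<pi> = restrict_keys (\<lambda>q. q \<in> Q)"
  have lookup_\<pi>: "lookup (\<pi> f) q = (if q \<in> Q then lookup f q else 0)" for f q
    by (simp add: \<pi>_def lookup_restrict_keys when_def)
  have ideal_I: "ideal I R" using R.genideal_ideal[OF F(1)] F(3) by simp
  have FI: "f \<in> I" if "f \<in> F" for f using R.genideal_self[OF F(1)] F(3) that by blast
  have gI: "g q \<in> I" if "q \<in> Q" for q using R.genideal_self[OF g(2)] g(3) that by blast
  have inj_g: "inj_on g Q"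
  proof (rule inj_onI)
    fix q q' assume "q \<in> Q" "q' \<in> Q" "g q = g q'"
    thus "q = q'" using dual[of q q'] dual[of q' q'] by (auto split: if_splits)
  qed
  have indep: "c f0 = 0"
    if c: "(\<Sum>f\<in>F. single 0 (c f) * \<pi> f) = 0" and f0: "f0 \<in> F" for c f0
  proof (rule ccontr)
    assume c0: "c f0 \<noteq> 0"
    define p where "p = (\<Sum>f\<in>F. single 0 (c f) * f)"
    have pI: "p \<in> I" unfolding p_def
      by (intro ideal_sum[OF ideal_I] ideal_mult[OF ideal_I] FI) auto
    have p_Q: "lookup p q = 0" if "q \<in> Q" for q
      using arg_cong[OF c, of "\<lambda>p. lookup p q"] that
      by (simp add: p_def lookup_sum lookup_scale lookup_\<pi>)
    obtain \<rho> where \<rho>: "p = (\<Sum>h\<in>g ` Q. \<rho> h * h)" "\<And>h. h \<in> g ` Q \<Longrightarrow> \<rho> h \<in> carrier R"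
      using Idl_finite_combination[OF g(2) finite_imageI[OF g(1)], of p] pI g(3) by metis
    have p_eq: "p = (\<Sum>q\<in>Q. \<rho> (g q) * g q)"
      unfolding \<rho>(1) by (simp add: sum.reindex[OF inj_g])
    have \<rho>0: "lookup (\<rho> (g q)) 0 = 0" if q: "q \<in> Q" for q
    proof -
      have "lookup p q
          = (\<Sum>q'\<in>Q. lookup (\<rho> (g q')) 0 * lookup (g q') q)"
        unfolding p_eq lookup_sum by (intro sum.cong residue gI \<rho>(2) q refl) auto
      also have "\<dots> = (\<Sum>q'\<in>Q. if q = q' then lookup (\<rho> (g q')) 0 else 0)"
        by (intro sum.cong) (auto simp: dual q)
      also have "\<dots> = lookup (\<rho> (g q)) 0" using q g(1) by simp
      finally show ?thesis using p_Q[OF q] by simp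
    qed
    have "\<exists>\<sigma>. g q = (\<Sum>f\<in>F. \<sigma> f * f) \<and> (\<forall>f\<in>F. \<sigma> f \<in> carrier R)" if "q \<in> Q" for q
      using Idl_finite_combination[OF F(1,2), of "g q"] gI[OF that] F(3) by metis
    then obtain \<sigma> where \<sigma>: "\<And>q. q \<in> Q \<Longrightarrow> g q = (\<Sum>f\<in>F. \<sigma> q f * f)"
      "\<And>q f. q \<in> Q \<Longrightarrow> f \<in> F \<Longrightarrow> \<sigma> q f \<in> carrier R" by metis
    define \<tau> where "\<tau> f = (\<Sum>q\<in>Q. \<rho> (g q) * \<sigma> q f)" for f
    have \<tau>: "\<tau> f \<in> carrier R" "lookup (\<tau> f) 0 = 0" if f: "f \<in> F" for f
    proof -
      show "\<tau> f \<in> carrier R" unfolding \<tau>_def by (intro sum_carrier mult_carrier \<rho> \<sigma> f) auto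
      have "lookup (\<rho> (g q) * \<sigma> q f) 0 = 0" if q: "q \<in> Q" for q
      proof -
        have "lookup (\<rho> (g q) * \<sigma> q f) 0
            = lookup (\<rho> (g q)) 0 * lookup (\<sigma> q f) 0"
          using \<rho>(2)[of "g q"] \<sigma>(2)[OF q f] q
          by (intro lookup_mult_unit_factor) (auto simp: carrier_R intro: pointed)
        thus ?thesis by (simp add: \<rho>0 q)
      qed
      thus "lookup (\<tau> f) 0 = 0" by (simp add: \<tau>_def lookup_sum)
    qed
    have "p = (\<Sum>q\<in>Q. \<Sum>f\<in>F. \<rho> (g q) * \<sigma> q f * f)"
      unfolding p_eq by (intro sum.cong refl) (simp add: \<sigma>(1) sum_distrib_left mult.assoc)
    also have "\<dots> = (\<Sum>f\<in>F. \<tau> f * f)"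
      by (subst sum.swap) (simp add: \<tau>_def sum_distrib_right)
    finally have p_\<tau>: "p = (\<Sum>f\<in>F. \<tau> f * f)" .
    \<comment> \<open>solve \<open>p = \<Sum> c f\<close> for \<open>f\<^sub>0\<close>, with \<open>p\<close> rewritten by coefficients without constant term\<close>
    define c' :: "('a \<Rightarrow>\<^sub>0 'k) \<Rightarrow> ('a \<Rightarrow>\<^sub>0 'k)" where "c' f = (if f = f0 then 0 else single 0 (c f))" for f
    define \<kappa> where "\<kappa> f = single 0 (1 / c f0) * (\<tau> f - c' f)" for f
    have "p = (\<Sum>f\<in>F - {f0}. single 0 (c f) * f) + single 0 (c f0) * f0"
      unfolding p_def by (subst sum.remove[OF F(2) f0]) (rule add.commute)
    moreover have "(\<Sum>f\<in>F - {f0}. single 0 (c f) * f) = (\<Sum>f\<in>F. c' f * f)"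
      by (rule sum.mono_neutral_cong_left) (use F(2) in \<open>auto simp: c'_def\<close>)
    ultimately have "(\<Sum>f\<in>F. \<tau> f * f) - (\<Sum>f\<in>F. c' f * f) = single 0 (c f0) * f0"
      unfolding p_\<tau> by simp
    hence "(\<Sum>f\<in>F. (\<tau> f - c' f) * f) = single 0 (c f0) * f0"
      by (simp add: left_diff_distrib sum_subtractf)
    hence "single 0 (1 / c f0) * (\<Sum>f\<in>F. (\<tau> f - c' f) * f)
        = single 0 (1 / c f0) * single 0 (c f0) * f0"
      by (simp add: mult.assoc)
    hence "f0 = (\<Sum>f\<in>F. \<kappa> f * f)"
      using c0 by (simp add: \<kappa>_def mult_single sum_distrib_left mult.assoc)
    moreover have "\<kappa> f \<in> carrier R" if "f \<in> F" for f
      unfolding \<kappa>_def c'_def using \<tau>(1)[OF that] by (auto intro!: mult_carrier diff_carrier)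
    moreover have "lookup (\<kappa> f0) 0 = 0"
      using \<tau>(2)[OF f0] by (simp add: \<kappa>_def c'_def lookup_scale)
    ultimately have "f0 \<in> Idl\<^bsub>R\<^esub> (F - {f0})"
      by (intro graded_nakayama[where r = \<kappa>, OF deg_add deg_zero F(1,2) homog f0]) auto
    moreover have F': "F - {f0} \<subseteq> carrier R" using F(1) by blast
    ultimately have "F \<subseteq> Idl\<^bsub>R\<^esub> (F - {f0})" using R.genideal_self[OF F'] by blast
    hence "I \<subseteq> Idl\<^bsub>R\<^esub> (F - {f0})"
      using R.genideal_minimal[OF R.genideal_ideal[OF F']] F(3) by blast
    moreover have "Idl\<^bsub>R\<^esub> (F - {f0}) \<subseteq> I"
      using R.genideal_minimal[OF ideal_I, of "F - {f0}"] FI by blast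
    ultimately show False using minimal[of "F - {f0}"] f0 by blast
  qed
  have inj_\<pi>: "inj_on \<pi> F"
  proof (rule inj_onI, rule ccontr)
    fix f f' assume f: "f \<in> F" "f' \<in> F" "\<pi> f = \<pi> f'" "f \<noteq> f'"
    define c :: "('a \<Rightarrow>\<^sub>0 'k) \<Rightarrow> 'k" where "c x = (if x = f then 1 else if x = f' then - 1 else 0)" for x
    have "(\<Sum>x\<in>F. single 0 (c x) * \<pi> x) = (\<Sum>x\<in>{f, f'}. single 0 (c x) * \<pi> x)"
      by (rule sum.mono_neutral_right) (use F f in \<open>auto simp: c_def\<close>)
    also have "\<dots> = 0" using f by (simp add: c_def single_uminus)
    finally show False using indep[of c f] f by (simp add: c_def)
  qed
  have indep_\<pi>: "coeff_space.independent (\<pi> ` F)"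
  proof
    assume "coeff_space.dependent (\<pi> ` F)"
    then obtain u where u: "\<exists>v\<in>\<pi> ` F. u v \<noteq> 0" "(\<Sum>v\<in>\<pi> ` F. single 0 (u v) * v) = 0"
      using F(2) by (auto simp: coeff_space.dependent_finite)
    hence "(\<Sum>f\<in>F. single 0 ((u \<circ> \<pi>) f) * \<pi> f) = 0"
      unfolding sum.reindex[OF inj_\<pi>] comp_apply by blast
    hence "\<forall>f\<in>F. u (\<pi> f) = 0" using indep[of "u \<circ> \<pi>"] unfolding comp_apply by blast
    thus False using u(1) by blast
  qed
  let ?B = "(\<lambda>q. single q 1) ` Q :: ('a \<Rightarrow>\<^sub>0 'k) set"
  have inj_B: "inj_on (\<lambda>q. single q 1 :: 'a \<Rightarrow>\<^sub>0 'k) Q"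
    by (rule inj_onI) (metis keys_single singleton_inject zero_neq_one)
  have indep_B: "coeff_space.independent ?B"
  proof
    assume "coeff_space.dependent ?B"
    then obtain u where u: "\<exists>v\<in>?B. u v \<noteq> 0" "(\<Sum>v\<in>?B. single 0 (u v) * v) = 0"
      using g(1) by (auto simp: coeff_space.dependent_finite)
    then obtain q where q: "q \<in> Q" "u (single q 1) \<noteq> 0" by blast
    have "(\<Sum>q\<in>Q. single q (u (single q 1))) = 0"
      using u(2) unfolding sum.reindex[OF inj_B] comp_apply mult_single by simp
    hence "lookup (\<Sum>q\<in>Q. single q (u (single q 1))) q = 0"
      by simp
    hence "u (single q 1) = 0"
      using q(1) g(1) by (simp add: lookup_sum lookup_single when_def)
    thus False using q(2) by simp
  qed
  have "card F = card (\<pi> ` F)" by (simp add: card_image inj_\<pi>)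
  also have "\<dots> \<le> card ?B"
  proof -
    have "\<pi> ` F \<subseteq> coeff_space.span ?B"
      by (auto intro!: in_coeff_span simp: \<pi>_def keys_restrict_keys)
    thus ?thesis using coeff_space.independent_span_bound[OF finite_imageI[OF g(1)] indep_\<pi>] by blast
  qed
  finally have le: "card F \<le> card Q" by (simp add: card_image inj_B)
  have "single q 1 \<in> coeff_space.span (\<pi> ` F)" if q: "q \<in> Q" for q
  proof -
    have "g q \<in> Idl\<^bsub>R\<^esub> F" using gI[OF q] F(3) by simp
    then obtain r where r: "g q = (\<Sum>f\<in>F. r f * f)" "\<And>f. f \<in> F \<Longrightarrow> r f \<in> carrier R"
      by (rule Idl_finite_combination[OF F(1,2)]) (rule that)
    have "single q 1 = (\<Sum>f\<in>F. single 0 (lookup (r f) 0) * \<pi> f)"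
    proof (rule poly_mapping_eqI)
      fix k
      show "lookup (single q 1) k
        = lookup (\<Sum>f\<in>F. single 0 (lookup (r f) 0) * \<pi> f) k"
      proof (cases "k \<in> Q")
        case True
        have "lookup (g q) k = (\<Sum>f\<in>F. lookup (r f) 0 * lookup f k)"
          unfolding r(1) lookup_sum by (intro sum.cong residue FI r(2) True refl)
        thus ?thesis using True q by (simp add: lookup_sum lookup_scale lookup_\<pi> lookup_single dual when_def)
      qed (use q in \<open>auto simp: lookup_sum lookup_scale lookup_\<pi> lookup_single when_def\<close>)
    qed
    also have "\<dots> \<in> coeff_space.span (\<pi> ` F)"
      by (intro coeff_space.span_sum coeff_space.span_scale coeff_space.span_base) auto
    finally show ?thesis .
  qed
  hence "?B \<subseteq> coeff_space.span (\<pi> ` F)" by blast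
  hence "card ?B \<le> card (\<pi> ` F)"
    using coeff_space.independent_span_bound[OF finite_imageI[OF F(2)] indep_B] by blast
  thus ?thesis using le by (simp add: card_image inj_B inj_\<pi>)
qed

lemma dual_generators_minimal:
  assumes g: "finite Q" "g ` Q \<subseteq> carrier R" "Idl\<^bsub>R\<^esub> (g ` Q) = I"
    and dual: "\<And>q q'. q \<in> Q \<Longrightarrow> q' \<in> Q \<Longrightarrow> lookup (g q) q' = (if q = q' then 1 else 0)"
    and residue: "\<And>f r q. f \<in> I \<Longrightarrow> r \<in> carrier R \<Longrightarrow> q \<in> Q \<Longrightarrow>
      lookup (r * f) q = lookup r 0 * lookup f q"
    and F': "F' \<subset> g ` Q"
  shows "Idl\<^bsub>R\<^esub> F' \<noteq> I"
proof
  assume eq: "Idl\<^bsub>R\<^esub> F' = I"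
  obtain q where q: "q \<in> Q" "g q \<notin> F'" using F' by blast
  have fin: "finite F'" and car: "F' \<subseteq> carrier R"
    using F' g finite_subset[of F' "g ` Q"] by blast+
  have gI: "g ` Q \<subseteq> I" using R.genideal_self[OF g(2)] g(3) by blast
  have "g q \<in> Idl\<^bsub>R\<^esub> F'" using gI eq q(1) by blast
  then obtain r where r: "g q = (\<Sum>f\<in>F'. r f * f)" "\<And>f. f \<in> F' \<Longrightarrow> r f \<in> carrier R"
    by (rule Idl_finite_combination[OF car fin]) (rule that)
  have "lookup (r f * f) q = 0" if f: "f \<in> F'" for f
  proof -
    obtain q' where q': "q' \<in> Q" "f = g q'" using f F' by blast
    thus ?thesis using residue[of f "r f" q] r(2)[OF f] q f gI dual[of q' q] by auto
  qed
  hence "lookup (g q) q = 0" unfolding r(1) lookup_sum by simp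
  thus False using dual[OF q(1) q(1)] by simp
qed

end

section \<open>Minimal generators and the presentation map\<close>

lemma generates_subset: "generates A S \<Longrightarrow> A \<subseteq> S"
  unfolding generates_def by (metis hull_subset)

lemma generates_least:
  assumes "generates A S" "add_submonoid N" "A \<subseteq> N"
  shows "S \<subseteq> N"
  using assms unfolding generates_def by (metis hull_minimal)

lemma add_submonoid_hull: "add_submonoid (add_submonoid hull A)"
  by (rule hull_in) (auto simp: add_submonoid_def)

lemma affine_semigroup_submonoid: "affine_semigroup S \<Longrightarrow> add_submonoid S"
  unfolding affine_semigroup_def generates_def using add_submonoid_hull by metis

lemma msg_generates: "add_submonoid S \<Longrightarrow> generates (msg S) S"
  and msg_minimal: "add_submonoid S \<Longrightarrow> B \<subset> msg S \<Longrightarrow> \<not> generates B S"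
  using theI'[OF msg_welldef[of S]] unfolding msg_def by blast+

lemma msg_subset: "add_submonoid S \<Longrightarrow> msg S \<subseteq> S"
  by (rule generates_subset[OF msg_generates])

definition vsum :: "nat ^ 'd \<Rightarrow> nat" where "vsum x = (\<Sum>i\<in>UNIV. x $ i)"

lemma vsum_add: "vsum (x + y) = vsum x + vsum y"
  unfolding vsum_def vector_add_component by (rule sum.distrib)

lemma vsum_eq_0_iff: "vsum x = 0 \<longleftrightarrow> x = 0"
  by (simp add: vsum_def vec_eq_iff)

lemma irreducible_in_msg:
  assumes S: "add_submonoid S" and s: "s \<in> S" "s \<noteq> 0"
    and irr: "\<And>x y. x \<in> S \<Longrightarrow> y \<in> S \<Longrightarrow> s = x + y \<Longrightarrow> x = 0 \<or> y = 0"
  shows "s \<in> msg S"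
proof (rule ccontr)
  assume n: "s \<notin> msg S"
  have "x + y \<noteq> s" if "x \<in> S - {s}" "y \<in> S - {s}" for x y
    using irr[of x y] that by auto
  hence "add_submonoid (S - {s})" using S s(2) unfolding add_submonoid_def by blast
  hence "S \<subseteq> S - {s}"
    using generates_least[OF msg_generates[OF S]] msg_subset[OF S] n by blast
  thus False using s by blast
qed

text \<open>If \<open>s\<close> were a sum of two nonzero elements of \<open>S\<close>, then the irreducible elements, which are all in
  \<open>msg S\<close> and differ from \<open>s\<close>, would still generate \<open>S\<close>; so \<open>s\<close> could be dropped.\<close>

lemma msg_irreducible:
  assumes S: "add_submonoid S" and s: "s \<in> msg S" "x \<in> S" "y \<in> S" "s = x + y"
  shows "x = 0 \<or> y = 0"
proof (rule ccontr)
  assume n: "\<not> (x = 0 \<or> y = 0)"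
  let ?N = "add_submonoid hull (msg S - {s})"
  have N: "add_submonoid ?N" by (rule add_submonoid_hull)
  have sub: "?N \<subseteq> S" using msg_subset[OF S] S by (intro hull_minimal) auto
  have "t \<in> ?N" if "t \<in> S" for t
    using that
  proof (induction "vsum t" arbitrary: t rule: less_induct)
    case less
    show ?case
    proof (cases "t = 0 \<or> (\<exists>u\<in>S. \<exists>v\<in>S. t = u + v \<and> u \<noteq> 0 \<and> v \<noteq> 0)")
      case True
      thus ?thesis
      proof
        assume "\<exists>u\<in>S. \<exists>v\<in>S. t = u + v \<and> u \<noteq> 0 \<and> v \<noteq> 0"
        then obtain u v where uv: "u \<in> S" "v \<in> S" "t = u + v" "u \<noteq> 0" "v \<noteq> 0" by blast
        have "vsum u < vsum t" "vsum v < vsum t"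
          using uv vsum_eq_0_iff[of u] vsum_eq_0_iff[of v] by (simp_all add: vsum_add)
        thus ?thesis using less uv N unfolding add_submonoid_def by blast
      qed (use N in \<open>simp add: add_submonoid_def\<close>)
    next
      case False
      hence "t \<in> msg S" using less.prems by (intro irreducible_in_msg[OF S]) auto
      moreover have "t \<noteq> s" using False s n by blast
      ultimately show ?thesis using hull_subset[of "msg S - {s}" add_submonoid] by blast
    qed
  qed
  hence "generates (msg S - {s}) S" unfolding generates_def using sub by blast
  moreover have "msg S - {s} \<subset> msg S" using s(1) by blast
  ultimately show False using msg_minimal[OF S] by blast
qed

lemma msg_nonzero: "add_submonoid S \<Longrightarrow> 0 \<notin> msg S"
proof
  assume S: "add_submonoid S" and "0 \<in> msg S"
  let ?N = "add_submonoid hull (msg S - {0})"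
  have "add_submonoid ?N" by (rule add_submonoid_hull)
  hence "msg S \<subseteq> ?N"
    using hull_subset[of "msg S - {0}" add_submonoid] by (auto simp: add_submonoid_def)
  hence "S \<subseteq> ?N" using generates_least[OF msg_generates[OF S] add_submonoid_hull] by blast
  moreover have "?N \<subseteq> S" using msg_subset[OF S] S by (intro hull_minimal) auto
  ultimately have "generates (msg S - {0}) S" unfolding generates_def by blast
  thus False using msg_minimal[OF S, of "msg S - {0}"] \<open>0 \<in> msg S\<close> by blast
qed

text \<open>The degree in the variables from \<open>A\<close>.\<close>

definition weight :: "'a set \<Rightarrow> ('a \<Rightarrow>\<^sub>0 nat) \<Rightarrow> nat"
  where "weight A u = (\<Sum>a\<in>keys u \<inter> A. lookup u a)"

lemma keys_add_nat: "keys (u + v) = keys u \<union> keys v"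
  for u v :: "'a \<Rightarrow>\<^sub>0 nat"
  by (auto simp: in_keys_iff lookup_add)

lemma weight_add: "weight A (u + v) = weight A u + weight A v"
proof -
  have *: "weight A w = (\<Sum>a\<in>keys (u + v) \<inter> A. lookup w a)"
    if "keys w \<subseteq> keys (u + v)" for w
    unfolding weight_def by (rule sum.mono_neutral_left) (use that in \<open>auto simp: in_keys_iff\<close>)
  have "weight A (u + v) = weight A u + weight A v"
    if "keys u \<subseteq> keys (u + v)" "keys v \<subseteq> keys (u + v)"
    unfolding *[OF order_refl] *[OF that(1)] *[OF that(2)] lookup_add by (rule sum.distrib)
  thus ?thesis by (simp add: keys_add_nat)
qed

lemma weight_single: "weight A (single a n) = (if a \<in> A then n else 0)"
  by (auto simp: weight_def Int_insert_left)

lemma weight_zero [simp]: "weight A 0 = 0"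
  by (simp add: weight_def)

lemma weight_eq_0: "weight A u = 0 \<Longrightarrow> keys u \<inter> A = {}"
  by (auto simp: weight_def in_keys_iff)

lemma split_off_key:
  assumes "b \<in> keys u"
  obtains v where "u = v + single b (1::nat)"
proof
  show "u = (u - single b 1) + single b 1"
    using assms by (intro poly_mapping_eqI) (auto simp: lookup_add lookup_minus lookup_single in_keys_iff when_def)
qed

lemma semigroup_degree_superset:
  assumes "finite A" "keys u \<subseteq> A"
  shows "semigroup_degree u = (\<Sum>a\<in>A. lookup u a *s a)"
  unfolding semigroup_degree_def
  by (rule sum.mono_neutral_left) (use assms in \<open>auto simp: in_keys_iff vec_eq_iff\<close>)

lemma semigroup_degree_add: "semigroup_degree (u + v) = semigroup_degree u + semigroup_degree v"
proof -
  let ?A = "keys (u + v)"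
  have *: "semigroup_degree w = (\<Sum>a\<in>?A. lookup w a *s a)"
    if "keys w \<subseteq> ?A" for w
    using that by (intro semigroup_degree_superset) auto
  have "keys u \<subseteq> ?A" "keys v \<subseteq> ?A" by (simp_all add: keys_add_nat)
  thus ?thesis
    unfolding *[OF order_refl] by (simp only: * lookup_add vector_sadd_rdistrib sum.distrib)
qed

lemma semigroup_degree_single [simp]: "semigroup_degree (single a n) = n *s a"
  by (simp add: semigroup_degree_def vec_eq_iff)

lemma Suc_0_smult [simp]: "Suc 0 *s b = b" for b :: "nat ^ 'd"
  by (simp add: vec_eq_iff)

lemma semigroup_degree_0 [simp]: "semigroup_degree 0 = 0"
  by (simp add: semigroup_degree_def)

lemma semigroup_degree_in:
  assumes "add_submonoid S" "keys u \<subseteq> S"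
  shows "semigroup_degree u \<in> S"
  unfolding semigroup_degree_def using assms by (intro add_submonoid_sum add_submonoid_smult) auto

lemma monomial_power: "monomial a ^ n = monomial (n *s a)" for a :: "nat ^ 'd"
proof (induction n)
  case (Suc n)
  have "Suc n *s a = a + n *s a" by (simp add: vec_eq_iff)
  thus ?case using Suc by (simp add: monomial_def mult_single)
qed (simp add: monomial_def vec_eq_iff flip: single_one)

lemma monomial_prod: "(\<Prod>i\<in>I. monomial (f i)) = monomial (\<Sum>i\<in>I. f i)"
  for f :: "'i \<Rightarrow> nat ^ 'd"
  by (induction I rule: infinite_finite_induct) (auto simp: monomial_def mult_single)

text \<open>On monomials the presentation map is the grading, so it is determined by the degrees.\<close>

lemma presentation_map_eq:
  "presentation_map p = (\<Sum>u\<in>keys p. single (semigroup_degree u) (lookup p u))"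
  unfolding presentation_map_def monomial_power monomial_prod
  by (simp add: semigroup_degree_def monomial_def mult_single)

lemma presentation_map_superset:
  assumes "finite A" "keys p \<subseteq> A"
  shows "presentation_map p = (\<Sum>u\<in>A. single (semigroup_degree u) (lookup p u))"
  unfolding presentation_map_eq
  by (rule sum.mono_neutral_left) (use assms in \<open>auto simp: in_keys_iff\<close>)

lemma presentation_map_add: "presentation_map (p + q) = presentation_map p + presentation_map q"
proof -
  let ?A = "keys p \<union> keys q"
  have *: "presentation_map w = (\<Sum>u\<in>?A. single (semigroup_degree u) (lookup w u))"
    if "keys w \<subseteq> ?A" for w :: "(nat ^ 'a \<Rightarrow>\<^sub>0 nat) \<Rightarrow>\<^sub>0 'b"
    using that by (intro presentation_map_superset) auto
  show ?thesis
    unfolding *[OF Poly_Mapping.keys_add] *[OF Un_upper1] *[OF Un_upper2] lookup_add single_add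
    by (rule sum.distrib)
qed

lemma presentation_map_single [simp]:
  "presentation_map (single u c) = single (semigroup_degree u) c"
  by (simp add: presentation_map_eq)

lemma presentation_map_0 [simp]: "presentation_map 0 = 0"
  by (simp add: presentation_map_eq)

lemma presentation_map_sum: "presentation_map (\<Sum>i\<in>I. f i) = (\<Sum>i\<in>I. presentation_map (f i))"
  by (induction I rule: infinite_finite_induct) (auto simp: presentation_map_add)

lemma presentation_map_mult: "presentation_map (p * q) = presentation_map p * presentation_map q"
proof -
  have "p * q = (\<Sum>u\<in>keys p. \<Sum>v\<in>keys q.
      single (u + v) (lookup p u * lookup q v))"
    by (subst poly_mapping_sum_single[of p], subst poly_mapping_sum_single[of q])
      (simp add: sum_product mult_single)
  thus ?thesis
    by (simp add: presentation_map_sum semigroup_degree_add presentation_map_eq[of p]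
        presentation_map_eq[of q] sum_product mult_single)
qed

lemma presentation_map_diff: "presentation_map (p - q) = presentation_map p - presentation_map q"
  using presentation_map_add[of "p - q" q] by simp

lemma defining_ideal_eq:
  "defining_ideal S = {p \<in> carrier (presentation_ring S). presentation_map p = 0}"
  by (simp add: defining_ideal_def a_kernel_def kernel_def semigroup_ring_def)

lemma lookup_presentation_map:
  "lookup (presentation_map p) s
    = (\<Sum>u\<in>keys p. lookup p u when semigroup_degree u = s)"
  by (simp add: presentation_map_eq lookup_sum lookup_single)

locale semigroup_presentation =
  fixes S :: "(nat ^ 'd::finite) set" and M :: "(nat ^ 'd \<Rightarrow>\<^sub>0 nat) set"
  defines "M \<equiv> {u. keys u \<subseteq> msg S}"
  assumes submonoid: "add_submonoid S"
begin

lemma M_add_iff: "u + v \<in> M \<longleftrightarrow> u \<in> M \<and> v \<in> M"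
  by (auto simp: M_def keys_add_nat)

lemma single_in_M: "b \<in> msg S \<Longrightarrow> single b n \<in> M"
  by (simp add: M_def)

lemma supported_M: "supported M"
  by unfold_locales (auto simp: M_def keys_add_nat)

lemma degree_in_S: "u \<in> M \<Longrightarrow> semigroup_degree u \<in> S"
  using msg_subset[OF submonoid] by (intro semigroup_degree_in[OF submonoid]) (auto simp: M_def)

lemma degree_eq_0: 
  assumes "u \<in> M" "semigroup_degree u = 0"
  shows "u = 0"
proof (rule ccontr)
  assume "u \<noteq> 0"
  then obtain b where b: "b \<in> keys u" by fastforce
  then obtain v where v: "u = v + single b 1" by (rule split_off_key)
  have "b = 0" using assms(2) by (simp add: v semigroup_degree_add vec_nat_add_eq_0_iff)
  thus False using msg_nonzero[OF submonoid] b assms(1) by (auto simp: M_def)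
qed

lemma degree_eq_generator:
  assumes u: "u \<in> M" and x: "x \<in> msg S" "semigroup_degree u = x"
  shows "u = single x 1"
proof -
  have "u \<noteq> 0" using x msg_nonzero[OF submonoid] by auto
  then obtain b where b: "b \<in> keys u" by fastforce
  then obtain v where v: "u = v + single b 1" by (rule split_off_key)
  have bv: "b \<in> msg S" "v \<in> M" using u b unfolding v M_add_iff by (auto simp: M_def)
  have "b \<noteq> 0" using bv msg_nonzero[OF submonoid] by auto
  moreover have "x = semigroup_degree v + b" using x(2) by (simp add: v semigroup_degree_add)
  ultimately have "semigroup_degree v = 0"
    using msg_irreducible[OF submonoid x(1) degree_in_S[OF bv(2)], of b] bv(1) msg_subset[OF submonoid]
    by blast
  thus ?thesis using degree_eq_0[OF bv(2)] v x(2) by simp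
qed

text \<open>An element of the defining ideal has coefficient sum zero in every degree; here the degree
  of \<open>u\<^sub>0\<close> has a single factorization.\<close>

lemma defining_ideal_lookup_unique:
  assumes f: "f \<in> defining_ideal S" and u0: "\<And>u. u \<in> M \<Longrightarrow> semigroup_degree u = semigroup_degree u0 \<Longrightarrow> u = u0"
  shows "lookup f u0 = 0"
proof -
  have keys: "keys f \<subseteq> M" and "presentation_map f = 0"
    using f by (auto simp: defining_ideal_eq presentation_ring_def M_def)
  hence "0 = (\<Sum>u\<in>keys f. lookup f u when semigroup_degree u = semigroup_degree u0)"
    using lookup_presentation_map[of f "semigroup_degree u0"] by simp
  also have "\<dots> = (\<Sum>u\<in>keys f. if u0 = u then lookup f u else 0)"
    using keys u0 by (intro sum.cong) (auto simp: when_def)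
  also have "\<dots> = lookup f u0" by (simp add: sum.delta' in_keys_iff)
  finally show ?thesis by simp
qed

text \<open>A proper factor of a product of two minimal generators is \<open>1\<close> or a minimal generator, hence the
  only monomial of its degree. By \<open>defining_ideal_lookup_unique\<close> it does not occur in \<open>f\<close>.\<close>

lemma quadratic_coefficient_residue:
  fixes f r :: "(nat ^ 'd \<Rightarrow>\<^sub>0 nat) \<Rightarrow>\<^sub>0 'k::field"
  assumes f: "f \<in> defining_ideal S" and r: "keys r \<subseteq> M" and q: "weight UNIV q = 2"
  shows "lookup (r * f) q = lookup r 0 * lookup f q"
proof (rule lookup_mult_unit_factor, rule ccontr)
  fix u v assume u: "u \<in> keys r" and v: "v \<in> keys f" and uv: "u + v = q" and "u \<noteq> 0"
  have vM: "v \<in> M" using f v by (auto simp: defining_ideal_eq presentation_ring_def M_def)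
  have "weight UNIV u \<noteq> 0" using weight_eq_0[of UNIV u] \<open>u \<noteq> 0\<close> by auto
  hence "weight UNIV v \<le> 1" using q by (simp add: weight_add flip: uv)
  have "lookup f v = 0"
  proof (cases "v = 0")
    case True
    thus ?thesis using degree_eq_0 by (intro defining_ideal_lookup_unique[OF f]) auto
  next
    case False
    then obtain b where b: "b \<in> keys v" by fastforce
    then obtain w where w: "v = w + single b 1" by (rule split_off_key)
    have "weight UNIV w = 0" using \<open>weight UNIV v \<le> 1\<close> by (simp add: w weight_add weight_single)
    hence "w = 0" using weight_eq_0[of UNIV w] by auto
    hence vb: "v = single b 1" using w by simp
    have "b \<in> msg S" using b vM by (auto simp: M_def)
    thus ?thesis unfolding vb
      using degree_eq_generator by (intro defining_ideal_lookup_unique[OF f]) auto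
  qed
  thus False using v by (simp add: in_keys_iff)
qed

end

section \<open>Normal forms of monomials\<close>

definition ray_comb :: "('d \<Rightarrow> nat ^ 'd) \<Rightarrow> ('d \<Rightarrow> nat) \<Rightarrow> nat ^ 'd"
  where "ray_comb e n = (\<Sum>i\<in>UNIV. n i *s e i)"

definition unit_fun :: "'d \<Rightarrow> 'd \<Rightarrow> nat" where "unit_fun i k = (if k = i then 1 else 0)"

lemma ray_comb_add: "ray_comb e (\<lambda>k. n k + n' k) = ray_comb e n + ray_comb e n'"
  unfolding ray_comb_def vector_sadd_rdistrib by (rule sum.distrib)

lemma ray_comb_unit: "ray_comb e (unit_fun i) = e i"
proof -
  have "ray_comb e (unit_fun i) = (\<Sum>k\<in>UNIV. if k = i then e k else 0)"
    unfolding ray_comb_def by (rule sum.cong) (auto simp: unit_fun_def)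
  thus ?thesis by simp
qed

lemma ray_comb_zero: "ray_comb e (\<lambda>_. 0) = 0"
  by (simp add: ray_comb_def)

text \<open>Modulo the rays \<open>e\<close>, the semigroup consists of full layers \<open>w + \<nat>e\<close> for \<open>w \<in> W\<close>, and of layers
  \<open>h + \<nat>e\<close> for \<open>h \<in> H\<close> from which exactly the corner \<open>h\<close> is missing. The minimal generators are the
  rays and the corners of the layers, a punctured layer having the \<open>d\<close> corners \<open>h + e\<^sub>i\<close>. The
  numbering \<open>\<iota>\<close> of the rays serves to choose normal forms in the punctured layers.\<close>

locale layered_semigroup = semigroup_presentation S M
  for S :: "(nat ^ 'd::finite) set" and M +
  fixes e :: "'d \<Rightarrow> nat ^ 'd" and W H :: "(nat ^ 'd) set" and \<iota> :: "'d \<Rightarrow> nat"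
  assumes zero_W: "0 \<in> W" and disjoint: "W \<inter> H = {}" and inj_\<iota>: "inj \<iota>"
    and finite_msg: "finite (msg S)"
    and msg_eq: "msg S = range e \<union> (W - {0}) \<union> {h + e i | h i. h \<in> H}"
    and repr: "s \<in> S \<Longrightarrow> \<exists>w n. s = w + ray_comb e n \<and> (w \<in> W \<or> w \<in> H \<and> n \<noteq> (\<lambda>_. 0))"
    and uniq: "w \<in> W \<union> H \<Longrightarrow> w' \<in> W \<union> H \<Longrightarrow> w + ray_comb e n = w' + ray_comb e n' \<Longrightarrow> w = w' \<and> n = n'"
begin

definition Y where "Y = msg S - range e"

definition valid where "valid w n \<longleftrightarrow> w \<in> W \<or> w \<in> H \<and> n \<noteq> (\<lambda>_. 0)"

lemma uniq': "w \<in> W \<union> H \<Longrightarrow> w' \<in> W \<union> H \<Longrightarrow> w + ray_comb e n = w' + ray_comb e n' \<Longrightarrow> w = w'"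
  "w \<in> W \<union> H \<Longrightarrow> w' \<in> W \<union> H \<Longrightarrow> w + ray_comb e n = w' + ray_comb e n' \<Longrightarrow> n = n'"
  using uniq by blast+

lemma unit_fun_nonzero: "unit_fun i \<noteq> (\<lambda>_. 0)"
  by (metis unit_fun_def zero_neq_one)

lemma unit_fun_inj: "unit_fun i = unit_fun j \<longleftrightarrow> i = j"
  by (metis unit_fun_def zero_neq_one)

lemma H_nonzero: "h \<in> H \<Longrightarrow> h \<noteq> 0"
  using disjoint zero_W by blast

lemma e_inj: "e i = e j \<longleftrightarrow> i = j"
  using uniq'(2)[of 0 0 "unit_fun i" "unit_fun j"] zero_W by (auto simp: ray_comb_unit unit_fun_inj)

lemma e_notin_W: "e i \<notin> W"
  using uniq'(2)[of "e i" 0 "\<lambda>_. 0" "unit_fun i"] zero_W unit_fun_nonzero[of i]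
  by (auto simp: ray_comb_unit ray_comb_zero)

lemma shift_neq_e: "h \<in> H \<Longrightarrow> h + e i \<noteq> e j"
  using uniq'(1)[of h 0 "unit_fun i" "unit_fun j"] zero_W H_nonzero by (auto simp: ray_comb_unit)

lemma shift_inj: "h \<in> H \<Longrightarrow> h' \<in> H \<Longrightarrow> h + e i = h' + e j \<longleftrightarrow> h = h' \<and> i = j"
  using uniq'[of h h' "unit_fun i" "unit_fun j"] by (auto simp: ray_comb_unit unit_fun_inj)

lemma Y_eq: "Y = (W - {0}) \<union> {h + e i | h i. h \<in> H}"
  unfolding Y_def msg_eq by (auto simp: e_notin_W shift_neq_e shift_neq_e[THEN not_sym])

lemma e_in_msg: "e i \<in> msg S" and shift_in_Y: "h \<in> H \<Longrightarrow> h + e i \<in> Y"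
  and shift_in_msg: "h \<in> H \<Longrightarrow> h + e i \<in> msg S"
  and e_notin_Y: "e i \<notin> Y"
  and Y_msg: "y \<in> Y \<Longrightarrow> y \<in> msg S"
  using msg_eq Y_eq by (auto simp: Y_def)

definition tail_mono :: "('d \<Rightarrow> nat) \<Rightarrow> (nat ^ 'd \<Rightarrow>\<^sub>0 nat)"
  where "tail_mono n = (\<Sum>i\<in>UNIV. single (e i) (n i))"

lemma tail_mono_add: "tail_mono (\<lambda>k. n k + n' k) = tail_mono n + tail_mono n'"
  unfolding tail_mono_def single_add by (rule sum.distrib)

lemma tail_mono_unit: "tail_mono (unit_fun i) = single (e i) 1"
proof -
  have "tail_mono (unit_fun i) = (\<Sum>k\<in>UNIV. if k = i then single (e k) 1 else 0)"
    unfolding tail_mono_def by (rule sum.cong) (auto simp: unit_fun_def)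
  thus ?thesis by simp
qed

lemma lookup_tail_mono: "lookup (tail_mono n) (e i) = n i"
  by (simp add: tail_mono_def lookup_sum lookup_single e_inj when_def)

lemma lookup_tail_mono_other: "a \<notin> range e \<Longrightarrow> lookup (tail_mono n) a = 0"
  by (auto simp: tail_mono_def lookup_sum lookup_single when_def)

lemma tail_mono_eqI: "keys u \<subseteq> range e \<Longrightarrow> u = tail_mono (\<lambda>i. lookup u (e i))"
proof (rule poly_mapping_eqI)
  fix k assume "keys u \<subseteq> range e"
  thus "lookup u k = lookup (tail_mono (\<lambda>i. lookup u (e i))) k"
    by (cases "k \<in> range e") (auto simp: lookup_tail_mono lookup_tail_mono_other in_keys_iff)
qed

lemma weight_tail_mono: "weight Y (tail_mono n) = 0"
proof -
  have "keys (tail_mono n) \<inter> Y = {}"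
    using lookup_tail_mono_other[of _ n] by (auto simp: Y_def in_keys_iff)
  thus ?thesis by (simp add: weight_def)
qed

lemma tail_mono_in_M: "tail_mono n \<in> M"
proof -
  have "keys (tail_mono n) \<subseteq> range e"
    using lookup_tail_mono_other[of _ n] by (auto simp: in_keys_iff)
  thus ?thesis using e_in_msg by (auto simp: M_def)
qed

lemma degree_sum: "semigroup_degree (\<Sum>i\<in>I. f i) = (\<Sum>i\<in>I. semigroup_degree (f i))"
  by (induction I rule: infinite_finite_induct) (auto simp: semigroup_degree_add)

lemma degree_tail_mono: "semigroup_degree (tail_mono n) = ray_comb e n"
  by (simp add: tail_mono_def degree_sum ray_comb_def)

definition first_ray :: "('d \<Rightarrow> nat) \<Rightarrow> 'd" where "first_ray n = arg_min \<iota> (\<lambda>i. n i \<noteq> 0)"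

lemma first_ray: assumes "n \<noteq> (\<lambda>_. 0)"
  shows "n (first_ray n) \<noteq> 0" "n k \<noteq> 0 \<Longrightarrow> \<iota> (first_ray n) \<le> \<iota> k"
proof -
  obtain k0 where "n k0 \<noteq> 0" using assms by blast
  thus "n (first_ray n) \<noteq> 0" unfolding first_ray_def by (rule arg_min_natI)
  show "n k \<noteq> 0 \<Longrightarrow> \<iota> (first_ray n) \<le> \<iota> k"
    unfolding first_ray_def by (rule arg_min_nat_le)
qed

lemma first_ray_eqI:
  assumes "n i \<noteq> 0" "\<And>k. n k \<noteq> 0 \<Longrightarrow> \<iota> i \<le> \<iota> k"
  shows "first_ray n = i"
proof -
  have "n \<noteq> (\<lambda>_. 0)" using assms(1) by auto
  hence "\<iota> (first_ray n) = \<iota> i" using first_ray[of n] assms by (intro antisym) blast+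
  thus ?thesis using inj_\<iota> by (simp add: inj_eq)
qed

lemma split_unit: "n i \<noteq> 0 \<Longrightarrow> n = (\<lambda>k. (n k - unit_fun i k) + unit_fun i k)"
  by (auto simp: unit_fun_def fun_eq_iff)

text \<open>In a punctured layer the missing corner forces a choice of the generator \<open>h + e\<^sub>i\<close>; the ray \<open>i\<close>
  chosen is the first one that occurs in \<open>n\<close>.\<close>

definition normal_mono :: "nat ^ 'd \<Rightarrow> ('d \<Rightarrow> nat) \<Rightarrow> (nat ^ 'd \<Rightarrow>\<^sub>0 nat)"
  where "normal_mono w n =
    (if w \<in> H then tail_mono (\<lambda>k. n k - unit_fun (first_ray n) k) + single (w + e (first_ray n)) 1
     else tail_mono n + (if w = 0 then 0 else single w 1))"

definition normal_form :: "nat ^ 'd \<Rightarrow> (nat ^ 'd \<Rightarrow>\<^sub>0 nat)"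
  where "normal_form s = (THE u. \<exists>w n. s = w + ray_comb e n \<and> valid w n \<and> u = normal_mono w n)"

lemma normal_form_eq: "valid w n \<Longrightarrow> normal_form (w + ray_comb e n) = normal_mono w n"
  unfolding normal_form_def
  by (rule the_equality) (auto simp: valid_def dest: uniq' uniq'[OF UnI1] uniq'[OF UnI2] intro: UnI1 UnI2)

lemma normal_mono_props:
  assumes "valid w n"
  shows "normal_mono w n \<in> M" "semigroup_degree (normal_mono w n) = w + ray_comb e n"
    "weight Y (normal_mono w n) \<le> 1"
proof -
  show "normal_mono w n \<in> M"
    using assms disjoint Y_eq Y_msg zero_W
    by (auto simp: normal_mono_def M_add_iff tail_mono_in_M shift_in_msg valid_def intro!: single_in_M)
      (auto simp: M_def)
  show "weight Y (normal_mono w n) \<le> 1"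
    by (auto simp: normal_mono_def weight_add weight_tail_mono weight_single)
  show "semigroup_degree (normal_mono w n) = w + ray_comb e n"
  proof (cases "w \<in> H")
    case True
    hence "n \<noteq> (\<lambda>_. 0)" using assms disjoint by (auto simp: valid_def)
    hence "n (first_ray n) \<noteq> 0" by (rule first_ray)
    hence "ray_comb e n = ray_comb e (\<lambda>k. n k - unit_fun (first_ray n) k) + e (first_ray n)"
      using ray_comb_add[of e "\<lambda>k. n k - unit_fun (first_ray n) k" "unit_fun (first_ray n)"]
        split_unit[of n "first_ray n"] by (simp add: ray_comb_unit)
    thus ?thesis using True by (simp add: normal_mono_def semigroup_degree_add degree_tail_mono ac_simps)
  qed (simp add: normal_mono_def semigroup_degree_add degree_tail_mono ac_simps)
qed

lemma normal_form_props:
  assumes "s \<in> S"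
  shows "normal_form s \<in> M" "semigroup_degree (normal_form s) = s" "weight Y (normal_form s) \<le> 1"
proof -
  obtain w n where "s = w + ray_comb e n" "valid w n" using repr[OF assms] by (auto simp: valid_def)
  thus "normal_form s \<in> M" "semigroup_degree (normal_form s) = s" "weight Y (normal_form s) \<le> 1"
    using normal_form_eq normal_mono_props by auto
qed

definition QY where "QY = {single y (1::nat) + single y' 1 | y y'. y \<in> Y \<and> y' \<in> Y}"

definition QH where "QH = {single (e i) (1::nat) + single (h + e j) 1 | h i j. h \<in> H \<and> \<iota> i < \<iota> j}"

text \<open>The left sides of the relations: products of two generators outside the rays, and the terms
  \<open>x\<^sub>i y\<^sub>h\<^sub>j\<close> with \<open>i < j\<close> of the syzygies \<open>x\<^sub>i y\<^sub>h\<^sub>j = x\<^sub>j y\<^sub>h\<^sub>i\<close>.\<close>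

definition Q where "Q = QY \<union> QH"

lemma QY_weight: "q \<in> QY \<Longrightarrow> weight Y q = 2"
  by (auto simp: QY_def weight_add weight_single)

lemma QH_weight: "q \<in> QH \<Longrightarrow> weight Y q = 1"
  by (auto simp: QH_def weight_add weight_single e_notin_Y shift_in_Y)

lemma Q_weight: "q \<in> Q \<Longrightarrow> weight UNIV q = 2"
  by (auto simp: Q_def QY_def QH_def weight_add weight_single)

lemma Q_in_M: "q \<in> Q \<Longrightarrow> q \<in> M"
  by (auto simp: Q_def QY_def QH_def M_add_iff intro!: single_in_M e_in_msg shift_in_Y Y_msg)

lemma first_ray_pair:
  assumes "\<iota> i < \<iota> j"
  shows "first_ray (\<lambda>k. unit_fun i k + unit_fun j k) = i"
  by (rule first_ray_eqI) (use assms in \<open>auto simp: unit_fun_def split: if_splits\<close>)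

lemma normal_form_pair:
  assumes "h \<in> H" "\<iota> i < \<iota> j"
  shows "normal_form (h + e i + e j) = single (e j) 1 + single (h + e i) 1"
proof -
  let ?n = "\<lambda>k. unit_fun i k + unit_fun j k"
  have n0: "?n \<noteq> (\<lambda>_. 0)" using unit_fun_nonzero[of i] by (auto simp: fun_eq_iff)
  have "h + e i + e j = h + ray_comb e ?n" by (simp add: ray_comb_add ray_comb_unit add.assoc)
  hence "normal_form (h + e i + e j) = normal_mono h ?n"
    using normal_form_eq[of h ?n] assms n0 by (simp add: valid_def)
  also have "(\<lambda>k. ?n k - unit_fun i k) = unit_fun j" by auto
  ultimately show ?thesis
    using assms first_ray_pair[OF assms(2)] by (simp add: normal_mono_def tail_mono_unit)
qed

text \<open>This makes the relations dual to the coefficients at \<open>Q\<close>. A normal form contains at most one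
  generator outside the rays, and if it is quadratic in a punctured layer then it is \<open>x\<^sub>j y\<^sub>h\<^sub>i\<close>
  with \<open>i\<close> at most \<open>j\<close>.\<close>

lemma normal_form_notin_Q:
  assumes s: "s \<in> S"
  shows "normal_form s \<notin> Q"
proof
  assume "normal_form s \<in> Q"
  moreover have "normal_form s \<notin> QY" using normal_form_props(3)[OF s] QY_weight by force
  ultimately obtain h i j where q: "normal_form s = single (e i) 1 + single (h + e j) 1"
    and h: "h \<in> H" "\<iota> i < \<iota> j" by (auto simp: Q_def QH_def)
  have "s = h + e i + e j"
    using normal_form_props(2)[OF s] by (simp add: q semigroup_degree_add ac_simps)
  hence "single (e i) 1 + single (h + e j) (1::nat)
      = single (e j) 1 + single (h + e i) 1"
    using normal_form_pair[OF h] q by simp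
  hence "lookup (single (e i) 1 + single (h + e j) (1::nat)) (e i)
      = lookup (single (e j) 1 + single (h + e i) 1) (e i)" by simp
  thus False using h shift_neq_e[OF h(1)] by (auto simp: lookup_add lookup_single when_def e_inj split: if_splits)
qed

end

section \<open>The number of minimal relations\<close>

lemma real_choose_two: "real (n choose 2) = real n * (real n - 1) / 2"
  by (induction n) (simp_all add: numeral_2_eq_2 field_simps)

context semigroup_presentation
begin

lemma ideal_defining_ideal: "ideal (defining_ideal S :: ((nat ^ 'd \<Rightarrow>\<^sub>0 nat) \<Rightarrow>\<^sub>0 'k::field) set) (presentation_ring S)"
proof -
  interpret supported M "presentation_ring S :: ((nat ^ 'd \<Rightarrow>\<^sub>0 nat) \<Rightarrow>\<^sub>0 'k) ring"
    by (rule supported_M) (simp add: presentation_ring_eq M_def)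
  show ?thesis
    by (rule idealI_supported)
      (auto simp: defining_ideal_eq presentation_map_add presentation_map_mult)
qed

end

context layered_semigroup
begin

definition gen :: "(nat ^ 'd \<Rightarrow>\<^sub>0 nat) \<Rightarrow> ((nat ^ 'd \<Rightarrow>\<^sub>0 nat) \<Rightarrow>\<^sub>0 'k::field)"
  where "gen q = single q 1 - single (normal_form (semigroup_degree q)) 1"

text \<open>Rewriting a product of two generators outside the rays lowers the number of such factors, since
  its normal form has at most one. A monomial with exactly one such factor is either normal or
  becomes normal by one exchange of a ray in a punctured layer.\<close>

lemma normal_form_reduction:
  fixes J :: "((nat ^ 'd \<Rightarrow>\<^sub>0 nat) \<Rightarrow>\<^sub>0 'k::field) set"
  assumes J: "ideal J (presentation_ring S)" and gen_J: "\<And>q. q \<in> Q \<Longrightarrow> gen q \<in> J" and u: "u \<in> M"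
  shows "gen u \<in> J"
proof -
  interpret supported M "presentation_ring S :: ((nat ^ 'd \<Rightarrow>\<^sub>0 nat) \<Rightarrow>\<^sub>0 'k) ring"
    by (rule supported_M) (simp add: presentation_ring_eq M_def)
  define rel :: "(nat ^ 'd \<Rightarrow>\<^sub>0 nat) \<Rightarrow> (nat ^ 'd \<Rightarrow>\<^sub>0 nat) \<Rightarrow> bool"
    where "rel u v \<longleftrightarrow> single u 1 - single v 1 \<in> J" for u v
  have rel_refl: "rel u u" for u using ideal_zero[OF J] by (simp add: rel_def)
  have rel_trans: "rel u w" if "rel u v" "rel v w" for u v w
    using ideal_add[OF J, of "single u 1 - single v 1"
        "single v 1 - single w 1"] that by (simp add: rel_def)
  have rel_shift: "rel (w + u) (w + v)" if "rel u v" "w \<in> M" for u v w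
    using ideal_mult[OF J single_carrier[OF that(2), of 1], of "single u 1 - single v 1"]
      that(1) by (simp add: rel_def right_diff_distrib mult_single)
  have rel_Q: "rel q (normal_form (semigroup_degree q))" if "q \<in> Q" for q
    using gen_J[OF that] by (simp add: rel_def gen_def)
  have "rel u (normal_form (semigroup_degree u))"
    using u
  proof (induction "weight Y u" arbitrary: u rule: less_induct)
    case less
    consider "weight Y u = 0" | "weight Y u = 1" | "weight Y u \<ge> 2" by linarith
    thus ?case
    proof cases
      case 1
      have "keys u \<subseteq> range e"
        using weight_eq_0[OF 1] less.prems by (auto simp: M_def Y_def)
      then obtain n where n: "u = tail_mono n" using tail_mono_eqI by blast
      have "normal_form (semigroup_degree u) = u"
        using normal_form_eq[of 0 n] zero_W H_nonzero
        by (auto simp: n degree_tail_mono valid_def normal_mono_def)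
      thus ?thesis using rel_refl by simp
    next
      case 2
      then obtain y where y: "y \<in> keys u" "y \<in> Y"
        unfolding weight_def by (metis IntE all_not_in_conv sum.empty zero_neq_one)
      obtain v where v: "u = v + single y 1" using y(1) by (rule split_off_key)
      have "weight Y v = 0" using 2 y by (simp add: v weight_add weight_single)
      moreover have "v \<in> M" using less.prems by (simp add: v M_add_iff)
      ultimately have "keys v \<subseteq> range e"
        using weight_eq_0[of Y v] by (auto simp: M_def Y_def)
      then obtain n where n: "v = tail_mono n" using tail_mono_eqI by blast
      from y(2) consider "y \<in> W" "y \<noteq> 0" | h j where "h \<in> H" "y = h + e j" unfolding Y_eq by blast
      thus ?thesis
      proof cases
        case 1
        hence "y \<notin> H" using disjoint by blast
        hence "normal_form (semigroup_degree u) = u"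
          using normal_form_eq[of y n] 1
          by (auto simp: v n degree_tail_mono valid_def normal_mono_def semigroup_degree_add add.commute)
        thus ?thesis using rel_refl by simp
      next
        case (2 h j)
        let ?n = "\<lambda>k. n k + unit_fun j k" and ?i = "first_ray (\<lambda>k. n k + unit_fun j k)"
        have n0: "?n \<noteq> (\<lambda>_. 0)" using unit_fun_nonzero[of j] by (auto simp: fun_eq_iff)
        have i: "?n ?i \<noteq> 0" "\<iota> ?i \<le> \<iota> j"
          using first_ray[OF n0] by (auto simp: unit_fun_def)
        have "semigroup_degree u = h + ray_comb e ?n"
          by (simp add: v n 2 degree_tail_mono semigroup_degree_add ray_comb_add ray_comb_unit ac_simps)
        hence nf: "normal_form (semigroup_degree u)
            = tail_mono (\<lambda>k. ?n k - unit_fun ?i k) + single (h + e ?i) 1"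
          using normal_form_eq[of h ?n] 2 n0 by (simp add: valid_def normal_mono_def)
        show ?thesis
        proof (cases "?i = j")
          case True
          hence "(\<lambda>k. ?n k - unit_fun ?i k) = n" by auto
          thus ?thesis using nf True rel_refl by (simp add: v n 2)
        next
          case False
          hence less: "\<iota> ?i < \<iota> j" using i(2) inj_\<iota> by (metis inj_eq le_neq_implies_less)
          define n' where "n' k = n k - unit_fun ?i k" for k
          have "n ?i \<noteq> 0" using i(1) False by (simp add: unit_fun_def)
          hence n': "n = (\<lambda>k. n' k + unit_fun ?i k)" unfolding n'_def by (rule split_unit)
          let ?q = "single (e ?i) 1 + single (h + e j) 1"
          have q: "?q \<in> Q" using 2 less unfolding Q_def QH_def by blast
          have "u = tail_mono n' + ?q"
            unfolding v 2 n by (subst n') (simp only: tail_mono_add tail_mono_unit add.assoc)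
          moreover have "(\<lambda>k. ?n k - unit_fun ?i k) = (\<lambda>k. n' k + unit_fun j k)"
          proof
            fix k show "n k + unit_fun j k - unit_fun ?i k = n' k + unit_fun j k"
              using fun_cong[OF n', of k] by linarith
          qed
          moreover have "semigroup_degree ?q = h + e ?i + e j"
            by (simp add: semigroup_degree_add ac_simps)
          moreover note normal_form_pair[OF 2(1) less]
          ultimately show ?thesis
            using rel_shift[OF rel_Q[OF q] tail_mono_in_M[of n']] nf
            by (simp add: tail_mono_add tail_mono_unit add.assoc)
        qed
      qed
    next
      case 3
      then obtain y where y: "y \<in> keys u" "y \<in> Y"
        unfolding weight_def by (metis IntE all_not_in_conv not_numeral_le_zero sum.empty)
      obtain v where v: "u = v + single y 1" using y(1) by (rule split_off_key)
      have "weight Y v \<noteq> 0" using 3 y by (simp add: v weight_add weight_single)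
      then obtain y' where y': "y' \<in> keys v" "y' \<in> Y"
        unfolding weight_def by (metis IntE all_not_in_conv sum.empty)
      obtain w where w: "v = w + single y' 1" using y'(1) by (rule split_off_key)
      let ?q = "single y' 1 + single y 1"
      have u_eq: "u = w + ?q" by (simp add: v w add.assoc)
      have wM: "w \<in> M" "?q \<in> M" using less.prems unfolding u_eq M_add_iff by auto
      have "?q \<in> Q" using y y' by (auto simp: Q_def QY_def)
      hence step: "rel u (w + normal_form (semigroup_degree ?q))"
        unfolding u_eq by (intro rel_shift rel_Q wM)
      have q_S: "semigroup_degree ?q \<in> S" using wM(2) by (rule degree_in_S)
      have "weight Y (w + normal_form (semigroup_degree ?q)) < weight Y u"
        using normal_form_props(3)[OF q_S] y y' by (simp add: u_eq weight_add weight_single)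
      moreover have "w + normal_form (semigroup_degree ?q) \<in> M"
        using normal_form_props(1)[OF q_S] wM by (simp add: M_add_iff)
      moreover have "semigroup_degree (w + normal_form (semigroup_degree ?q)) = semigroup_degree u"
        using normal_form_props(2)[OF q_S] by (simp add: u_eq semigroup_degree_add)
      ultimately show ?thesis using rel_trans[OF step] less.hyps by metis
    qed
  qed
  thus ?thesis by (simp add: rel_def gen_def)
qed

lemma gen_carrier: "q \<in> M \<Longrightarrow> keys (gen q :: (nat ^ 'd \<Rightarrow>\<^sub>0 nat) \<Rightarrow>\<^sub>0 'k::field) \<subseteq> M"
  unfolding gen_def using normal_form_props(1)[OF degree_in_S, of q]
  by (intro keys_subset_diff) auto

lemma gen_in_defining_ideal: "q \<in> M \<Longrightarrow> (gen q :: (nat ^ 'd \<Rightarrow>\<^sub>0 nat) \<Rightarrow>\<^sub>0 'k::field) \<in> defining_ideal S"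
  using gen_carrier[of q] normal_form_props(2)[OF degree_in_S, of q]
  by (auto simp: defining_ideal_eq presentation_ring_def M_def gen_def presentation_map_diff)

lemma gen_dual:
  assumes "q \<in> Q" "q' \<in> Q"
  shows "lookup (gen q :: (nat ^ 'd \<Rightarrow>\<^sub>0 nat) \<Rightarrow>\<^sub>0 'k::field) q' = (if q = q' then 1 else 0)"
proof -
  have "normal_form (semigroup_degree q) \<noteq> q'"
    using normal_form_notin_Q[OF degree_in_S[OF Q_in_M[OF assms(1)]]] assms(2) by auto
  thus ?thesis by (simp add: gen_def lookup_minus lookup_single when_def)
qed

text \<open>Replacing every monomial of \<open>p\<close> by its normal form gives \<open>0\<close>, because the coefficient sums of \<open>p\<close>
  in all degrees vanish; so \<open>p\<close> is a combination of differences of monomials and normal forms.\<close>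

lemma defining_ideal_generated:
  fixes J :: "((nat ^ 'd \<Rightarrow>\<^sub>0 nat) \<Rightarrow>\<^sub>0 'k::field) set"
  assumes J: "ideal J (presentation_ring S)" and gen_J: "\<And>q. q \<in> Q \<Longrightarrow> gen q \<in> J"
  shows "defining_ideal S \<subseteq> J"
proof
  interpret supported M "presentation_ring S :: ((nat ^ 'd \<Rightarrow>\<^sub>0 nat) \<Rightarrow>\<^sub>0 'k) ring"
    by (rule supported_M) (simp add: presentation_ring_eq M_def)
  fix p :: "(nat ^ 'd \<Rightarrow>\<^sub>0 nat) \<Rightarrow>\<^sub>0 'k" assume "p \<in> defining_ideal S"
  hence p: "keys p \<subseteq> M" "presentation_map p = 0"
    by (auto simp: defining_ideal_eq presentation_ring_def M_def)
  let ?K = "keys p" and ?c = "lookup p"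
  let ?nf = "\<lambda>u. normal_form (semigroup_degree u)"
  have "(\<Sum>u\<in>?K. single (?nf u) (?c u)) = 0"
  proof (rule poly_mapping_eqI)
    fix k
    have "lookup (\<Sum>u\<in>?K. single (?nf u) (?c u)) k
        = (\<Sum>u\<in>?K. ?c u when ?nf u = k)"
      by (simp add: lookup_sum lookup_single)
    also have "\<dots> = 0"
    proof (cases "\<exists>u\<in>?K. ?nf u = k")
      case True
      then obtain u0 where u0: "u0 \<in> ?K" "?nf u0 = k" by blast
      have "?nf u = k \<longleftrightarrow> semigroup_degree u = semigroup_degree u0" if "u \<in> ?K" for u
        using normal_form_props(2)[OF degree_in_S, of u] normal_form_props(2)[OF degree_in_S, of u0]
          p(1) that u0 by (metis subsetD)
      hence "(\<Sum>u\<in>?K. ?c u when ?nf u = k)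
          = (\<Sum>u\<in>?K. ?c u when semigroup_degree u = semigroup_degree u0)"
        by (intro sum.cong) (auto simp: when_def)
      also have "\<dots> = 0" using p(2) lookup_presentation_map[of p "semigroup_degree u0"] by simp
      finally show ?thesis .
    qed (auto intro!: sum.neutral)
    finally show "lookup (\<Sum>u\<in>?K. single (?nf u) (?c u)) k
        = lookup 0 k" by simp
  qed
  hence "p = (\<Sum>u\<in>?K. single u (?c u)) - (\<Sum>u\<in>?K. single (?nf u) (?c u))"
    using poly_mapping_sum_single[of p] by simp
  also have "\<dots> = (\<Sum>u\<in>?K. single 0 (?c u) * gen u)"
    by (simp add: sum_subtractf[symmetric] gen_def right_diff_distrib mult_single)
  also have "\<dots> \<in> J"
    using p(1) by (intro ideal_sum[OF J] ideal_mult[OF J] normal_form_reduction[OF J gen_J]) auto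
  finally show "p \<in> J" .
qed

lemma finite_Y: "finite Y"
  using finite_msg by (simp add: Y_def)

text \<open>A product of two generators is determined by its set of variables, which has one or two
  elements.\<close>

lemma card_QY: "card QY = card Y + (card Y choose 2)"
proof -
  let ?P1 = "{A. A \<subseteq> Y \<and> card A = 1}" and ?P2 = "{A. A \<subseteq> Y \<and> card A = 2}"
  have keys_pair: "keys (single y (1::nat) + single y' 1) = {y, y'}"
    for y y' :: "nat ^ 'd" by (simp add: keys_add_nat insert_commute)
  have "inj_on keys QY"
    by (rule inj_onI) (auto simp: QY_def keys_pair doubleton_eq_iff add.commute simp del: One_nat_def)
  moreover have "keys ` QY = ?P1 \<union> ?P2"
  proof (intro equalityI subsetI)
    fix A assume "A \<in> keys ` QY"
    then obtain y y' where "A = {y, y'}" "y \<in> Y" "y' \<in> Y" by (auto simp: QY_def keys_pair simp del: One_nat_def)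
    thus "A \<in> ?P1 \<union> ?P2" by (cases "y = y'") auto
  next
    fix A assume "A \<in> ?P1 \<union> ?P2"
    then obtain y y' where "A = {y, y'}" "y \<in> Y" "y' \<in> Y"
      by (elim UnE CollectE conjE) (auto simp: card_1_singleton_iff card_2_iff)
    thus "A \<in> keys ` QY"
      by (intro image_eqI[of _ _ "single y 1 + single y' 1"])
        (auto simp only: keys_pair QY_def)
  qed
  ultimately have "card QY = card (?P1 \<union> ?P2)" by (metis card_image)
  also have "\<dots> = card ?P1 + card ?P2"
    using finite_Y by (intro card_Un_disjoint) (auto intro: finite_subset[of _ "Pow Y"])
  finally show ?thesis using finite_Y by (simp add: n_subsets)
qed

lemma finite_H: "finite H"
proof (rule finite_imageD)
  show "finite ((\<lambda>h. h + e undefined) ` H)"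
    using finite_msg shift_in_msg by (auto intro: finite_subset[of _ "msg S"])
qed (simp add: inj_on_def)

lemma card_QH: "card QH = card H * (CARD('d) choose 2)"
proof -
  let ?P = "{(i, j). \<iota> i < \<iota> j}" and ?P2 = "{A. A \<subseteq> (UNIV :: 'd set) \<and> card A = 2}"
  let ?f = "\<lambda>(h, i, j). single (e i) (1::nat) + single (h + e j) 1"
  have keys_pair: "keys (single y (1::nat) + single y' 1) = {y, y'}"
    for y y' :: "nat ^ 'd" by (simp add: keys_add_nat insert_commute)
  have inj: "inj_on ?f (H \<times> ?P)"
  proof (rule inj_onI)
    fix x x' assume "x \<in> H \<times> ?P" "x' \<in> H \<times> ?P" and fx: "?f x = ?f x'"
    then obtain h i j h' i' j' where x: "x = (h, i, j)" "x' = (h', i', j')" and h: "h \<in> H" "h' \<in> H"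
      by (cases x, cases x') auto
    have eq: "single (e i) (1::nat) + single (h + e j) 1
        = single (e i') 1 + single (h' + e j') 1"
      using fx unfolding x prod.case .
    have "{e i, h + e j} = {e i', h' + e j'}" using arg_cong[OF eq, of keys] by (simp only: keys_pair)
    thus "x = x'"
      using h by (simp add: x doubleton_eq_iff e_inj shift_inj shift_neq_e)
  qed
  have image: "?f ` (H \<times> ?P) = QH"
  proof (intro equalityI subsetI)
    fix q assume "q \<in> QH"
    then obtain h i j where q: "q = single (e i) 1 + single (h + e j) 1"
      "h \<in> H" "\<iota> i < \<iota> j" unfolding QH_def by blast
    show "q \<in> ?f ` (H \<times> ?P)" by (rule image_eqI[of _ _ "(h, i, j)"]) (use q in simp_all)
  next
    fix q assume "q \<in> ?f ` (H \<times> ?P)"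
    then obtain h i j where "q = ?f (h, i, j)" "h \<in> H" "\<iota> i < \<iota> j" by auto
    thus "q \<in> QH" unfolding QH_def prod.case by blast
  qed
  have "card QH = card (H \<times> ?P)" using card_image[OF inj] unfolding image .
  also have "\<dots> = card H * card ?P" by (rule card_cartesian_product)
  also have "card ?P = card ?P2"
  proof (rule bij_betw_same_card[of "\<lambda>(i, j). {i, j}"], unfold bij_betw_def, intro conjI)
    show "inj_on (\<lambda>(i, j). {i, j}) ?P" by (rule inj_onI) (auto simp: doubleton_eq_iff)
    show "(\<lambda>(i, j). {i, j}) ` ?P = ?P2"
    proof (intro equalityI subsetI)
      fix A assume "A \<in> ?P2"
      then obtain i j where A: "A = {i, j}" "i \<noteq> j" by (auto simp: card_2_iff)
      hence "\<iota> i < \<iota> j \<or> \<iota> j < \<iota> i" using inj_\<iota> by (metis inj_eq nat_neq_iff)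
      thus "A \<in> (\<lambda>(i, j). {i, j}) ` ?P" using A by (auto simp: image_iff insert_commute)
    qed (auto simp: card_2_iff)
  qed
  also have "card ?P2 = (CARD('d) choose 2)" by (rule n_subsets) simp
  finally show ?thesis .
qed

lemma finite_Q: "finite Q"
proof -
  have "QY \<subseteq> (\<lambda>(y, y'). single y 1 + single y' 1) ` (Y \<times> Y)"
    by (auto simp: QY_def)
  moreover have "QH \<subseteq> (\<lambda>(h, i, j). single (e i) 1 + single (h + e j) 1) ` (H \<times> UNIV)"
  proof
    fix q assume "q \<in> QH"
    then obtain h i j where q: "q = single (e i) 1 + single (h + e j) 1"
      "h \<in> H" unfolding QH_def by blast
    show "q \<in> (\<lambda>(h, i, j). single (e i) 1 + single (h + e j) 1) ` (H \<times> UNIV)"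
      by (rule image_eqI[of _ _ "(h, i, j)"]) (use q in simp_all)
  qed
  ultimately show ?thesis
    unfolding Q_def using finite_Y finite_H by (intro finite_UnI) (auto intro: finite_subset)
qed

theorem mu_eq_card_Q: "mu TYPE('k::field) S = card Q"
proof -
  interpret supported M "presentation_ring S :: ((nat ^ 'd \<Rightarrow>\<^sub>0 nat) \<Rightarrow>\<^sub>0 'k) ring"
    by (rule supported_M) (simp add: presentation_ring_eq M_def)
  let ?I = "defining_ideal S :: ((nat ^ 'd \<Rightarrow>\<^sub>0 nat) \<Rightarrow>\<^sub>0 'k) set"
  let ?R = "presentation_ring S :: ((nat ^ 'd \<Rightarrow>\<^sub>0 nat) \<Rightarrow>\<^sub>0 'k) ring"
  let ?G = "gen ` Q :: ((nat ^ 'd \<Rightarrow>\<^sub>0 nat) \<Rightarrow>\<^sub>0 'k) set"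
  have car: "?G \<subseteq> carrier ?R" using gen_carrier[where 'k = 'k] Q_in_M by (auto simp: carrier_R)
  have GI: "?G \<subseteq> ?I" using gen_in_defining_ideal[where 'k = 'k] Q_in_M by auto
  have Idl_G: "Idl\<^bsub>?R\<^esub> ?G = ?I"
  proof
    show "Idl\<^bsub>?R\<^esub> ?G \<subseteq> ?I" by (rule R.genideal_minimal[OF ideal_defining_ideal GI])
    show "?I \<subseteq> Idl\<^bsub>?R\<^esub> ?G"
      using R.genideal_self[OF car] by (intro defining_ideal_generated R.genideal_ideal[OF car]) auto
  qed
  have residue: "lookup (r * f) q = lookup r 0 * lookup f q"
    if "f \<in> ?I" "r \<in> carrier ?R" "q \<in> Q" for f r q
    using that by (intro quadratic_coefficient_residue Q_weight) (auto simp: carrier_R)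
  have homog: "homogeneous f" if "f \<in> ?G" for f
  proof -
    from that obtain q where q: "q \<in> Q" "f = gen q" by blast
    have "semigroup_degree (normal_form (semigroup_degree q)) = semigroup_degree q"
      using q(1) by (intro normal_form_props degree_in_S Q_in_M)
    thus ?thesis
      using keys_diff[of "single q (1::'k)" "single (normal_form (semigroup_degree q)) 1"]
      unfolding q(2) homogeneous_def gen_def by (intro exI[of _ "semigroup_degree q"]) auto
  qed
  have "inj_on (gen :: _ \<Rightarrow> (nat ^ 'd \<Rightarrow>\<^sub>0 nat) \<Rightarrow>\<^sub>0 'k) Q"
  proof (rule inj_onI)
    fix q q' assume q: "q \<in> Q" "q' \<in> Q" "(gen q :: (nat ^ 'd \<Rightarrow>\<^sub>0 nat) \<Rightarrow>\<^sub>0 'k) = gen q'"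
    show "q = q'" using gen_dual[OF q(1) q(2), where 'k = 'k] gen_dual[OF q(2) q(2), where 'k = 'k] q(3)
      by (auto split: if_splits)
  qed
  hence card_G: "card ?G = card Q" by (rule card_image)
  show ?thesis
    unfolding mu_def
  proof (rule the_equality)
    have "minimal_homogeneous_generators S ?G"
      unfolding minimal_homogeneous_generators_def
      using car homog Idl_G dual_generators_minimal[OF finite_Q car Idl_G gen_dual residue] by blast
    thus "\<exists>F :: ((nat ^ 'd \<Rightarrow>\<^sub>0 nat) \<Rightarrow>\<^sub>0 'k) set. minimal_homogeneous_generators S F \<and> finite F \<and> card F = card Q"
      using card_G finite_Q by blast
  next
    fix r assume "\<exists>F :: ((nat ^ 'd \<Rightarrow>\<^sub>0 nat) \<Rightarrow>\<^sub>0 'k) set. minimal_homogeneous_generators S F \<and> finite F \<and> card F = r"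
    then obtain F :: "((nat ^ 'd \<Rightarrow>\<^sub>0 nat) \<Rightarrow>\<^sub>0 'k) set" where F: "F \<subseteq> carrier ?R" "\<forall>f\<in>F. homogeneous f" "Idl\<^bsub>?R\<^esub> F = ?I"
      "\<forall>F'. F' \<subset> F \<longrightarrow> Idl\<^bsub>?R\<^esub> F' \<noteq> ?I" and fin: "finite F" "card F = r"
      unfolding minimal_homogeneous_generators_def by blast
    have pointed: "u = 0" if "u \<in> M" "v \<in> M" "u + v = 0" for u v
      using that keys_add_nat[of u v] by auto
    have minimal: "Idl\<^bsub>?R\<^esub> F' \<noteq> ?I" if "F' \<subset> F" for F'
      using F(4) that by blast
    have homog_F: "\<exists>s. \<forall>u\<in>keys f. semigroup_degree u = s" if "f \<in> F" for f
      using F(2) that unfolding homogeneous_def by blast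
    have "card F = card Q"
      by (rule card_minimal_generators[OF semigroup_degree_add degree_eq_0 pointed finite_Q car Idl_G
            gen_dual residue F(1) fin(1) F(3) minimal homog_F])
    thus "r = card Q" using fin by simp
  qed
qed

corollary mu_formula:
  "real (mu TYPE('k::field) S) = 1 / 2 * (real (card Y) * (real (card Y) + 1)
    + real CARD('d) * (real CARD('d) - 1) * real (card H))"
proof -
  have "QY \<inter> QH = {}" using QY_weight QH_weight by fastforce
  hence "card Q = card QY + card QH"
    unfolding Q_def using finite_Q by (intro card_Un_disjoint) (auto simp: Q_def)
  thus ?thesis
    by (simp add: mu_eq_card_Q card_QY card_QH real_choose_two field_simps)
qed

end

section \<open>Primes in rings of fractions, and chains of primes\<close>

context mult_closed
begin

abbreviation "Q \<equiv> ring_of_fractions R U"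

sublocale fractions: cring Q by (rule ring_of_fractions_cring)

definition extension :: "'a set \<Rightarrow> ('a \<times> 'a) set set"
  where "extension P = {fraction R U a s | a s. a \<in> P \<and> s \<in> U}"

definition contraction :: "('a \<times> 'a) set set \<Rightarrow> 'a set"
  where "contraction J = {a \<in> carrier R. fraction R U a \<one> \<in> J}"

lemma fraction_in_extension:
  assumes P: "primeideal P R" "P \<inter> U = {}" and a: "a \<in> carrier R" "s \<in> U"
  shows "fraction R U a s \<in> extension P \<longleftrightarrow> a \<in> P"
proof
  interpret P: primeideal P R by (rule P(1))
  assume "fraction R U a s \<in> extension P"
  then obtain b t where bt: "b \<in> P" "t \<in> U" "fraction R U a s = fraction R U b t"
    by (auto simp: extension_def)
  have b: "b \<in> carrier R" using bt(1) P.a_subset by blast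
  have "(b, t) \<in> fraction R U a s" using bt(3) frac_self[OF b bt(2)] by simp
  then obtain u where u: "u \<in> U" "u \<otimes> (t \<otimes> a) = u \<otimes> (s \<otimes> b)" by (auto simp: frac_iff)
  have "u \<otimes> t \<otimes> a \<in> P"
    using u bt b a by (simp add: m_assoc P.I_l_closed)
  hence "u \<otimes> t \<in> P \<or> a \<in> P" using u(1) bt(2) a by (intro P.I_prime) auto
  thus "a \<in> P" using mult_U[OF u(1) bt(2)] P(2) by blast
qed (use a in \<open>auto simp: extension_def\<close>)

lemma extension_prime:
  assumes P: "primeideal P R" "P \<inter> U = {}"
  shows "primeideal (extension P) Q"
proof -
  interpret P: primeideal P R by (rule P(1))
  have sub: "P \<subseteq> carrier R" by (rule P.a_subset)
  note in_ext = fraction_in_extension[OF P]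
  have elim: "\<exists>a s. a \<in> P \<and> a \<in> carrier R \<and> s \<in> U \<and> x = fraction R U a s" if "x \<in> extension P" for x
    using that sub by (auto simp: extension_def)
  have "ideal (extension P) Q"
  proof (rule fractions.idealI_comm)
    show "extension P \<subseteq> carrier Q" using elim frac_carr by blast
    show "\<zero>\<^bsub>Q\<^esub> \<in> extension P" using one_U by (simp add: frac_zero in_ext)
  next
    fix x y assume "x \<in> extension P" "y \<in> extension P"
    then obtain a s b t where h: "a \<in> P" "a \<in> carrier R" "s \<in> U" "x = fraction R U a s"
      "b \<in> P" "b \<in> carrier R" "t \<in> U" "y = fraction R U b t" using elim by metis
    thus "x \<oplus>\<^bsub>Q\<^esub> y \<in> extension P"
      by (simp add: frac_add in_ext mult_U P.I_l_closed)
  next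
    fix r x assume "r \<in> carrier Q" "x \<in> extension P"
    then obtain a s b t where h: "a \<in> P" "a \<in> carrier R" "s \<in> U" "x = fraction R U a s"
      "b \<in> carrier R" "t \<in> U" "r = fraction R U b t" using elim frac_cases by metis
    thus "r \<otimes>\<^bsub>Q\<^esub> x \<in> extension P"
      by (simp add: frac_mult in_ext mult_U P.I_l_closed)
  qed
  thus ?thesis
  proof (rule primeidealI)
    show "cring Q" by (rule ring_of_fractions_cring)
    have "\<one>\<^bsub>Q\<^esub> \<notin> extension P" using one_U P(2) by (auto simp: frac_one in_ext)
    thus "carrier Q \<noteq> extension P" using fractions.one_closed by blast
    fix x y assume "x \<in> carrier Q" "y \<in> carrier Q" and xy: "x \<otimes>\<^bsub>Q\<^esub> y \<in> extension P"
    then obtain a s b t where h: "a \<in> carrier R" "s \<in> U" "x = fraction R U a s"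
      "b \<in> carrier R" "t \<in> U" "y = fraction R U b t" using frac_cases by metis
    hence "a \<otimes> b \<in> P" using xy by (simp add: frac_mult in_ext mult_U)
    thus "x \<in> extension P \<or> y \<in> extension P" using h P.I_prime by (simp add: in_ext)
  qed
qed

lemma extension_mono:
  assumes P: "primeideal P R" "P \<inter> U = {}" and P': "primeideal P' R" "P' \<inter> U = {}" and less: "P \<subset> P'"
  shows "extension P \<subset> extension P'"
proof
  show "extension P \<subseteq> extension P'" using less by (auto simp: extension_def)
  obtain a where a: "a \<in> P'" "a \<notin> P" using less by blast
  have "a \<in> carrier R" using a(1) P'(1) by (meson ideal.Icarr primeideal.axioms(1))
  thus "extension P \<noteq> extension P'"
    using a fraction_in_extension[OF P, of a \<one>] fraction_in_extension[OF P', of a \<one>] one_U by blast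
qed

lemma contraction_ideal:
  assumes J: "ideal J Q"
  shows "ideal (contraction J) R"
proof (rule idealI_comm)
  interpret J: ideal J Q by (rule J)
  show "\<zero> \<in> contraction J"
    using J.zero_closed by (simp add: contraction_def frac_zero)
  show "x \<oplus> y \<in> contraction J" if "x \<in> contraction J" "y \<in> contraction J" for x y
    using that J.a_closed[of "fraction R U x \<one>" "fraction R U y \<one>"] one_U
    by (simp add: contraction_def frac_add)
  show "r \<otimes> x \<in> contraction J" if "r \<in> carrier R" "x \<in> contraction J" for r x
    using that J.I_l_closed[of "fraction R U x \<one>" "fraction R U r \<one>"] one_U
    by (simp add: contraction_def frac_mult frac_carr)
qed (auto simp: contraction_def)

lemma fraction_split: "a \<in> carrier R \<Longrightarrow> s \<in> U \<Longrightarrow>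
    fraction R U a s = fraction R U \<one> s \<otimes>\<^bsub>Q\<^esub> fraction R U a \<one>"
  "a \<in> carrier R \<Longrightarrow> s \<in> U \<Longrightarrow>
    fraction R U a \<one> = fraction R U s \<one> \<otimes>\<^bsub>Q\<^esub> fraction R U a s"
  using one_U by (simp_all add: frac_mult) (rule frac_eqI, auto simp: mult_U m_comm)

lemma fraction_in_ideal:
  assumes J: "ideal J Q" and a: "a \<in> carrier R" "s \<in> U"
  shows "fraction R U a s \<in> J \<longleftrightarrow> a \<in> contraction J"
proof -
  interpret J: ideal J Q by (rule J)
  have car: "fraction R U s \<one> \<in> carrier Q" "fraction R U \<one> s \<in> carrier Q"
    using a one_U by (simp_all add: frac_carr)
  show ?thesis
  proof
    assume "fraction R U a s \<in> J"
    hence "fraction R U a \<one> \<in> J" unfolding fraction_split(2)[OF a] by (rule J.I_l_closed[OF _ car(1)])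
    thus "a \<in> contraction J" using a by (simp add: contraction_def)
  next
    assume "a \<in> contraction J"
    hence "fraction R U a \<one> \<in> J" by (simp add: contraction_def)
    thus "fraction R U a s \<in> J" unfolding fraction_split(1)[OF a] by (rule J.I_l_closed[OF _ car(2)])
  qed
qed

lemma contraction_prime:
  assumes J: "primeideal J Q"
  shows "primeideal (contraction J) R"
proof (rule primeidealI)
  interpret J: primeideal J Q by (rule J)
  show "ideal (contraction J) R" by (rule contraction_ideal) (rule J.ideal_axioms)
  show "cring R" by unfold_locales
  have "\<one>\<^bsub>Q\<^esub> \<notin> J" using J.I_notcarr J.one_imp_carrier by blast
  thus "carrier R \<noteq> contraction J" using one_closed by (auto simp: contraction_def frac_one)
  fix a b assume "a \<in> carrier R" "b \<in> carrier R" "a \<otimes> b \<in> contraction J"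
  thus "a \<in> contraction J \<or> b \<in> contraction J"
    using J.I_prime[of "fraction R U a \<one>" "fraction R U b \<one>"] one_U
    by (simp add: contraction_def frac_mult frac_carr)
qed

lemma contraction_mono:
  assumes J: "ideal J Q" "ideal J' Q" and less: "J \<subset> J'"
  shows "contraction J \<subset> contraction J'"
proof
  show "contraction J \<subseteq> contraction J'" using less by (auto simp: contraction_def)
  obtain x where x: "x \<in> J'" "x \<notin> J" using less by blast
  have "x \<in> carrier Q" using x(1) J(2) by (meson ideal.Icarr)
  then obtain a s where a: "a \<in> carrier R" "s \<in> U" "x = fraction R U a s" by (rule frac_cases)
  thus "contraction J \<noteq> contraction J'"
    using x fraction_in_ideal[OF J(1) a(1,2)] fraction_in_ideal[OF J(2) a(1,2)] by blast
qed

lemma pow_U: "s \<in> U \<Longrightarrow> s [^] (n::nat) \<in> U"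
  by (induction n) (simp_all add: one_U mult_U)

lemma fraction_pow:
  "a \<in> carrier R \<Longrightarrow> s \<in> U \<Longrightarrow> fraction R U a s [^]\<^bsub>Q\<^esub> (n::nat) = fraction R U (a [^] n) (s [^] n)"
  by (induction n) (simp_all add: frac_one frac_mult pow_U)

text \<open>An element of the ring of fractions outside the extension of \<open>P\<close> has a numerator in \<open>U\<close>, so it is
  a unit.\<close>

lemma extension_maximal:
  assumes P: "primeideal P R" "U = carrier R - P"
  shows "maximalideal (extension P) Q"
proof -
  interpret P: primeideal P R by (rule P(1))
  have PU: "P \<inter> U = {}" using P(2) by blast
  interpret E: primeideal "extension P" Q by (rule extension_prime[OF P(1) PU])
  show ?thesis
  proof (rule maximalidealI)
    show "ideal (extension P) Q" by (rule E.ideal_axioms)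
    show "carrier Q \<noteq> extension P" by (rule E.I_notcarr)
    fix J assume J: "ideal J Q" "extension P \<subseteq> J" "J \<subseteq> carrier Q"
    show "J = extension P \<or> J = carrier Q"
    proof (cases "J = extension P")
      case False
      interpret J: ideal J Q by (rule J(1))
      obtain x where x: "x \<in> J" "x \<notin> extension P" using False J(2) by blast
      have "x \<in> carrier Q" using x J by blast
      then obtain a s where a: "a \<in> carrier R" "s \<in> U" "x = fraction R U a s" by (rule frac_cases)
      have aU: "a \<in> U" using x(2) a P(2) fraction_in_extension[OF P(1) PU a(1,2)] by blast
      have "fraction R U s a \<otimes>\<^bsub>Q\<^esub> x = \<one>\<^bsub>Q\<^esub>"
        using a aU one_U by (simp add: frac_mult frac_one) (rule frac_eqI, auto simp: mult_U m_comm)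
      moreover have "fraction R U s a \<in> carrier Q" using a aU by (simp add: frac_carr)
      ultimately have "\<one>\<^bsub>Q\<^esub> \<in> J" using J.I_l_closed[OF x(1)] by metis
      thus ?thesis using J.one_imp_carrier by blast
    qed simp
  qed
qed

end

text \<open>The monomial in \<open>z\<^sub>0, z\<^sub>1, \<dots>\<close> with the given list of exponents.\<close>

fun zpow :: "(nat \<Rightarrow> 'a::comm_monoid_mult) \<Rightarrow> nat list \<Rightarrow> 'a" where
  "zpow z [] = 1"
| "zpow z (x # xs) = z 0 ^ x * zpow (\<lambda>i. z (Suc i)) xs"

context supported
begin

lemma prime_properties:
  assumes "primeideal P R"
  shows "ideal P R" "1 \<notin> P" "\<And>a b. a \<in> carrier R \<Longrightarrow> b \<in> carrier R \<Longrightarrow> a * b \<in> P \<Longrightarrow> a \<in> P \<or> b \<in> P"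
proof -
  interpret P: primeideal P R by (rule assms)
  show "ideal P R" by (rule P.ideal_axioms)
  show "1 \<notin> P" using P.I_notcarr P.one_imp_carrier by auto
  show "a \<in> P \<or> b \<in> P" if "a \<in> carrier R" "b \<in> carrier R" "a * b \<in> P" for a b
    using P.I_prime[of a b] that by simp
qed

lemma prime_power:
  assumes "primeideal P R" "a \<in> carrier R" "a \<notin> P"
  shows "a ^ n \<notin> P"
proof (induction n)
  case (Suc n)
  show ?case
  proof
    assume "a ^ Suc n \<in> P"
    hence "a \<in> P \<or> a ^ n \<in> P" using prime_properties(3)[OF assms(1,2), of "a ^ n"] assms(2) by auto
    thus False using assms(3) Suc by blast
  qed
qed (simp add: prime_properties(2)[OF assms(1)])

lemma zpow_carrier: "(\<And>i. i < length xs \<Longrightarrow> z i \<in> carrier R) \<Longrightarrow> zpow z xs \<in> carrier R"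
  by (induction z xs rule: zpow.induct) (auto intro!: mult_carrier power_carrier)

text \<open>Suppose that a polynomial expression in the \<open>z\<^sub>i\<close> lies in \<open>P\<^sub>0\<close>, and factor out the least power
  of \<open>z\<^sub>0\<close>. As \<open>z\<^sub>0 \<notin> P\<^sub>0\<close>, the cofactor lies in \<open>P\<^sub>0 \<subseteq> P\<^sub>1\<close>. Since \<open>z\<^sub>0 \<in> P\<^sub>1\<close>, the terms free of
  \<open>z\<^sub>0\<close> then form an expression in \<open>z\<^sub>1, z\<^sub>2, \<dots>\<close> that lies in \<open>P\<^sub>1\<close>. After the last variable a
  nonzero constant remains in a prime ideal.\<close>

lemma chain_algebraically_independent:
  assumes "\<And>i. i \<le> n \<Longrightarrow> primeideal (P i) R" "\<And>i. i < n \<Longrightarrow> P i \<subseteq> P (Suc i)"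
    and "\<And>i. i < n \<Longrightarrow> z i \<in> P (Suc i) - P i"
    and "finite A" "A \<noteq> {}" "\<And>xs. xs \<in> A \<Longrightarrow> length xs = n \<and> c xs \<noteq> 0"
  shows "(\<Sum>xs\<in>A. single 0 (c xs) * zpow z xs) \<notin> P 0"
  using assms
proof (induction n arbitrary: P z A c)
  case 0
  have "A \<subseteq> {[]}" using 0(6) by fastforce
  hence A: "A = {[]}" using 0(5) by blast
  have c0: "c [] \<noteq> 0" using 0(6)[of "[]"] A by simp
  have P0: "primeideal (P 0) R" using 0(1) by simp
  show ?case
  proof
    assume "(\<Sum>xs\<in>A. single 0 (c xs) * zpow z xs) \<in> P 0"
    hence "single 0 (1 / c []) * single 0 (c []) \<in> P 0"
      by (intro ideal_mult[OF prime_properties(1)[OF P0]]) (simp_all add: A)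
    thus False using c0 prime_properties(2)[OF P0] by (simp add: mult_single)
  qed
next
  case (Suc n)
  have P0: "primeideal (P 0) R" and P1: "primeideal (P (Suc 0)) R" using Suc.prems(1) by simp_all
  have z_carrier: "z i \<in> carrier R" if "i < Suc n" for i
    using Suc.prems(3)[OF that] ideal_carrier[OF prime_properties(1)[OF Suc.prems(1)[of "Suc i"]]] that by auto
  let ?z = "\<lambda>i. z (Suc i)"
  \<comment> \<open>the least power of \<open>z\<^sub>0\<close>, attained exactly on \<open>A0\<close>\<close>
  define m where "m = Min (hd ` A)"
  have m_le: "m \<le> hd xs" if "xs \<in> A" for xs using that Suc.prems(4) by (simp add: m_def)
  have "m \<in> hd ` A" unfolding m_def using Suc.prems(4,5) by (intro Min_in) auto
  define A0 where "A0 = {xs \<in> A. hd xs = m}"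
  have A0: "A0 \<subseteq> A" "A0 \<noteq> {}" using \<open>m \<in> hd ` A\<close> by (auto simp: A0_def)
  have cons: "xs = hd xs # tl xs" "length (tl xs) = n" if "xs \<in> A" for xs
    using Suc.prems(6)[OF that] by (cases xs; simp)+
  have inj_tl: "inj_on tl A0"
  proof (rule inj_onI)
    fix xs ys assume "xs \<in> A0" "ys \<in> A0" "tl xs = tl ys"
    thus "xs = ys" using cons(1)[of xs] cons(1)[of ys] by (simp add: A0_def)
  qed
  define T where "T = (\<Sum>ys\<in>tl ` A0. single 0 (c (m # ys)) * zpow ?z ys)"
  define V where "V = (\<Sum>xs\<in>A - A0. single 0 (c xs) * (z 0 ^ (hd xs - m - 1) * zpow ?z (tl xs)))"
  have tl_carrier: "zpow ?z (tl xs) \<in> carrier R" if "xs \<in> A" for xs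
    using cons(2)[OF that] z_carrier by (intro zpow_carrier) simp
  have "T = (\<Sum>xs\<in>A0. single 0 (c (m # tl xs)) * zpow ?z (tl xs))"
    unfolding T_def by (simp add: sum.reindex[OF inj_tl])
  also have "z 0 ^ m * \<dots> = (\<Sum>xs\<in>A0. single 0 (c xs) * zpow z xs)"
    unfolding sum_distrib_left
  proof (rule sum.cong)
    fix xs assume xs: "xs \<in> A0"
    hence "xs = m # tl xs" using cons(1)[of xs] A0(1) by (auto simp: A0_def)
    hence "zpow z xs = z 0 ^ m * zpow ?z (tl xs)" "c (m # tl xs) = c xs" by (metis zpow.simps(2), simp)
    thus "z 0 ^ m * (single 0 (c (m # tl xs)) * zpow ?z (tl xs))
        = single 0 (c xs) * zpow z xs" by (simp add: mult.left_commute)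
  qed simp
  finally have T: "z 0 ^ m * T = (\<Sum>xs\<in>A0. single 0 (c xs) * zpow z xs)" .
  have V: "z 0 ^ m * (z 0 * V) = (\<Sum>xs\<in>A - A0. single 0 (c xs) * zpow z xs)"
    unfolding V_def sum_distrib_left
  proof (rule sum.cong)
    fix xs assume xs: "xs \<in> A - A0"
    hence "hd xs = m + 1 + (hd xs - m - 1)" using m_le[of xs] by (auto simp: A0_def)
    hence "z 0 ^ hd xs = z 0 ^ m * z 0 * z 0 ^ (hd xs - m - 1)" by (metis power_add power_one_right)
    moreover have "zpow z xs = z 0 ^ hd xs * zpow ?z (tl xs)"
      using cons(1)[of xs] xs by (metis DiffD1 zpow.simps(2))
    ultimately show "z 0 ^ m * (z 0 * (single 0 (c xs) * (z 0 ^ (hd xs - m - 1) * zpow ?z (tl xs))))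
        = single 0 (c xs) * zpow z xs"
      by (simp only: ac_simps)
  qed simp
  have sum_eq: "(\<Sum>xs\<in>A. single 0 (c xs) * zpow z xs) = z 0 ^ m * (T + z 0 * V)"
    unfolding distrib_left T V using Suc.prems(4) A0(1) by (subst add.commute) (rule sum.subset_diff)
  have T_carrier: "T \<in> carrier R"
    unfolding T_def using A0(1) tl_carrier by (auto intro!: sum_carrier mult_carrier)
  have V_carrier: "V \<in> carrier R"
    unfolding V_def using z_carrier tl_carrier by (auto intro!: sum_carrier mult_carrier power_carrier)
  have z0: "z 0 \<in> carrier R" "z 0 \<notin> P 0" "z 0 \<in> P (Suc 0)"
    using z_carrier[of 0] Suc.prems(3)[of 0] by auto
  show ?case
  proof
    assume "(\<Sum>xs\<in>A. single 0 (c xs) * zpow z xs) \<in> P 0"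
    hence "T + z 0 * V \<in> P 0"
      using prime_properties(3)[OF P0, of "z 0 ^ m" "T + z 0 * V"] prime_power[OF P0 z0(1,2), of m]
        z0 T_carrier V_carrier unfolding sum_eq by blast
    hence "T + z 0 * V \<in> P (Suc 0)" using Suc.prems(2)[of 0] by blast
    moreover have "z 0 * V \<in> P (Suc 0)"
      using ideal_mult[OF prime_properties(1)[OF P1] V_carrier z0(3)] by (simp add: mult.commute)
    ultimately have "T \<in> P (Suc 0)"
      using ideal_diff[OF prime_properties(1)[OF P1], of "T + z 0 * V" "z 0 * V"] by simp
    moreover have "T \<notin> P (Suc 0)"
      unfolding T_def
    proof (rule Suc.IH[where P = "\<lambda>i. P (Suc i)"])
      show "length ys = n \<and> c (m # ys) \<noteq> 0" if ys: "ys \<in> tl ` A0" for ys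
      proof -
        from ys obtain xs where xs: "xs \<in> A0" "ys = tl xs" by blast
        hence "xs \<in> A" "xs = m # ys" using cons(1)[of xs] A0(1) by (auto simp: A0_def)
        thus ?thesis using Suc.prems(6)[of xs] by simp
      qed
    qed (use Suc.prems(1-4) A0 finite_subset[OF A0(1)] in auto)
    ultimately show False by blast
  qed
qed

end

section \<open>Polynomials over the free commutative monoid\<close>

text \<open>Take the lexicographic maxima of \<open>A\<close> and \<open>B\<close> for the coordinates in the order of \<open>ds\<close>.\<close>

lemma lex_max_pair:
  fixes A B :: "(nat ^ 'd) set"
  assumes "finite A" "A \<noteq> {}" "finite B" "B \<noteq> {}"
  shows "\<exists>a0\<in>A. \<exists>b0\<in>B. \<forall>a\<in>A. \<forall>b\<in>B. a + b = a0 + b0 \<longrightarrow> (\<forall>i\<in>set ds. a $ i = a0 $ i)"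
  using assms
proof (induction ds arbitrary: A B)
  case (Cons i ds)
  define A' where "A' = {a \<in> A. a $ i = Max ((\<lambda>a. a $ i) ` A)}"
  define B' where "B' = {b \<in> B. b $ i = Max ((\<lambda>b. b $ i) ` B)}"
  have le: "a $ i \<le> Max ((\<lambda>a. a $ i) ` A)" if "a \<in> A" for a using that Cons.prems(1) by simp
  have le': "b $ i \<le> Max ((\<lambda>b. b $ i) ` B)" if "b \<in> B" for b using that Cons.prems(3) by simp
  have max: "\<exists>x\<in>X. x $ i = Max ((\<lambda>a. a $ i) ` X)" if "finite X" "X \<noteq> {}" for X :: "(nat ^ 'd) set"
    using Max_in[of "(\<lambda>a. a $ i) ` X"] that by (metis (no_types, lifting) finite_imageI image_iff image_is_empty)
  have "A' \<noteq> {}" "B' \<noteq> {}" "finite A'" "finite B'"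
    using Cons.prems max[of A] max[of B] by (auto simp: A'_def B'_def)
  then obtain a0 b0 where ab0: "a0 \<in> A'" "b0 \<in> B'"
    "\<And>a b. a \<in> A' \<Longrightarrow> b \<in> B' \<Longrightarrow> a + b = a0 + b0 \<Longrightarrow> \<forall>i\<in>set ds. a $ i = a0 $ i"
    using Cons.IH[of A' B'] by blast
  have main: "\<forall>i\<in>set (i # ds). a $ i = a0 $ i" if ab: "a \<in> A" "b \<in> B" "a + b = a0 + b0" for a b
  proof -
    have "a $ i + b $ i = a0 $ i + b0 $ i" using ab(3) by (metis vector_add_component)
    moreover have "a $ i \<le> a0 $ i" "b $ i \<le> b0 $ i"
      using le[OF ab(1)] le'[OF ab(2)] ab0(1,2) by (simp_all add: A'_def B'_def)
    ultimately have "a $ i = a0 $ i" "b $ i = b0 $ i" by linarith+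
    moreover have "a \<in> A'" "b \<in> B'" using calculation ab ab0(1,2) by (simp_all add: A'_def B'_def)
    ultimately show ?thesis using ab0(3)[of a b] ab(3) by simp
  qed
  have mem: "a0 \<in> A" "b0 \<in> B" using ab0(1,2) by (simp_all add: A'_def B'_def)
  show ?case
    by (rule bexI[OF _ mem(1)], rule bexI[OF _ mem(2)], intro ballI[of A] ballI[of B] impI, rule main)
next
  case Nil
  then obtain a0 b0 where "a0 \<in> A" "b0 \<in> B" by blast
  thus ?case by (intro bexI[of _ a0] bexI[of _ b0]) simp_all
qed

lemma poly_vec_no_zero_divisors:
  fixes p q :: "nat ^ 'd \<Rightarrow>\<^sub>0 'k::field"
  assumes "p \<noteq> 0" "q \<noteq> 0"
  obtains a b where "a \<in> keys p" "b \<in> keys q" "a + b \<in> keys (p * q)"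
proof -
  obtain ds where ds: "set ds = (UNIV :: 'd set)" using finite_list[OF finite] by blast
  obtain a0 b0 where ab: "a0 \<in> keys p" "b0 \<in> keys q"
    "\<And>a b. a \<in> keys p \<Longrightarrow> b \<in> keys q \<Longrightarrow> a + b = a0 + b0 \<Longrightarrow> \<forall>i\<in>set ds. a $ i = a0 $ i"
    using lex_max_pair[of "keys p" "keys q" ds] assms by auto
  have "lookup (p * q) (a0 + b0) = lookup p a0 * lookup q b0"
    by (rule lookup_mult_unique_pair) (use ab(3) ds in \<open>auto simp: vec_eq_iff\<close>)
  thus ?thesis using ab(1,2) that[of a0 b0] by (simp add: in_keys_iff)
qed

definition coord_box :: "nat \<Rightarrow> (nat ^ 'd) set" where "coord_box K = {x. \<forall>i. x $ i \<le> K}"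

lemma box_image: "coord_box K \<subseteq> (\<lambda>f. \<chi> i. f i) ` (UNIV \<rightarrow>\<^sub>E {..K})"
proof
  fix x assume "x \<in> coord_box K"
  thus "x \<in> (\<lambda>f. \<chi> i. f i) ` (UNIV \<rightarrow>\<^sub>E {..K})"
    by (intro image_eqI[of _ _ "\<lambda>i. x $ i"]) (auto simp: coord_box_def)
qed

lemma finite_box: "finite (coord_box K :: (nat ^ 'd::finite) set)"
  by (rule finite_subset[OF box_image]) (simp add: finite_PiE)

lemma card_box: "card (coord_box K :: (nat ^ 'd::finite) set) \<le> (K + 1) ^ CARD('d)"
proof -
  have "card (coord_box K :: (nat ^ 'd) set) \<le> card ((UNIV :: 'd set) \<rightarrow>\<^sub>E {..K})"
    by (rule surj_card_le[OF _ box_image]) (simp add: finite_PiE)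
  thus ?thesis by (simp add: card_PiE)
qed

lemma keys_power_box:
  fixes p :: "nat ^ 'd \<Rightarrow>\<^sub>0 'k::field"
  assumes "keys p \<subseteq> coord_box D"
  shows "keys (p ^ n) \<subseteq> coord_box (D * n)"
proof (induction n)
  case (Suc n)
  show ?case
  proof
    fix x assume "x \<in> keys (p ^ Suc n)"
    then obtain u v where "x = u + v" "u \<in> keys p" "v \<in> keys (p ^ n)"
      using keys_mult[of p "p ^ n"] by auto
    thus "x \<in> coord_box (D * Suc n)" using assms Suc by (auto simp: coord_box_def intro!: add_mono)
  qed
qed (simp add: coord_box_def)

lemma keys_zpow_box:
  fixes z :: "nat \<Rightarrow> nat ^ 'd \<Rightarrow>\<^sub>0 'k::field"
  assumes "\<And>i. i < length xs \<Longrightarrow> keys (z i) \<subseteq> coord_box D"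
  shows "keys (zpow z xs) \<subseteq> coord_box (D * sum_list xs)"
  using assms
proof (induction z xs rule: zpow.induct)
  case (2 z x xs)
  show ?case
  proof
    fix k assume "k \<in> keys (zpow z (x # xs))"
    then obtain u v where k: "k = u + v" "u \<in> keys (z 0 ^ x)"
      "v \<in> keys (zpow (\<lambda>i. z (Suc i)) xs)"
      using keys_mult[of "z 0 ^ x" "zpow (\<lambda>i. z (Suc i)) xs"] by auto
    have "u \<in> coord_box (D * x)" using keys_power_box[of "z 0" D x] 2(2)[of 0] k(2) by auto
    moreover have "v \<in> coord_box (D * sum_list xs)" using 2 k(3) by auto
    ultimately show "k \<in> coord_box (D * sum_list (x # xs))"
      by (auto simp: k(1) coord_box_def distrib_left intro!: add_mono)
  qed
qed (simp add: coord_box_def)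

text \<open>If the exponents of the \<open>z\<^sub>i\<close> are at most \<open>D\<close>, the \<open>N\<^sup>n\<close> monomials in the \<open>z\<^sub>i\<close> with exponents below
  \<open>N\<close> lie in a space of dimension at most \<open>(D n N + 1)\<^sup>d\<close>. For \<open>n > d\<close> and large \<open>N\<close> they are
  therefore linearly dependent.\<close>

lemma algebraic_relation_exists:
  fixes z :: "nat \<Rightarrow> nat ^ 'd::finite \<Rightarrow>\<^sub>0 'k::field"
  assumes n: "n > CARD('d)"
  shows "\<exists>A c. finite A \<and> A \<noteq> {} \<and> (\<forall>xs\<in>A. length xs = n \<and> c xs \<noteq> 0) \<and>
    (\<Sum>xs\<in>A. single 0 (c xs) * zpow z xs) = 0"
proof (rule ccontr)
  assume *: "\<not> ?thesis"
  have none: False if "finite A" "A \<noteq> {}" "\<forall>xs\<in>A. length xs = n \<and> c xs \<noteq> 0"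
    "(\<Sum>xs\<in>A. single 0 (c xs) * zpow z xs) = 0" for A c
    by (rule notE[OF *], intro exI[of _ A] exI[of _ c] conjI) (rule that)+
  let ?V = "(\<lambda>(x, j). x $ j) ` ((\<Union>i<n. keys (z i)) \<times> UNIV)"
  have "finite ?V" by (intro finite_imageI finite_cartesian_product finite_UN_I) simp_all
  then obtain D where D: "\<forall>y\<in>?V. y \<le> D"
    unfolding finite_nat_set_iff_bounded_le by (rule exE)
  have keys_z: "keys (z i) \<subseteq> coord_box D" if i: "i < n" for i
  proof (unfold coord_box_def, intro subsetI CollectI allI)
    fix x j assume "x \<in> keys (z i)"
    thus "x $ j \<le> D" using i by (intro bspec[OF D] image_eqI[of _ _ "(x, j)"]) auto
  qed
  \<comment> \<open>large enough for \<open>(D n N + 1)\<^sup>d \<le> (D n + 1)\<^sup>d N\<^sup>d < N\<^sup>d\<^sup>+\<^sup>1\<close>\<close>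
  define N where "N = (D * n + 1) ^ CARD('d) + 1"
  define A where "A = {xs. set xs \<subseteq> {..<N} \<and> length xs = n}"
  have fin_A: "finite A" unfolding A_def by (rule finite_lists_length_eq) simp
  have card_A: "card A = N ^ n" unfolding A_def by (subst card_lists_length_eq) simp_all
  let ?B = "(\<lambda>u. single u 1) ` coord_box (D * (n * N)) :: (nat ^ 'd \<Rightarrow>\<^sub>0 'k) set"
  have in_span: "zpow z xs \<in> coeff_space.span ?B" if "xs \<in> A" for xs
  proof (rule in_coeff_span)
    have len: "length xs = n" and "\<And>x. x \<in> set xs \<Longrightarrow> x \<le> N"
      using that by (auto simp: A_def intro: less_imp_le)
    hence "sum_list xs \<le> n * N" using sum_list_mono[of xs id "\<lambda>_. N"] by (simp add: sum_list_triv)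
    hence "coord_box (D * sum_list xs) \<subseteq> (coord_box (D * (n * N)) :: (nat ^ 'd) set)"
      unfolding coord_box_def using mult_le_mono2 order_trans by blast
    thus "keys (zpow z xs) \<subseteq> coord_box (D * (n * N))"
      using keys_zpow_box[of xs z D] keys_z len by blast
  qed
  have inj: "inj_on (zpow z) A"
  proof (rule inj_onI, rule ccontr)
    fix xs ys assume h: "xs \<in> A" "ys \<in> A" "zpow z xs = zpow z ys" "xs \<noteq> ys"
    show False
      by (rule none[of "{xs, ys}" "\<lambda>x. if x = xs then 1 else - 1"])
        (use h in \<open>auto simp: A_def single_uminus\<close>)
  qed
  have indep: "coeff_space.independent (zpow z ` A)"
  proof
    assume "coeff_space.dependent (zpow z ` A)"
    then obtain u where u: "\<exists>v\<in>zpow z ` A. u v \<noteq> 0" "(\<Sum>v\<in>zpow z ` A. single 0 (u v) * v) = 0"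
      using fin_A by (auto simp: coeff_space.dependent_finite)
    let ?A = "{xs \<in> A. u (zpow z xs) \<noteq> 0}"
    have "(\<Sum>xs\<in>?A. single 0 (u (zpow z xs)) * zpow z xs)
        = (\<Sum>xs\<in>A. single 0 (u (zpow z xs)) * zpow z xs)"
      by (rule sum.mono_neutral_left) (use fin_A in auto)
    also have "\<dots> = 0" using u(2) unfolding sum.reindex[OF inj] comp_apply .
    finally have "(\<Sum>xs\<in>?A. single 0 (u (zpow z xs)) * zpow z xs) = 0" .
    moreover have "?A \<noteq> {}" using u(1) by blast
    moreover have "\<forall>xs\<in>?A. length xs = n \<and> u (zpow z xs) \<noteq> 0" by (simp add: A_def)
    moreover have "finite ?A" using fin_A by simp
    ultimately show False by (intro none[of ?A "\<lambda>xs. u (zpow z xs)"])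
  qed
  have "card (zpow z ` A) \<le> card ?B"
    using coeff_space.independent_span_bound[OF finite_imageI[OF finite_box] indep] in_span by blast
  also have "\<dots> \<le> card (coord_box (D * (n * N)) :: (nat ^ 'd) set)" by (rule card_image_le[OF finite_box])
  also have "\<dots> \<le> (D * (n * N) + 1) ^ CARD('d)" by (rule card_box)
  also have "\<dots> \<le> ((D * n + 1) * N) ^ CARD('d)"
    by (rule power_mono) (simp_all add: N_def algebra_simps)
  also have "\<dots> < N * N ^ CARD('d)" unfolding power_mult_distrib by (simp add: N_def)
  also have "\<dots> \<le> N ^ n" using n power_increasing[of "Suc CARD('d)" n N] by (simp add: N_def)
  finally show False using card_image[OF inj] card_A by simp
qed

section \<open>The Krull dimension of a simplicial semigroup ring at the origin\<close>

text \<open>\<open>L\<close> gives the coordinates with respect to the basis \<open>e\<close> of \<open>\<rat>\<^sup>d\<close>. The rule \<open>L_sub\<close> expresses that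
  the cone lies in the nonnegative orthant: a difference of lattice points with nonnegative
  coordinates is again a vector of natural numbers.\<close>

locale simplicial_cone =
  fixes S :: "(nat ^ 'd::finite) set" and e :: "'d \<Rightarrow> nat ^ 'd" and L :: "nat ^ 'd \<Rightarrow> 'd \<Rightarrow> rat"
  assumes submonoid: "add_submonoid S"
    and L_add: "L (x + y) i = L x i + L y i"
    and L_e: "L (e j) i = (if i = j then 1 else 0)"
    and L_inj: "(\<And>i. L x i = L y i) \<Longrightarrow> x = y"
    and L_sub: "(\<And>i. L y i \<le> L x i) \<Longrightarrow> \<exists>z. x = y + z"
    and L_nonneg: "s \<in> S \<Longrightarrow> 0 \<le> L s i"
    and e_S: "e i \<in> S"
    and gaps_eq: "gaps S = {x. \<forall>i. 0 \<le> L x i} - S"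
begin

lemma L_zero [simp]: "L 0 i = 0"
  using L_add[of 0 0 i] by simp

lemma L_smult: "L (n *s x) i = of_nat n * L x i"
proof (induction n)
  case (Suc n)
  have "Suc n *s x = x + n *s x" by (simp add: vec_eq_iff)
  thus ?case using Suc by (simp add: L_add algebra_simps)
qed (simp add: vec_eq_iff[symmetric] vector_smult_lzero)

lemma L_pos: 
  assumes "s \<in> S" "s \<noteq> 0"
  shows "\<exists>i. 0 < L s i"
proof (rule ccontr)
  assume "\<not> ?thesis"
  hence "L s i = L 0 i" for i using L_nonneg[OF assms(1), of i] by (simp add: antisym not_less)
  thus False using L_inj[of s 0] assms(2) by blast
qed

lemma S_zero: "0 \<in> S" and S_add: "x \<in> S \<Longrightarrow> y \<in> S \<Longrightarrow> x + y \<in> S"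
  using submonoid by (auto simp: add_submonoid_def)

lemma cone_cases: "(\<And>i. 0 \<le> L x i) \<Longrightarrow> x \<in> S \<or> x \<in> gaps S"
  using gaps_eq by blast

lemma finite_bounded_coords: "finite {x. \<forall>i. L x i \<le> of_nat K}"
proof -
  let ?y = "\<Sum>j\<in>UNIV. K *s e j"
  have "L (\<Sum>j\<in>J. K *s e j) i = (if i \<in> J then of_nat K else 0)" if "finite J" for J i
    using that by (induction J) (auto simp: L_add L_smult L_e)
  hence Ly: "L ?y i = of_nat K" for i by simp
  have "{x. \<forall>i. L x i \<le> of_nat K} \<subseteq> coord_box (\<Sum>i\<in>UNIV. ?y $ i)"
  proof
    fix x assume "x \<in> {x. \<forall>i. L x i \<le> of_nat K}"
    then obtain z where z: "?y = x + z" using L_sub[of x ?y] Ly by auto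
    have "x $ i \<le> (\<Sum>i\<in>UNIV. ?y $ i)" for i
    proof -
      have "x $ i \<le> ?y $ i" unfolding z by simp
      also have "\<dots> \<le> (\<Sum>i\<in>UNIV. ?y $ i)" by (rule member_le_sum) simp_all
      finally show ?thesis .
    qed
    thus "x \<in> coord_box (\<Sum>i\<in>UNIV. ?y $ i)" by (simp add: coord_box_def)
  qed
  thus ?thesis using finite_box by (rule finite_subset)
qed

text \<open>The polynomials supported off the face on which the coordinates in \<open>T\<close> vanish.\<close>

definition face_ideal :: "'d set \<Rightarrow> (nat ^ 'd \<Rightarrow>\<^sub>0 'k::field) set"
  where "face_ideal T = {p. keys p \<subseteq> S \<and> (\<forall>x\<in>keys p. \<exists>i\<in>T. 0 < L x i)}"

lemma supported_S: "supported S"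
  by unfold_locales (auto simp: S_zero S_add)

text \<open>The quotient is the semigroup ring of the face. Concretely, the parts of \<open>p\<close> and \<open>q\<close> on the face
  are nonzero, hence so is their product, and all other terms of \<open>p * q\<close> are in the face ideal.\<close>

lemma face_ideal_prime:
  "primeideal (face_ideal T :: (nat ^ 'd \<Rightarrow>\<^sub>0 'k::field) set) (semigroup_ring S)"
proof -
  interpret supported S "semigroup_ring S :: (nat ^ 'd \<Rightarrow>\<^sub>0 'k) ring"
    by (rule supported_S) (simp add: semigroup_ring_eq)
  let ?I = "face_ideal T :: (nat ^ 'd \<Rightarrow>\<^sub>0 'k) set" and ?R = "semigroup_ring S :: (nat ^ 'd \<Rightarrow>\<^sub>0 'k) ring"
  have ideal: "ideal ?I ?R"
  proof (rule idealI_supported)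
    show "p + q \<in> ?I" if "p \<in> ?I" "q \<in> ?I" for p q
      using that Poly_Mapping.keys_add[of p q] unfolding face_ideal_def by blast
    show "r * p \<in> ?I" if "r \<in> carrier ?R" "p \<in> ?I" for r p
    proof -
      have "\<exists>i\<in>T. 0 < L x i" if x: "x \<in> keys (r * p)" for x
      proof -
        obtain u v where uv: "x = u + v" "u \<in> keys r" "v \<in> keys p"
          using keys_mult[of r p] x by blast
        obtain i where "i \<in> T" "0 < L v i" using uv(3) \<open>p \<in> ?I\<close> unfolding face_ideal_def by blast
        moreover have "0 \<le> L u i" using uv(2) \<open>r \<in> carrier ?R\<close> by (intro L_nonneg) (auto simp: carrier_R)
        ultimately show ?thesis using uv(1) by (intro bexI[of _ i]) (simp_all add: L_add)
      qed
      moreover have "r * p \<in> carrier ?R" using that by (intro mult_carrier) (auto simp: face_ideal_def carrier_R)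
      ultimately show ?thesis by (simp add: face_ideal_def carrier_R)
    qed
  qed (auto simp: face_ideal_def carrier_R)
  show ?thesis
  proof (rule primeidealI[OF ideal is_cring])
    have "1 \<notin> ?I" by (simp add: face_ideal_def)
    thus "carrier ?R \<noteq> ?I" using one_carrier by blast
  next
    fix p q assume pq: "p \<in> carrier ?R" "q \<in> carrier ?R" and "p \<otimes>\<^bsub>?R\<^esub> q \<in> ?I"
    hence pq_I: "p * q \<in> ?I" by simp
    let ?P = "\<lambda>x. \<forall>i\<in>T. \<not> 0 < L x i"
    let ?p = "restrict_keys ?P p" and ?p' = "restrict_keys (\<lambda>x. \<not> ?P x) p"
    let ?q = "restrict_keys ?P q" and ?q' = "restrict_keys (\<lambda>x. \<not> ?P x) q"
    have in_I: "restrict_keys (\<lambda>x. \<not> ?P x) r \<in> ?I" if "r \<in> carrier ?R" for r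
      using that by (auto simp: face_ideal_def carrier_R keys_restrict_keys)
    show "p \<in> ?I \<or> q \<in> ?I"
    proof (rule ccontr)
      assume not: "\<not> (p \<in> ?I \<or> q \<in> ?I)"
      have nz: "restrict_keys ?P r \<noteq> 0" if "r \<in> carrier ?R" "r \<notin> ?I" for r
      proof
        assume "restrict_keys ?P r = 0"
        hence "restrict_keys (\<lambda>x. \<not> ?P x) r = r"
          using restrict_keys_split[of r ?P, symmetric] by (simp only: add_0)
        with in_I[OF that(1)] have "r \<in> ?I" by (rule back_subst)
        thus False using that(2) by contradiction
      qed
      obtain a b where ab: "a \<in> keys ?p" "b \<in> keys ?q"
        "a + b \<in> keys (?p * ?q)"
        using poly_vec_no_zero_divisors[OF nz nz] pq not by blast
      have "?p * ?q = p * q - (?p * ?q' + q * ?p')"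
      proof -
        have "p * q = ?p * q + ?p' * q" 
          unfolding distrib_right[symmetric] by (rule arg_cong[where f = "\<lambda>x. x * q", OF restrict_keys_split])
        also have "?p * q = ?p * ?q + ?p * ?q'" 
          unfolding distrib_left[symmetric] by (rule arg_cong[where f = "\<lambda>x. ?p * x", OF restrict_keys_split])
        finally show ?thesis by (simp add: mult.commute)
      qed
      also have "\<dots> \<in> ?I"
        using pq by (intro ideal_diff[OF ideal pq_I] ideal_add[OF ideal] ideal_mult[OF ideal] in_I restrict_carrier)
      finally obtain i where i: "i \<in> T" "0 < L (a + b) i" using ab(3) unfolding face_ideal_def by blast
      moreover have "\<not> 0 < L a i" "\<not> 0 < L b i" using ab(1,2) i(1) by (simp_all add: keys_restrict_keys)
      ultimately show False by (simp add: L_add)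
    qed
  qed
qed

lemma face_ideal_UNIV: "face_ideal UNIV = {p. keys p \<subseteq> S \<and> lookup p 0 = 0}"
proof -
  have "(\<forall>x\<in>keys p. \<exists>i. 0 < L x i) \<longleftrightarrow> 0 \<notin> keys p"
    if "keys p \<subseteq> S" for p :: "nat ^ 'd \<Rightarrow>\<^sub>0 'k::field"
    using L_pos that by (metis L_zero less_irrefl subsetD)
  thus ?thesis by (auto simp: face_ideal_def in_keys_iff)
qed

lemma maximal_homogeneous_ideal_eq:
  "(maximal_homogeneous_ideal S :: (nat ^ 'd \<Rightarrow>\<^sub>0 'k::field) set) = face_ideal UNIV"
proof -
  interpret supported S "semigroup_ring S :: (nat ^ 'd \<Rightarrow>\<^sub>0 'k) ring"
    by (rule supported_S) (simp add: semigroup_ring_eq)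
  let ?R = "semigroup_ring S :: (nat ^ 'd \<Rightarrow>\<^sub>0 'k) ring"
  let ?X = "monomial ` (S - {0}) :: (nat ^ 'd \<Rightarrow>\<^sub>0 'k) set"
  have X: "?X \<subseteq> face_ideal UNIV" by (auto simp: face_ideal_UNIV monomial_def lookup_single)
  have X_carrier: "?X \<subseteq> carrier ?R" by (auto simp: carrier_R monomial_def)
  have "p \<in> Idl\<^bsub>?R\<^esub> ?X" if "p \<in> face_ideal UNIV" for p
  proof -
    have "p = (\<Sum>u\<in>keys p. single 0 (lookup p u) * monomial u)"
      using poly_mapping_sum_single[of p] by (simp add: monomial_def mult_single)
    also have "\<dots> \<in> Idl\<^bsub>?R\<^esub> ?X"
    proof (intro ideal_sum ideal_mult R.genideal_ideal[OF X_carrier] const_carrier)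
      fix u assume "u \<in> keys p"
      hence "u \<in> S - {0}" using that by (auto simp: face_ideal_UNIV in_keys_iff)
      thus "monomial u \<in> Idl\<^bsub>?R\<^esub> ?X" using R.genideal_self[OF X_carrier] by blast
    qed
    finally show ?thesis .
  qed
  moreover have "Idl\<^bsub>?R\<^esub> ?X \<subseteq> face_ideal UNIV"
    by (rule R.genideal_minimal[OF primeideal.axioms(1)[OF face_ideal_prime] X])
  ultimately show ?thesis unfolding maximal_homogeneous_ideal_def by blast
qed

definition units_at :: "(nat ^ 'd \<Rightarrow>\<^sub>0 'k::field) set"
  where "units_at = carrier (semigroup_ring S) - maximal_homogeneous_ideal S"

lemma units_at_iff: "p \<in> units_at \<longleftrightarrow> keys p \<subseteq> S \<and> lookup p 0 \<noteq> 0"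
  by (auto simp: units_at_def maximal_homogeneous_ideal_eq face_ideal_UNIV semigroup_ring_def)

lemma mult_closed_units:
  "mult_closed (semigroup_ring S :: (nat ^ 'd \<Rightarrow>\<^sub>0 'k::field) ring) units_at"
proof -
  interpret supported S "semigroup_ring S :: (nat ^ 'd \<Rightarrow>\<^sub>0 'k) ring"
    by (rule supported_S) (simp add: semigroup_ring_eq)
  interpret P: primeideal "face_ideal UNIV" "semigroup_ring S :: (nat ^ 'd \<Rightarrow>\<^sub>0 'k) ring"
    by (rule face_ideal_prime)
  show ?thesis
  proof unfold_locales
    show "\<one>\<^bsub>semigroup_ring S\<^esub> \<in> (units_at :: (nat ^ 'd \<Rightarrow>\<^sub>0 'k) set)" by (simp add: units_at_iff S_zero)
    show "s \<otimes>\<^bsub>semigroup_ring S\<^esub> t \<in> units_at" if "s \<in> units_at" "t \<in> units_at"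
      for s t :: "nat ^ 'd \<Rightarrow>\<^sub>0 'k"
      using that P.I_prime[of s t] mult_carrier[of s t]
      unfolding units_at_def maximal_homogeneous_ideal_eq by auto
  qed (auto simp: units_at_def)
qed

lemma localization_eq: "localization_at (semigroup_ring S) (maximal_homogeneous_ideal S)
    = ring_of_fractions (semigroup_ring S) units_at"
  by (simp add: localization_at_def units_at_def)

text \<open>The face ideals of a flag of faces give a chain of length \<open>d\<close>. Conversely, a chain of length \<open>n\<close>
  contracts to a chain in the semigroup ring, which yields \<open>n\<close> algebraically independent
  polynomials in \<open>d\<close> variables.\<close>

lemma krull_dim_localization:
  "krull_dim (ring_of_fractions (semigroup_ring S :: (nat ^ 'd \<Rightarrow>\<^sub>0 'k::field) ring) units_at) = enat CARD('d)"
proof -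
  let ?R = "semigroup_ring S :: (nat ^ 'd \<Rightarrow>\<^sub>0 'k) ring"
  interpret supported S ?R by (rule supported_S) (simp add: semigroup_ring_eq)
  interpret mult_closed ?R units_at by (rule mult_closed_units)
  let ?chain = "\<lambda>n P. (\<forall>i\<le>n. primeideal (P i) Q) \<and> (\<forall>i<n. P i \<subset> P (Suc i))"
  have upper: "n \<le> CARD('d)" if "?chain n P" for n P
  proof (rule ccontr)
    assume n: "\<not> n \<le> CARD('d)"
    let ?P = "\<lambda>i. contraction (P i)"
    have prime: "primeideal (?P i) ?R" if "i \<le> n" for i
      using \<open>?chain n P\<close> that by (intro contraction_prime) blast
    have less: "?P i \<subset> ?P (Suc i)" if "i < n" for i
      using \<open>?chain n P\<close> that by (intro contraction_mono primeideal.axioms(1)) auto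
    hence "\<forall>i. \<exists>x. i < n \<longrightarrow> x \<in> ?P (Suc i) - ?P i" by blast
    then obtain z where z: "\<And>i. i < n \<Longrightarrow> z i \<in> ?P (Suc i) - ?P i" by metis
    obtain A c where A: "finite A" "A \<noteq> {}" "\<forall>xs\<in>A. length xs = n \<and> c xs \<noteq> 0"
      "(\<Sum>xs\<in>A. single 0 (c xs) * zpow z xs) = 0"
      using algebraic_relation_exists[of n z] n by auto
    have "(\<Sum>xs\<in>A. single 0 (c xs) * zpow z xs) \<notin> ?P 0"
      by (rule chain_algebraically_independent[of n ?P z A c]) (use prime less z A in auto)
    thus False using A(4) ideal_zero[OF primeideal.axioms(1)[OF prime[of 0]]] by simp
  qed
  obtain ds where ds: "set ds = (UNIV :: 'd set)" "distinct ds"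
    using finite_distinct_list[OF finite] by blast
  have len: "length ds = CARD('d)" using distinct_card[OF ds(2)] ds(1) by simp
  let ?F = "\<lambda>k. face_ideal (set (take k ds)) :: (nat ^ 'd \<Rightarrow>\<^sub>0 'k) set"
  have disj: "?F k \<inter> units_at = {}" for k
    unfolding units_at_def maximal_homogeneous_ideal_eq by (auto simp: face_ideal_def)
  have F_less: "?F k \<subset> ?F (Suc k)" if k: "k < length ds" for k
  proof
    show "?F k \<subseteq> ?F (Suc k)" using set_take_subset_set_take[of k "Suc k" ds] unfolding face_ideal_def by auto (meson subsetD)
    have "ds ! k \<in> set (take (Suc k) ds)" using k by (simp add: take_Suc_conv_app_nth)
    moreover have "ds ! k \<notin> set (take k ds)"
      using ds(2) k by (auto simp: in_set_conv_nth nth_eq_iff_index_eq)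
    ultimately have "monomial (e (ds ! k)) \<in> ?F (Suc k) - ?F k"
      by (auto simp: face_ideal_def monomial_def e_S L_e)
    thus "?F k \<noteq> ?F (Suc k)" by blast
  qed
  have "primeideal (extension (?F k)) Q" for k by (rule extension_prime[OF face_ideal_prime disj])
  moreover have "extension (?F k) \<subset> extension (?F (Suc k))" if "k < CARD('d)" for k
    using that by (intro extension_mono face_ideal_prime disj F_less) (simp add: len)
  ultimately have chain: "?chain CARD('d) (\<lambda>k. extension (?F k))" by blast
  show ?thesis
    unfolding krull_dim_def
  proof (rule antisym)
    show "Sup {enat n | n. \<exists>P. ?chain n P} \<le> enat CARD('d)"
    proof (rule Sup_least)
      fix x assume "x \<in> {enat n | n. \<exists>P. ?chain n P}"
      then obtain n P where x: "x = enat n" and "?chain n P" by (elim CollectE exE conjE) (rule that, assumption, intro conjI, assumption+)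
      show "x \<le> enat CARD('d)" unfolding x enat_ord_simps by (rule upper[OF \<open>?chain n P\<close>])
    qed
    show "enat CARD('d) \<le> Sup {enat n | n. \<exists>P. ?chain n P}"
      by (rule Sup_upper, intro CollectI exI conjI, rule refl, rule chain[THEN conjunct1], rule chain[THEN conjunct2])
  qed
qed

end

section \<open>Gaps of a Buchsbaum semigroup\<close>

context simplicial_cone
begin

text \<open>Such an \<open>s\<close> has coordinates at most \<open>N\<close>, or subtracting some \<open>N e\<^sub>i\<close> leads to one of the finitely
  many gaps.\<close>

lemma finite_far_from_rays:
  assumes fin: "finite (gaps S)"
  shows "finite {s \<in> S. \<forall>i. \<forall>y\<in>S. s \<noteq> N *s e i + y}"
proof (rule finite_subset)
  show "finite ({x. \<forall>i. L x i \<le> of_nat N} \<union> (\<Union>i. (\<lambda>z. N *s e i + z) ` gaps S))"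
    using fin finite_bounded_coords by (intro finite_UnI finite_UN_I finite_imageI) simp_all
  show "{s \<in> S. \<forall>i. \<forall>y\<in>S. s \<noteq> N *s e i + y}
      \<subseteq> {x. \<forall>i. L x i \<le> of_nat N} \<union> (\<Union>i. (\<lambda>z. N *s e i + z) ` gaps S)"
  proof
    fix s assume s: "s \<in> {s \<in> S. \<forall>i. \<forall>y\<in>S. s \<noteq> N *s e i + y}"
    show "s \<in> {x. \<forall>i. L x i \<le> of_nat N} \<union> (\<Union>i. (\<lambda>z. N *s e i + z) ` gaps S)"
    proof (cases "\<forall>i. L s i \<le> of_nat N")
      case False
      then obtain i where i: "of_nat N < L s i" by (auto simp: not_le)
      have "L (N *s e i) j \<le> L s j" for j using i L_nonneg[of s j] s by (simp add: L_smult L_e)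
      then obtain z where z: "s = N *s e i + z" using L_sub by blast
      have "0 \<le> L z j" for j
        using i L_nonneg[of s j] s unfolding z by (cases "j = i") (simp_all add: L_add L_smult L_e)
      hence "z \<in> gaps S" using cone_cases[of z] s z by blast
      thus ?thesis using z by blast
    qed simp
  qed
qed

lemma power_support:
  fixes p :: "nat ^ 'd \<Rightarrow>\<^sub>0 'k::field"
  assumes p: "keys p \<subseteq> S" "lookup p 0 = 0" and k: "k \<in> keys (p ^ n)"
  shows "k \<in> S" "n \<le> vsum k"
proof -
  have "k \<in> S \<and> n \<le> vsum k" using k
  proof (induction n arbitrary: k)
    case (Suc n)
    obtain u v where uv: "k = u + v" "u \<in> keys p" "v \<in> keys (p ^ n)"
      using Suc.prems keys_mult[of p "p ^ n"] by auto
    have "u \<noteq> 0" using uv(2) p(2) by (auto simp: in_keys_iff)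
    hence "vsum u \<noteq> 0" by (simp add: vsum_eq_0_iff)
    thus ?case using Suc.IH[OF uv(3)] uv p(1) S_add[of u v] by (auto simp: vsum_add)
  qed (simp add: S_zero)
  thus "k \<in> S" "n \<le> vsum k" by simp_all
qed

text \<open>A large power of a polynomial without constant term has a support of large total degree, and by
  \<open>finite_far_from_rays\<close> every element of \<open>S\<close> of large total degree lies in some \<open>N e\<^sub>i + S\<close>.\<close>

lemma ray_powers_system_of_parameters:
  assumes fin: "finite (gaps S)" and N: "N \<ge> 1" and ds: "set ds = UNIV" "distinct ds"
  shows "system_of_parameters
    (ring_of_fractions (semigroup_ring S :: (nat ^ 'd \<Rightarrow>\<^sub>0 'k::field) ring) units_at)
    (mult_closed.extension (semigroup_ring S) units_at (face_ideal UNIV))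
    (map (\<lambda>i. fraction (semigroup_ring S) units_at (monomial (N *s e i)) 1) ds)"
proof -
  let ?R = "semigroup_ring S :: (nat ^ 'd \<Rightarrow>\<^sub>0 'k) ring"
  interpret supported S ?R by (rule supported_S) (simp add: semigroup_ring_eq)
  interpret mult_closed ?R units_at by (rule mult_closed_units)
  let ?P = "face_ideal UNIV :: (nat ^ 'd \<Rightarrow>\<^sub>0 'k) set"
  let ?x = "\<lambda>i. fraction ?R units_at (monomial (N *s e i)) 1"
  let ?E = "extension ?P"
  have P: "primeideal ?P ?R" by (rule face_ideal_prime)
  have disj: "?P \<inter> units_at = {}" by (auto simp: units_at_def maximal_homogeneous_ideal_eq)
  note in_E = fraction_in_extension[OF P disj]
  interpret E: primeideal ?E Q by (rule extension_prime[OF P disj])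
  have Ne_S: "N *s e i \<in> S" for i by (rule add_submonoid_smult[OF submonoid e_S])
  have Ne_0: "N *s e i \<noteq> 0" for i using N L_smult[of N "e i" i] L_e[of i i] by (metis L_zero mult_1_right not_one_le_zero of_nat_eq_0_iff)
  have mono_P: "monomial (N *s e i) \<in> ?P" for i
    using Ne_S Ne_0 by (auto simp: face_ideal_UNIV monomial_def lookup_single)
  have mono_carrier: "monomial (N *s e i) \<in> carrier ?R" for i
    using Ne_S by (simp add: monomial_def single_carrier)
  have one_unit: "1 \<in> (units_at :: (nat ^ 'd \<Rightarrow>\<^sub>0 'k) set)" using one_U by simp
  have xs_carrier: "?x ` UNIV \<subseteq> carrier Q" using mono_carrier one_unit by (auto intro!: frac_carr)
  have xs_E: "?x ` UNIV \<subseteq> ?E" using mono_P one_unit by (auto simp: extension_def)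
  let ?I = "Idl\<^bsub>Q\<^esub> (?x ` UNIV)"
  have I: "ideal ?I Q" by (rule fractions.genideal_ideal[OF xs_carrier])
  have I_sub: "?I \<subseteq> ?E" by (rule fractions.genideal_minimal[OF E.ideal_axioms xs_E])
  have cI: "ideal (contraction ?I) ?R" by (rule contraction_ideal[OF I])
  have mono_cI: "monomial (N *s e i) \<in> contraction ?I" for i
    using fractions.genideal_self[OF xs_carrier] mono_carrier[of i] by (auto simp: contraction_def)
  have "radical Q ?I = ?E"
  proof
    show "radical Q ?I \<subseteq> ?E"
    proof
      fix r assume "r \<in> radical Q ?I"
      then obtain n :: nat where r: "r \<in> carrier Q" "r [^]\<^bsub>Q\<^esub> n \<in> ?I" by (auto simp: radical_def)
      obtain a s where a: "a \<in> carrier ?R" "s \<in> units_at" "r = fraction ?R units_at a s"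
        using r(1) by (rule frac_cases)
      have "fraction ?R units_at (a ^ n) (s [^]\<^bsub>?R\<^esub> n) \<in> ?E" using r(2) I_sub a by (simp add: fraction_pow subset_iff)
      hence "a ^ n \<in> ?P" using in_E[of "a ^ n" "s [^]\<^bsub>?R\<^esub> n"] a pow_U[OF a(2)] power_carrier[OF a(1)] by blast
      hence "a \<in> ?P" using prime_power[OF P a(1)] by blast
      thus "r \<in> ?E" using a in_E by simp
    qed
    show "?E \<subseteq> radical Q ?I"
    proof
      fix r assume "r \<in> ?E"
      then obtain a s where a: "a \<in> ?P" "s \<in> units_at" "r = fraction ?R units_at a s"
        by (auto simp: extension_def)
      have a_carrier: "a \<in> carrier ?R" using a(1) by (simp add: carrier_R face_ideal_def)
      let ?F = "{s \<in> S. \<forall>i. \<forall>y\<in>S. s \<noteq> N *s e i + y}"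
      have "finite (vsum ` ?F)" by (rule finite_imageI[OF finite_far_from_rays[OF fin]])
      then obtain n where n: "\<forall>k\<in>vsum ` ?F. k < n" unfolding finite_nat_set_iff_bounded by (rule exE)
      have "a ^ n = (\<Sum>k\<in>keys (a ^ n). single k (lookup (a ^ n) k))"
        by (rule poly_mapping_sum_single)
      also have "\<dots> \<in> contraction ?I"
      proof (rule ideal_sum[OF cI])
        fix k assume k: "k \<in> keys (a ^ n)"
        have "k \<in> S" "n \<le> vsum k" using power_support[OF _ _ k] a(1) by (simp_all add: face_ideal_UNIV)
        have "\<not> vsum k < n" using \<open>n \<le> vsum k\<close> by simp
        hence "k \<notin> ?F" using n by blast
        then obtain i y where y: "y \<in> S" "k = N *s e i + y" using \<open>k \<in> S\<close> by blast
        have "single y (lookup (a ^ n) k) * monomial (N *s e i) \<in> contraction ?I"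
          by (rule ideal_mult[OF cI single_carrier[OF y(1)] mono_cI])
        thus "single k (lookup (a ^ n) k) \<in> contraction ?I"
          unfolding y(2) by (simp add: monomial_def mult_single add.commute)
      qed
      finally have "fraction ?R units_at (a ^ n) (s [^]\<^bsub>?R\<^esub> n) \<in> ?I"
        using fraction_in_ideal[OF I power_carrier[OF a_carrier] pow_U[OF a(2)]] by blast
      hence "r [^]\<^bsub>Q\<^esub> n \<in> ?I" using a_carrier a(2,3) by (simp add: fraction_pow)
      moreover have "r \<in> carrier Q" using a_carrier a(2,3) by (simp add: frac_carr)
      ultimately show "r \<in> radical Q ?I" unfolding radical_def by blast
    qed
  qed
  moreover have "length ds = CARD('d)" using distinct_card[OF ds(2)] ds(1) by simp
  ultimately show ?thesis
    using xs_E ds(1) krull_dim_localization[where 'k = 'k]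
    by (simp add: system_of_parameters_def)
qed

text \<open>With the parameters \<open>x\<^sub>i\<close> given by the monomials of \<open>N e\<^sub>i\<close>, the monomial \<open>f\<close> of \<open>h + N e\<^sub>0\<close>
  satisfies \<open>f x\<^sub>1 = g x\<^sub>0\<close>, where \<open>g\<close> is the monomial of \<open>h + N e\<^sub>1\<close>. So \<open>f\<close> lies in the colon
  ideal, and the monomial of \<open>s\<close> times \<open>f\<close> is divisible by \<open>x\<^sub>0\<close> in the local ring. Denominators
  have a nonzero constant term, hence \<open>h + s\<close> occurs in the support of an element of \<open>K[S]\<close>.\<close>

theorem buchsbaum_gap_shift:
  assumes fin: "finite (gaps S)" and d: "CARD('d) \<ge> 2" and buchsbaum: "buchsbaum_semigroup TYPE('k::field) S"
    and h: "h \<in> gaps S" and s: "s \<in> S" "s \<noteq> 0"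
  shows "h + s \<in> S"
proof -
  let ?R = "semigroup_ring S :: (nat ^ 'd \<Rightarrow>\<^sub>0 'k) ring"
  interpret supported S ?R by (rule supported_S) (simp add: semigroup_ring_eq)
  interpret mult_closed ?R units_at by (rule mult_closed_units)
  let ?P = "face_ideal UNIV :: (nat ^ 'd \<Rightarrow>\<^sub>0 'k) set"
  let ?E = "extension ?P"
  let ?f = "\<lambda>u. fraction ?R units_at (monomial u) 1"
  have P: "primeideal ?P ?R" by (rule face_ideal_prime)
  have one_unit: "1 \<in> (units_at :: (nat ^ 'd \<Rightarrow>\<^sub>0 'k) set)" using one_U by simp
  have mono_carrier: "monomial u \<in> carrier ?R" if "u \<in> S" for u
    using that by (simp add: monomial_def single_carrier)
  have f_mult: "?f u \<otimes>\<^bsub>Q\<^esub> ?f v = ?f (u + v)" if "u \<in> S" "v \<in> S" for u v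
    using frac_mult[OF mono_carrier[OF that(1)] one_unit mono_carrier[OF that(2)] one_unit]
    by (simp add: monomial_def mult_single)
  have f_carrier: "?f u \<in> carrier Q" if "u \<in> S" for u by (rule frac_carr[OF mono_carrier[OF that] one_unit])
  obtain \<mm> where noeth: "noetherian_local_ring Q \<mm>"
    and sop: "\<forall>xs. system_of_parameters Q \<mm> xs \<longrightarrow> (\<forall>i<length xs.
        \<mm> \<cdot>\<^bsub>Q\<^esub> colon Q (Idl\<^bsub>Q\<^esub> (set (take i xs))) (xs ! i) \<subseteq> Idl\<^bsub>Q\<^esub> (set (take i xs)))"
    using buchsbaum unfolding buchsbaum_semigroup_def buchsbaum_ring_def localization_eq
    by (elim exE conjE) (rule that)
  have \<mm>: "J = \<mm>" if "maximalideal J Q" for J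
    using noeth that unfolding noetherian_local_ring_def by blast
  have \<mm>_eq: "\<mm> = ?E"
    by (rule \<mm>[symmetric], rule extension_maximal[OF P]) (simp add: units_at_def maximal_homogeneous_ideal_eq)
  obtain ds where ds: "set ds = (UNIV :: 'd set)" "distinct ds"
    using finite_distinct_list[OF finite] by blast
  have len: "length ds = CARD('d)" using distinct_card[OF ds(2)] ds(1) by simp
  obtain i0 i1 ds' where ds_eq: "ds = i0 # i1 # ds'"
  proof -
    have "2 \<le> length ds" using d len by simp
    then obtain i0 xs where "ds = i0 # xs" "1 \<le> length xs" by (cases ds) auto
    moreover obtain i1 ds' where "xs = i1 # ds'" using \<open>1 \<le> length xs\<close> by (cases xs) auto
    ultimately show ?thesis using that by simp
  qed
  \<comment> \<open>choose \<open>N > 0\<close> such that neither \<open>h + N e\<^sub>0\<close> nor \<open>h + N e\<^sub>1\<close> is a gap\<close>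
  have "finite {n. h + n *s e i \<in> gaps S}" for i
  proof (rule finite_imageD[of "\<lambda>n. h + n *s e i"])
    show "finite ((\<lambda>n. h + n *s e i) ` {n. h + n *s e i \<in> gaps S})"
      by (rule finite_subset[OF _ fin]) blast
    show "inj_on (\<lambda>n. h + n *s e i) {n. h + n *s e i \<in> gaps S}"
    proof (rule inj_onI)
      fix n n' assume "h + n *s e i = h + n' *s e i"
      hence "L (n *s e i) i = L (n' *s e i) i" by simp
      thus "n = n'" by (simp add: L_smult L_e)
    qed
  qed
  hence "finite ({n. h + n *s e i0 \<in> gaps S} \<union> {n. h + n *s e i1 \<in> gaps S} \<union> {0})" by simp
  then obtain N where N: "N \<notin> {n. h + n *s e i0 \<in> gaps S} \<union> {n. h + n *s e i1 \<in> gaps S} \<union> {0}"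
    using ex_new_if_finite[OF infinite_UNIV_nat] by metis
  have shift_S: "h + N *s e i \<in> S" if "i = i0 \<or> i = i1" for i
  proof -
    have "0 \<le> L (h + N *s e i) j" for j
      using h gaps_eq L_nonneg[OF e_S, of i j] by (auto simp: L_add L_smult)
    thus ?thesis using cone_cases[of "h + N *s e i"] N that by blast
  qed
  have Ne_S: "N *s e i \<in> S" for i by (rule add_submonoid_smult[OF submonoid e_S])
  let ?xs = "map (\<lambda>i. ?f (N *s e i)) ds"
  have "system_of_parameters Q \<mm> ?xs"
    unfolding \<mm>_eq by (rule ray_powers_system_of_parameters[OF fin _ ds]) (use N in simp)
  hence "\<mm> \<cdot>\<^bsub>Q\<^esub> colon Q (Idl\<^bsub>Q\<^esub> (set (take 1 ?xs))) (?xs ! 1) \<subseteq> Idl\<^bsub>Q\<^esub> (set (take 1 ?xs))"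
    using sop[rule_format, of ?xs 1] len d by simp
  hence incl: "\<mm> \<cdot>\<^bsub>Q\<^esub> colon Q (Idl\<^bsub>Q\<^esub> {?f (N *s e i0)}) (?f (N *s e i1)) \<subseteq> Idl\<^bsub>Q\<^esub> {?f (N *s e i0)}"
    by (simp add: ds_eq)
  have PIdl: "Idl\<^bsub>Q\<^esub> {?f (N *s e i0)} = {x \<otimes>\<^bsub>Q\<^esub> ?f (N *s e i0) | x. x \<in> carrier Q}"
    using fractions.cgenideal_eq_genideal[OF f_carrier[OF Ne_S]] by (simp add: cgenideal_def)
  have "?f (h + N *s e i0) \<otimes>\<^bsub>Q\<^esub> ?f (N *s e i1) = ?f (h + N *s e i1) \<otimes>\<^bsub>Q\<^esub> ?f (N *s e i0)"
    using shift_S Ne_S by (simp add: f_mult ac_simps)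
  hence "?f (h + N *s e i0) \<in> colon Q (Idl\<^bsub>Q\<^esub> {?f (N *s e i0)}) (?f (N *s e i1))"
    unfolding colon_def PIdl using f_carrier shift_S by blast
  moreover have "?f s \<in> \<mm>"
    unfolding \<mm>_eq extension_def using s one_unit
    by (intro CollectI exI[of _ "monomial s"] exI[of _ 1]) (auto simp: face_ideal_UNIV monomial_def lookup_single)
  ultimately have "?f s \<otimes>\<^bsub>Q\<^esub> ?f (h + N *s e i0) \<in> Idl\<^bsub>Q\<^esub> {?f (N *s e i0)}"
    using incl by (intro subsetD[OF incl] ideal_prod.prod)
  then obtain x where x: "x \<in> carrier Q" "?f s \<otimes>\<^bsub>Q\<^esub> ?f (h + N *s e i0) = x \<otimes>\<^bsub>Q\<^esub> ?f (N *s e i0)"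
    unfolding PIdl by blast
  obtain b u where b: "b \<in> carrier ?R" "u \<in> units_at" "x = fraction ?R units_at b u"
    using x(1) by (rule frac_cases)
  have "?f (s + (h + N *s e i0)) = fraction ?R units_at (b * monomial (N *s e i0)) u"
    using x(2) frac_mult[OF b(1,2) mono_carrier[OF Ne_S] one_unit] b(3) f_mult[OF s(1) shift_S[of i0]] by simp
  moreover have "(b * monomial (N *s e i0), u) \<in> fraction ?R units_at (b * monomial (N *s e i0)) u"
    using b Ne_S by (intro frac_self mult_carrier mono_carrier)
  ultimately have "(b * monomial (N *s e i0), u) \<in> ?f (s + (h + N *s e i0))" by simp
  then obtain v where v: "v \<in> units_at" "v * (u * monomial (s + (h + N *s e i0))) = v * (b * monomial (N *s e i0))"
    by (auto simp: frac_iff)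
  have vu: "v * u \<in> units_at" using mult_U[OF v(1) b(2)] by simp
  have "lookup (v * u * single (s + (h + N *s e i0)) 1) (0 + (s + (h + N *s e i0)))
      = lookup (v * u) 0 * 1" by (rule lookup_times_single)
  moreover have "lookup (v * b * single (N *s e i0) 1) ((h + s) + N *s e i0)
      = lookup (v * b) (h + s) * 1" by (rule lookup_times_single)
  moreover have "v * u * single (s + (h + N *s e i0)) 1 = v * b * single (N *s e i0) 1"
    using v(2) by (simp add: monomial_def mult.assoc)
  moreover have "(h + s) + N *s e i0 = 0 + (s + (h + N *s e i0))" by (simp add: ac_simps)
  ultimately have "lookup (v * b) (h + s) \<noteq> 0"
    using vu by (simp add: units_at_iff)
  moreover have "v * b \<in> carrier ?R" using v(1) b(1) by (intro mult_carrier) auto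
  ultimately show ?thesis by (auto simp: carrier_R in_keys_iff)
qed

end

section \<open>Simplicial cones and their rays\<close>

lemma vec_of_nat_add: "(vec_of_nat (x + y) :: rat ^ 'd) = vec_of_nat x + vec_of_nat y"
  by (simp add: vec_of_nat_def vec_eq_iff)

lemma vec_of_nat_0 [simp]: "(vec_of_nat 0 :: rat ^ 'd) = 0"
  by (simp add: vec_of_nat_def vec_eq_iff)

lemma vec_of_nat_eq_iff: "(vec_of_nat x :: rat ^ 'd) = vec_of_nat y \<longleftrightarrow> x = y"
  by (simp add: vec_of_nat_def vec_eq_iff)

lemma vec_of_nat_int_eq_iff: "(vec_of_nat x :: int ^ 'd) = vec_of_nat y \<longleftrightarrow> x = y"
  by (simp add: vec_of_nat_def vec_eq_iff)

lemma vec_of_nat_in_qcone: "s \<in> A \<Longrightarrow> vec_of_nat s \<in> qcone A"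
  unfolding qcone_def by (intro CollectI exI[of _ "{s}"] exI[of _ "\<lambda>_. 1"]) simp

lemma qcone_mono: "A \<subseteq> B \<Longrightarrow> qcone A \<subseteq> qcone B"
  unfolding qcone_def by blast

lemma qcone_subset_span: "qcone A \<subseteq> vec.span (vec_of_nat ` A)"
  unfolding qcone_def
  by (clarify, rule vec.span_sum, rule vec.span_scale, rule vec.span_base) blast

text \<open>\<open>c\<close> gives the coordinates in \<open>\<rat>\<^sup>d\<close> with respect to the basis formed by a set of extremal rays,
  which need not be the minimal ones.\<close>

locale ray_basis =
  fixes S :: "(nat ^ 'd::finite) set" and b :: "'d \<Rightarrow> nat ^ 'd" and c :: "rat ^ 'd \<Rightarrow> 'd \<Rightarrow> rat"
  assumes submonoid: "add_submonoid S"
    and b_S: "b i \<in> S" and cone_b: "qcone (range b) = qcone S"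
    and c_add: "c (v + w) i = c v i + c w i" and c_scale: "c (q *s v) i = q * c v i"
    and c_b: "c (vec_of_nat (b j)) i = (if i = j then 1 else 0)"
    and c_sum: "(\<Sum>i\<in>UNIV. c v i *s vec_of_nat (b i)) = v"
begin

lemma c_zero [simp]: "c 0 i = 0"
  using c_add[of 0 0 i] by simp

lemma c_sum_distrib: "c (\<Sum>x\<in>F. f x) i = (\<Sum>x\<in>F. c (f x) i)"
  by (induction F rule: infinite_finite_induct) (simp_all add: c_add)

lemma c_inj: "(\<And>i. c v i = c w i) \<Longrightarrow> v = w"
  by (metis (no_types, lifting) c_sum sum.cong)

lemma b_inj: "inj b"
  by (rule injI) (metis c_b zero_neq_one)

lemma combination_in_qcone:
  fixes q :: "'d \<Rightarrow> rat"
  assumes "\<And>i. 0 \<le> q i" "inj s" "range s \<subseteq> A"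
  shows "(\<Sum>i\<in>UNIV. q i *s vec_of_nat (s i)) \<in> qcone A"
  unfolding qcone_def
proof (intro CollectI exI conjI)
  show "(\<Sum>i\<in>UNIV. q i *s vec_of_nat (s i)) = (\<Sum>x\<in>range s. q (inv_into UNIV s x) *s vec_of_nat x)"
    using assms(2) by (simp add: sum.reindex)
qed (use assms in auto)

lemma qcone_S: "v \<in> qcone S \<longleftrightarrow> (\<forall>i. 0 \<le> c v i)"
proof
  assume "v \<in> qcone S"
  hence "v \<in> qcone (range b)" by (simp add: cone_b)
  then obtain F q where F: "v = (\<Sum>s\<in>F. q s *s vec_of_nat s)" "F \<subseteq> range b" "\<forall>s\<in>F. 0 \<le> q s"
    unfolding qcone_def by blast
  have "0 \<le> c (q s *s vec_of_nat s) i" if "s \<in> F" for s i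
    using F(2,3) that by (auto simp: c_scale c_b)
  thus "\<forall>i. 0 \<le> c v i" unfolding F(1) c_sum_distrib by (auto intro: sum_nonneg)
next
  assume "\<forall>i. 0 \<le> c v i"
  hence "(\<Sum>i\<in>UNIV. c v i *s vec_of_nat (b i)) \<in> qcone S"
    using b_S by (intro combination_in_qcone b_inj) auto
  thus "v \<in> qcone S" by (simp only: c_sum)
qed

lemma c_nonneg: "s \<in> S \<Longrightarrow> 0 \<le> c (vec_of_nat s) i"
  using qcone_S vec_of_nat_in_qcone by blast

definition on_ray :: "'d \<Rightarrow> nat ^ 'd \<Rightarrow> bool"
  where "on_ray i x \<longleftrightarrow> 0 < c (vec_of_nat x) i \<and> (\<forall>j. j \<noteq> i \<longrightarrow> c (vec_of_nat x) j = 0)"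

lemma b_on_ray: "on_ray i (b i)"
  by (simp add: on_ray_def c_b)

text \<open>A vector \<open>b\<^sub>i\<close> is a nonnegative combination of \<open>B\<close> only if some member of \<open>B\<close> is a positive
  multiple of \<open>b\<^sub>i\<close>. One such member for each \<open>i\<close> already generates the cone, so by minimality they
  are all of \<open>B\<close>.\<close>

lemma extremal_on_ray:
  assumes B: "extremal_rays S B" and x: "x \<in> B"
  shows "\<exists>i. on_ray i x"
proof -
  have BS: "B \<subseteq> S" and cone: "qcone B = qcone S" and minimal: "\<And>B'. B' \<subset> B \<Longrightarrow> qcone B' \<noteq> qcone S"
    using B by (auto simp: extremal_rays_def)
  have "\<exists>s\<in>B. on_ray i s" for i
  proof -
    have "vec_of_nat (b i) \<in> qcone B" using vec_of_nat_in_qcone[OF b_S] cone by simp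
    then obtain F q where F: "finite F" "F \<subseteq> B" "\<forall>s\<in>F. 0 \<le> q s"
      "(vec_of_nat (b i) :: rat ^ 'd) = (\<Sum>s\<in>F. q s *s vec_of_nat s)"
      unfolding qcone_def by (elim CollectE exE conjE) (rule that)
    have coord: "(\<Sum>s\<in>F. q s * c (vec_of_nat s) j) = (if j = i then 1 else 0)" for j
      using arg_cong[OF F(4), of "\<lambda>v. c v j"] unfolding c_sum_distrib c_scale c_b by simp
    have nonneg: "0 \<le> q s * c (vec_of_nat s) j" if "s \<in> F" for s j
      using F(2,3) BS that c_nonneg by (intro mult_nonneg_nonneg) auto
    have "\<exists>s\<in>F. q s * c (vec_of_nat s) i \<noteq> 0"
    proof (rule ccontr)
      assume "\<not> ?thesis"
      hence "(\<Sum>s\<in>F. q s * c (vec_of_nat s) i) = 0" by (intro sum.neutral) blast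
      thus False using coord[of i] by simp
    qed
    then obtain s where s: "s \<in> F" "q s * c (vec_of_nat s) i \<noteq> 0" by blast
    have "0 < c (vec_of_nat s) i" using s c_nonneg[of s i] F(2) BS by (auto simp: less_le)
    moreover have "c (vec_of_nat s) j = 0" if "j \<noteq> i" for j
    proof -
      have "(\<Sum>s\<in>F. q s * c (vec_of_nat s) j) = 0" using coord[of j] that by simp
      hence "q s * c (vec_of_nat s) j = 0"
        using sum_nonneg_eq_0_iff[OF F(1), of "\<lambda>s. q s * c (vec_of_nat s) j"] nonneg s(1) by blast
      thus ?thesis using s(2) by auto
    qed
    ultimately show ?thesis using s(1) F(2) by (auto simp: on_ray_def)
  qed
  then obtain r where r: "\<And>i. r i \<in> B" "\<And>i. on_ray i (r i)" by metis
  have inj_r: "inj r"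
  proof (rule injI, rule ccontr)
    fix i j assume "r i = r j" "i \<noteq> j"
    thus False using r(2)[of i] r(2)[of j] unfolding on_ray_def by (metis less_irrefl)
  qed
  have "qcone S \<subseteq> qcone (range r)"
  proof
    fix v assume v: "v \<in> qcone S"
    have "v = (\<Sum>i\<in>UNIV. (c v i / c (vec_of_nat (r i)) i) *s vec_of_nat (r i))"
    proof (rule c_inj)
      fix j
      have "c (\<Sum>i\<in>UNIV. (c v i / c (vec_of_nat (r i)) i) *s vec_of_nat (r i)) j
          = (\<Sum>i\<in>UNIV. c v i / c (vec_of_nat (r i)) i * c (vec_of_nat (r i)) j)"
        by (simp add: c_sum_distrib c_scale)
      also have "\<dots> = (\<Sum>i\<in>UNIV. if i = j then c v j else 0)"
      proof (rule sum.cong)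
        fix i
        show "c v i / c (vec_of_nat (r i)) i * c (vec_of_nat (r i)) j = (if i = j then c v j else 0)"
          using r(2)[of i] unfolding on_ray_def by auto
      qed simp
      also have "\<dots> = c v j" by simp
      finally show "c v j = c (\<Sum>i\<in>UNIV. (c v i / c (vec_of_nat (r i)) i) *s vec_of_nat (r i)) j" by simp
    qed
    also have "\<dots> \<in> qcone (range r)"
      using v r(2) by (intro combination_in_qcone inj_r divide_nonneg_pos) (auto simp: qcone_S on_ray_def)
    finally show "v \<in> qcone (range r)" .
  qed
  moreover have "qcone (range r) \<subseteq> qcone S" using r(1) BS by (intro qcone_mono) blast
  ultimately have "\<not> range r \<subset> B" using minimal[of "range r"] by blast
  hence "range r = B" using r(1) by blast
  thus ?thesis using x r(2) by blast
qed

lemma in_qcone_ray: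
  assumes x: "on_ray i x" and t: "t \<in> S" "t \<noteq> 0"
  shows "vec_of_nat t \<in> qcone {x} \<longleftrightarrow> on_ray i t"
proof
  assume "vec_of_nat t \<in> qcone {x}"
  then obtain F q where F: "(vec_of_nat t :: rat ^ 'd) = (\<Sum>s\<in>F. q s *s vec_of_nat s)" "F \<subseteq> {x}"
    unfolding qcone_def by blast
  have "F = {} \<or> F = {x}" using F(2) by blast
  hence off: "c (vec_of_nat t) j = 0" if "j \<noteq> i" for j
    using x that F(1) by (auto simp: c_scale on_ray_def)
  have "c (vec_of_nat t) i \<noteq> 0"
  proof
    assume ti: "c (vec_of_nat t) i = 0"
    have "vec_of_nat t = (vec_of_nat 0 :: rat ^ 'd)"
    proof (rule c_inj)
      fix j show "c (vec_of_nat t) j = c (vec_of_nat 0) j"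
        using off[of j] ti by (cases "j = i") simp_all
    qed
    thus False using t(2) unfolding vec_of_nat_eq_iff by contradiction
  qed
  thus "on_ray i t" using off c_nonneg[OF t(1), of i] by (simp add: on_ray_def less_le)
next
  assume r: "on_ray i t"
  let ?q = "c (vec_of_nat t) i / c (vec_of_nat x) i"
  have "vec_of_nat t = ?q *s vec_of_nat x"
  proof (rule c_inj)
    fix j show "c (vec_of_nat t) j = c (?q *s vec_of_nat x) j"
      using r x by (cases "j = i") (auto simp: on_ray_def c_scale)
  qed
  moreover have "0 \<le> ?q" using r x by (simp add: on_ray_def)
  ultimately show "vec_of_nat t \<in> qcone {x}"
    unfolding qcone_def by (intro CollectI exI[of _ "{x}"] exI[of _ "\<lambda>_. ?q"]) simp
qed

text \<open>Two elements on the same ray are proportional, so the one of least total degree is least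
  componentwise.\<close>

lemma ray_minimum:
  obtains e where "\<And>i. e i \<in> S" "\<And>i. on_ray i (e i)" "\<And>i t. t \<in> S \<Longrightarrow> on_ray i t \<Longrightarrow> e i \<le> t"
proof -
  define e where "e i = arg_min vsum (\<lambda>t. t \<in> S \<and> on_ray i t)" for i
  have e: "e i \<in> S \<and> on_ray i (e i)" for i
    unfolding e_def using b_S b_on_ray by (intro arg_min_natI) blast
  have least: "vsum (e i) \<le> vsum t" if "t \<in> S" "on_ray i t" for i t
    unfolding e_def using that by (intro arg_min_nat_le) blast
  have "e i \<le> t" if t: "t \<in> S" "on_ray i t" for i t
  proof -
    have "\<exists>q. (vec_of_nat t :: rat ^ 'd) = q *s vec_of_nat (e i)"
    proof (intro exI c_inj)
      fix j show "c (vec_of_nat t) j = c ((c (vec_of_nat t) i / c (vec_of_nat (e i)) i) *s vec_of_nat (e i)) j"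
        using t e[of i] by (cases "j = i") (auto simp: on_ray_def c_scale)
    qed
    then obtain q where q: "(vec_of_nat t :: rat ^ 'd) = q *s vec_of_nat (e i)" by blast
    have coord: "(of_nat (t $ j) :: rat) = q * of_nat (e i $ j)" for j
      using arg_cong[OF q, of "\<lambda>v. v $ j"] by (simp add: vec_of_nat_def)
    have "of_nat (vsum t) = q * of_nat (vsum (e i))"
      by (simp add: vsum_def coord sum_distrib_left)
    moreover have "(of_nat (vsum (e i)) :: rat) \<le> of_nat (vsum t)" using least[OF t] by simp
    moreover have "e i \<noteq> 0" using e[of i] by (auto simp: on_ray_def)
    hence "(0 :: rat) < of_nat (vsum (e i))" using vsum_eq_0_iff[of "e i"] by simp
    ultimately have "1 * (of_nat (vsum (e i)) :: rat) \<le> q * of_nat (vsum (e i))" by simp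
    hence "1 \<le> q" using \<open>(0 :: rat) < of_nat (vsum (e i))\<close> by (simp only: mult_le_cancel_right_pos)
    hence "(of_nat (e i $ j) :: rat) \<le> of_nat (t $ j)" for j
      unfolding coord using mult_right_mono[of 1 q "of_nat (e i $ j)"] by simp
    thus ?thesis by (simp add: less_eq_vec_def)
  qed
  thus ?thesis using that e by blast
qed

end

section \<open>Apery sets and the counting formula\<close>

text \<open>The differences of elements of \<open>S\<close> span \<open>\<rat>\<^sup>d\<close> and lie in the span of the \<open>d\<close> vectors in \<open>B\<close>,
  which are therefore a basis.\<close>

lemma ray_basis_exists:
  fixes S :: "(nat ^ 'd::finite) set"
  assumes S: "add_submonoid S" and rank: "group_rank (group_of S) = CARD('d)"
    and B: "extremal_rays S B" "card B = CARD('d)"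
  shows "\<exists>b c. ray_basis S b c \<and> range b = B"
proof -
  let ?V = "vec_of_nat ` B :: (rat ^ 'd) set"
  have finB: "finite B" and BS: "B \<subseteq> S" and cone: "qcone B = qcone S" using B(1) by (auto simp: extremal_rays_def)
  have inj_vec: "inj_on (vec_of_nat :: _ \<Rightarrow> rat ^ 'd) A" for A
    by (rule inj_onI) (simp only: vec_of_nat_eq_iff)
  have cardV: "card ?V = CARD('d)" using card_image[OF inj_vec] B(2) by simp
  have in_span: "vec_of_nat s \<in> vec.span ?V" if "s \<in> S" for s
    using vec_of_nat_in_qcone[OF that] qcone_subset_span[of B] unfolding cone by blast
  have "(vec_of_int ` group_of S :: (rat ^ 'd) set) \<subseteq> vec.span ?V"
  proof
    fix v :: "rat ^ 'd" assume "v \<in> vec_of_int ` group_of S"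
    then obtain x y where xy: "x \<in> S" "y \<in> S" "v = vec_of_int (vec_of_nat x - vec_of_nat y)"
      unfolding group_of_def by blast
    have "v = vec_of_nat x - vec_of_nat y"
      unfolding xy(3) by (simp add: vec_of_int_def vec_of_nat_def vec_eq_iff)
    thus "v \<in> vec.span ?V" using in_span xy(1,2) by (simp add: vec.span_diff)
  qed
  hence "CARD('d) \<le> vec.dim (vec.span ?V)"
    using rank vec.dim_subset[of "vec_of_int ` group_of S" "vec.span ?V"] by (simp add: group_rank_def)
  hence dim: "vec.dim ?V = CARD('d)"
    using vec.dim_le_card[of ?V ?V] finB cardV vec.span_superset[of ?V] by (simp add: vec.dim_span)
  have span: "vec.span ?V = UNIV"
    using dim vec_dim_card[where 'a = rat and 'n = 'd]
      vec.subspace_dim_equal[of "vec.span ?V" UNIV] by (simp add: vec.dim_span)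
  have indep: "vec.independent ?V"
    using vec.card_le_dim_spanning[of ?V UNIV] span finB cardV vec_dim_card[where 'a = rat and 'n = 'd] by simp
  obtain b where b: "bij_betw b (UNIV :: 'd set) B"
    using finite_same_card_bij[of "UNIV :: 'd set" B] finB B(2) by auto
  hence inj_b: "inj b" and range_b: "range b = B" by (auto simp: bij_betw_def)
  define c :: "rat ^ 'd \<Rightarrow> 'd \<Rightarrow> rat" where "c v i = vec.representation ?V v (vec_of_nat (b i))" for v i
  have bV: "vec_of_nat (b i) \<in> ?V" for i using range_b by blast
  have V_eq: "?V = range (\<lambda>i. vec_of_nat (b i))" using range_b by auto
  have "ray_basis S b c"
  proof
    show "add_submonoid S" by (rule S)
    show "b i \<in> S" for i using range_b BS by blast
    show "qcone (range b) = qcone S" by (simp add: range_b cone)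
    show "c (v + w) i = c v i + c w i" for v w i
      using vec.representation_add[OF indep, of w v] span by (simp add: c_def)
    show "c (q *s v) i = q * c v i" for q v i
      using vec.representation_scale[OF indep, of v q] span by (simp add: c_def)
    show "c (vec_of_nat (b j)) i = (if i = j then 1 else 0)" for i j
      using vec.representation_basis[OF indep bV[of j]] inj_b
      by (simp add: c_def vec_of_nat_eq_iff inj_eq)
    show "(\<Sum>i\<in>UNIV. c v i *s vec_of_nat (b i)) = v" for v
    proof -
      have inj: "inj (\<lambda>i. vec_of_nat (b i) :: rat ^ 'd)"
        by (rule injI) (simp add: vec_of_nat_eq_iff inj_eq[OF inj_b])
      have "(\<Sum>x\<in>?V. vec.representation ?V v x *s x) = v"
        by (rule vec.sum_representation_eq[OF indep]) (use span finB in auto)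
      moreover have "(\<Sum>x\<in>?V. f x) = (\<Sum>i\<in>UNIV. f (vec_of_nat (b i)))" for f :: "rat ^ 'd \<Rightarrow> rat ^ 'd"
        unfolding V_eq sum.reindex[OF inj] comp_apply ..
      ultimately show ?thesis unfolding c_def by simp
    qed
  qed
  thus ?thesis using range_b by blast
qed

text \<open>Rescale the coordinates from the given extremal rays to the minimal elements of \<open>S\<close> on the same
  half-lines. A minimal element is irreducible in \<open>S\<close>, since summands of an element on an extremal
  ray stay on that ray.\<close>

lemma (in ray_basis) simplicial_cone_exists:
  assumes extremal: "extremal_rays S (range b)"
  shows "\<exists>e L. simplicial_cone S e L \<and> range e = minimal_extremal_rays S \<and> range e \<subseteq> msg S"
proof -
  obtain e where e: "\<And>i. e i \<in> S" "\<And>i. on_ray i (e i)" "\<And>i t. t \<in> S \<Longrightarrow> on_ray i t \<Longrightarrow> e i \<le> t"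
    using ray_minimum by blast
  have on_ray_nonzero: "t \<noteq> 0" if "on_ray i t" for i t using that by (auto simp: on_ray_def)
  define L where "L x i = c (vec_of_nat x) i / c (vec_of_nat (e i)) i" for x i
  have pos: "0 < c (vec_of_nat (e i)) i" for i using e(2)[of i] by (simp add: on_ray_def)
  have L_le: "L x i \<le> L y i \<longleftrightarrow> c (vec_of_nat x) i \<le> c (vec_of_nat y) i" for x y i
    using pos[of i] by (simp add: L_def divide_le_cancel)
  have L_0: "0 \<le> L x i \<longleftrightarrow> 0 \<le> c (vec_of_nat x) i" for x i
    using pos[of i] by (simp add: L_def zero_le_divide_iff)
  have "simplicial_cone S e L"
  proof
    show "add_submonoid S" by (rule submonoid)
    show "L (x + y) i = L x i + L y i" for x y i
      by (simp add: L_def vec_of_nat_add c_add add_divide_distrib)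
    show "L (e j) i = (if i = j then 1 else 0)" for i j
      using e(2)[of j] by (simp add: L_def on_ray_def)
    show "x = y" if "\<And>i. L x i = L y i" for x y
    proof -
      have "c (vec_of_nat x) i = c (vec_of_nat y) i" for i using that[of i] pos[of i] by (simp add: L_def)
      hence "(vec_of_nat x :: rat ^ 'd) = vec_of_nat y" by (rule c_inj)
      thus ?thesis by (simp only: vec_of_nat_eq_iff)
    qed
    show "\<exists>z. x = y + z" if le: "\<And>i. L y i \<le> L x i" for x y
    proof -
      let ?v = "vec_of_nat x + (- 1) *s vec_of_nat y :: rat ^ 'd"
      have c_v: "0 \<le> c ?v i" for i using le[of i] by (simp only: L_le c_add c_scale)
      have "y $ j \<le> x $ j" for j
      proof -
        have "0 \<le> (\<Sum>i\<in>UNIV. c ?v i *s vec_of_nat (b i) :: rat ^ 'd) $ j"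
          using c_v by (simp only: sum_component vector_smult_component) (auto intro!: sum_nonneg simp: vec_of_nat_def)
        hence "0 \<le> ?v $ j" by (simp only: c_sum)
        hence "(of_nat (y $ j) :: rat) \<le> of_nat (x $ j)" by (simp add: vec_of_nat_def)
        thus ?thesis by simp
      qed
      hence "x = y + (\<chi> j. x $ j - y $ j)" by (simp add: vec_eq_iff)
      thus ?thesis by blast
    qed
    show "0 \<le> L s i" if "s \<in> S" for s i using c_nonneg[OF that] by (simp add: L_0)
    show "e i \<in> S" for i by (rule e(1))
    show "gaps S = {x. \<forall>i. 0 \<le> L x i} - S" unfolding gaps_def qcone_S L_0 ..
  qed
  moreover have "range e = minimal_extremal_rays S"
  proof
    show "range e \<subseteq> minimal_extremal_rays S"
    proof
      fix s assume "s \<in> range e"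
      then obtain i where s: "s = e i" by blast
      have "vec_of_nat s \<in> qcone {b i}" "s \<noteq> 0"
        using in_qcone_ray[OF b_on_ray e(1) on_ray_nonzero[OF e(2)]] e(2) on_ray_nonzero[OF e(2)] by (simp_all add: s)
      moreover have "s \<le> t" if "t \<in> S" "t \<noteq> 0" "vec_of_nat t \<in> qcone {b i}" for t
        using in_qcone_ray[OF b_on_ray that(1,2)] that e(3) by (simp add: s)
      ultimately show "s \<in> minimal_extremal_rays S"
        unfolding minimal_extremal_rays_def using extremal e(1)[of i] s by blast
    qed
    show "minimal_extremal_rays S \<subseteq> range e"
    proof
      fix s assume "s \<in> minimal_extremal_rays S"
      then obtain B x where B: "extremal_rays S B" "x \<in> B" and s: "s \<in> S" "s \<noteq> 0" "vec_of_nat s \<in> qcone {x}"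
        and least: "\<forall>t\<in>S. t \<noteq> 0 \<and> vec_of_nat t \<in> qcone {x} \<longrightarrow> s \<le> t"
        unfolding minimal_extremal_rays_def by blast
      obtain i where x: "on_ray i x" using extremal_on_ray[OF B] by blast
      have "e i \<le> s" using in_qcone_ray[OF x s(1,2)] s e(3) by simp
      moreover have "s \<le> e i"
        using least e(1)[of i] on_ray_nonzero[OF e(2)] in_qcone_ray[OF x e(1) on_ray_nonzero[OF e(2)]] e(2) by blast
      ultimately have "e i = s" by (rule order.antisym)
      thus "s \<in> range e" by blast
    qed
  qed
  moreover have "e i \<in> msg S" for i
  proof (rule irreducible_in_msg[OF submonoid e(1) on_ray_nonzero[OF e(2)]])
    fix x y assume xy: "x \<in> S" "y \<in> S" "e i = x + y"
    show "x = 0 \<or> y = 0"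
    proof (cases "x = 0")
      case False
      have sum: "c (vec_of_nat (e i)) j = c (vec_of_nat x) j + c (vec_of_nat y) j" for j
        by (simp add: xy(3) vec_of_nat_add c_add)
      have off: "c (vec_of_nat x) j = 0" if "j \<noteq> i" for j
        using sum[of j] e(2)[of i] that c_nonneg[OF xy(1), of j] c_nonneg[OF xy(2), of j]
        by (simp add: on_ray_def)
      have "c (vec_of_nat x) i \<noteq> 0"
      proof
        assume xi: "c (vec_of_nat x) i = 0"
        have "vec_of_nat x = (vec_of_nat 0 :: rat ^ 'd)"
        proof (rule c_inj)
          fix j show "c (vec_of_nat x) j = c (vec_of_nat 0) j" using off[of j] xi by (cases "j = i") simp_all
        qed
        thus False using False unfolding vec_of_nat_eq_iff by contradiction
      qed
      hence "on_ray i x" using off c_nonneg[OF xy(1), of i] by (simp add: on_ray_def less_le)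
      hence "e i \<le> x" by (rule e(3)[OF xy(1)])
      hence "x $ j + y $ j \<le> x $ j" for j unfolding xy(3) less_eq_vec_def by simp
      hence "y = 0" by (simp add: vec_eq_iff)
      thus ?thesis ..
    qed simp
  qed
  ultimately show ?thesis by blast
qed

context simplicial_cone
begin

lemma Ap_iff: "s \<in> Ap S (range e) \<longleftrightarrow> s \<in> S \<and> (\<forall>i. \<forall>t\<in>S. s \<noteq> e i + t)"
proof -
  have "(vec_of_nat s - vec_of_nat x :: int ^ 'd) = vec_of_nat t \<longleftrightarrow> s = x + t" for x t
  proof -
    have "(vec_of_nat s - vec_of_nat x :: int ^ 'd) = vec_of_nat t \<longleftrightarrow> vec_of_nat s = (vec_of_nat (x + t) :: int ^ 'd)"
      by (simp add: vec_of_nat_def vec_eq_iff algebra_simps)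
    thus ?thesis by (simp only: vec_of_nat_int_eq_iff)
  qed
  thus ?thesis unfolding Ap_def image_iff by auto
qed

lemma L_ray_comb: "L (ray_comb e n) i = of_nat (n i)"
proof -
  have "L (\<Sum>j\<in>J. n j *s e j) i = (if i \<in> J then of_nat (n i) else 0)" if "finite J" for J
    using that by (induction J) (auto simp: L_add L_smult L_e)
  thus ?thesis by (simp add: ray_comb_def)
qed

lemma e_nonzero: "e i \<noteq> 0"
  using L_e[of i i] by auto

lemma zero_in_Ap: "0 \<in> Ap S (range e)"
  using e_nonzero by (auto simp: Ap_iff S_zero vec_nat_add_eq_0_iff)

definition fundamental :: "(nat ^ 'd) set" where "fundamental = {x. \<forall>i. 0 \<le> L x i \<and> L x i < 1}"

lemma cone_decomposition:
  assumes "\<And>i. 0 \<le> L x i"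
  shows "\<exists>w n. x = w + ray_comb e n \<and> w \<in> fundamental"
proof -
  let ?n = "\<lambda>i. nat \<lfloor>L x i\<rfloor>"
  have n: "(of_nat (?n i) :: rat) = of_int \<lfloor>L x i\<rfloor>" for i using assms[of i] by simp
  have "L (ray_comb e ?n) i \<le> L x i" for i by (simp only: L_ray_comb n of_int_floor_le)
  then obtain w where w: "x = ray_comb e ?n + w" using L_sub by blast
  have L_w: "L w i = L x i - of_int \<lfloor>L x i\<rfloor>" for i
    using L_add[of "ray_comb e ?n" w i] unfolding w[symmetric] L_ray_comb n by simp
  have "0 \<le> L w i \<and> L w i < 1" for i
  proof -
    have "of_int \<lfloor>L x i\<rfloor> \<le> L x i" "L x i < of_int \<lfloor>L x i\<rfloor> + 1" by linarith+
    thus ?thesis unfolding L_w by linarith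
  qed
  hence "w \<in> fundamental" by (simp add: fundamental_def)
  moreover have "x = w + ray_comb e ?n" using w by (simp only: add.commute)
  ultimately show ?thesis by blast
qed

lemma fundamental_unique:
  assumes "w \<in> fundamental" "w' \<in> fundamental" "w + ray_comb e n = w' + ray_comb e n'"
  shows "w = w' \<and> n = n'"
proof -
  have "n i = n' i" for i
  proof -
    have "L w i + of_nat (n i) = L w' i + of_nat (n' i)"
      using arg_cong[OF assms(3), of "\<lambda>x. L x i"] by (simp add: L_add L_ray_comb)
    moreover have "0 \<le> L w i" "L w i < 1" "0 \<le> L w' i" "L w' i < 1"
      using assms(1,2) by (auto simp: fundamental_def)
    ultimately have "(of_nat (n i) :: rat) < of_nat (n' i) + 1" "(of_nat (n' i) :: rat) < of_nat (n i) + 1"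
      by linarith+
    hence "(of_nat (n i) :: rat) < of_nat (Suc (n' i))" "(of_nat (n' i) :: rat) < of_nat (Suc (n i))" by simp_all
    thus ?thesis unfolding of_nat_less_iff by linarith
  qed
  hence "n = n'" by blast
  thus ?thesis using assms(3) by simp
qed

text \<open>If a gap \<open>h\<close> had a coordinate \<open>L\<^sub>i h \<ge> 1\<close>, then \<open>h - e\<^sub>i\<close> would be in the cone, and in either case,
  element of \<open>S\<close> or gap, adding \<open>e\<^sub>i\<close> would give \<open>h \<in> S\<close>. So the gaps are corners of layers, and the
  rest of each layer belongs to \<open>S\<close>.\<close>

lemma layered_of_gap_shift:
  fixes \<iota> :: "'d \<Rightarrow> nat"
  assumes shift: "\<And>h s. h \<in> gaps S \<Longrightarrow> s \<in> S \<Longrightarrow> s \<noteq> 0 \<Longrightarrow> h + s \<in> S"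
    and fin: "finite (msg S)" and e_msg: "range e \<subseteq> msg S"
    and med: "msg S - range e = Ap S (range e) - {0}" and \<iota>: "inj \<iota>"
  shows "layered_semigroup S e (fundamental \<inter> S) (gaps S) \<iota>"
proof -
  have gaps_fund: "gaps S \<subseteq> fundamental"
  proof
    fix h assume h: "h \<in> gaps S"
    hence h0: "0 \<le> L h i" "h \<notin> S" for i using gaps_eq by auto
    have "L h i < 1" for i
    proof (rule ccontr)
      assume "\<not> L h i < 1"
      hence "L (e i) j \<le> L h j" for j using h0(1)[of j] by (simp add: L_e)
      then obtain z where z: "h = e i + z" using L_sub by blast
      have "0 \<le> L z j" for j
        using \<open>\<not> L h i < 1\<close> h0(1)[of j] unfolding z by (cases "j = i") (simp_all add: L_add L_e)
      hence "z \<in> S \<or> z \<in> gaps S" by (rule cone_cases)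
      hence "h \<in> S" unfolding z using S_add[OF e_S] shift[OF _ e_S e_nonzero, of z i] by (auto simp: add.commute)
      thus False using h0(2) by blast
    qed
    thus "h \<in> fundamental" using h0(1) by (simp add: fundamental_def)
  qed
  have not_minus: "w \<noteq> e i + t" if "w \<in> fundamental" "t \<in> S" for w i t
  proof
    assume "w = e i + t"
    hence "L w i = 1 + L t i" by (simp add: L_add L_e)
    moreover have "L w i < 1" using that(1) by (simp add: fundamental_def)
    ultimately show False using L_nonneg[OF that(2), of i] by linarith
  qed
  have Ap_eq: "Ap S (range e) = (fundamental \<inter> S) \<union> {h + e i | h i. h \<in> gaps S}"
  proof (intro equalityI subsetI)
    fix s assume "s \<in> Ap S (range e)"
    hence s: "s \<in> S" "\<And>i t. t \<in> S \<Longrightarrow> s \<noteq> e i + t" by (auto simp: Ap_iff)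
    show "s \<in> (fundamental \<inter> S) \<union> {h + e i | h i. h \<in> gaps S}"
    proof (cases "s \<in> fundamental")
      case False
      then obtain i where i: "\<not> L s i < 1" using L_nonneg[OF s(1)] by (auto simp: fundamental_def)
      hence "L (e i) j \<le> L s j" for j using L_nonneg[OF s(1), of j] by (simp add: L_e)
      then obtain z where z: "s = e i + z" using L_sub by blast
      have "0 \<le> L z j" for j
        using i L_nonneg[OF s(1), of j] unfolding z by (cases "j = i") (simp_all add: L_add L_e)
      hence "z \<in> gaps S" using cone_cases[of z] s(2) z by blast
      moreover have "s = z + e i" using z by (simp only: add.commute)
      ultimately show ?thesis by blast
    qed (use s in blast)
  next
    fix s assume "s \<in> (fundamental \<inter> S) \<union> {h + e i | h i. h \<in> gaps S}"
    thus "s \<in> Ap S (range e)"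
    proof
      assume "s \<in> {h + e i | h i. h \<in> gaps S}"
      then obtain h i where h: "h \<in> gaps S" "s = h + e i" by blast
      have "s \<noteq> e j + t" if t: "t \<in> S" for j t
      proof
        assume "s = e j + t"
        hence eq: "h + e i = e j + t" using h(2) by simp
        show False
        proof (cases "i = j")
          case True
          hence "h = t" using eq by (simp add: add.commute)
          thus False using t h(1) gaps_eq by blast
        next
          case False
          have "L h j = 1 + L t j" using arg_cong[OF eq, of "\<lambda>x. L x j"] False by (simp add: L_add L_e)
          moreover have "L h j < 1" using gaps_fund h(1) by (auto simp: fundamental_def)
          ultimately show False using L_nonneg[OF t, of j] by linarith
        qed
      qed
      thus ?thesis using shift[OF h(1) e_S e_nonzero, of i] h(2) by (auto simp: Ap_iff)
    qed (use not_minus in \<open>auto simp: Ap_iff\<close>)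
  qed
  have "0 \<notin> {h + e i | h i. h \<in> gaps S}" using e_nonzero by (auto simp: vec_nat_add_eq_0_iff)
  hence "Ap S (range e) - {0} = (fundamental \<inter> S - {0}) \<union> {h + e i | h i. h \<in> gaps S}"
    unfolding Ap_eq by blast
  hence msg_eq: "msg S = range e \<union> (fundamental \<inter> S - {0}) \<union> {h + e i | h i. h \<in> gaps S}"
    using med e_msg by blast
  show ?thesis
  proof (unfold_locales)
    show "add_submonoid S" by (rule submonoid)
    show "0 \<in> fundamental \<inter> S" by (simp add: fundamental_def S_zero)
    show "fundamental \<inter> S \<inter> gaps S = {}" using gaps_eq by blast
    show "\<exists>w n. s = w + ray_comb e n \<and> (w \<in> fundamental \<inter> S \<or> w \<in> gaps S \<and> n \<noteq> (\<lambda>_. 0))"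
      if s: "s \<in> S" for s
    proof -
      obtain w n where w: "s = w + ray_comb e n" "w \<in> fundamental"
        using cone_decomposition[of s] L_nonneg[OF s] by blast
      have "w \<in> S \<or> w \<in> gaps S" using w(2) by (intro cone_cases) (simp add: fundamental_def)
      moreover have "n \<noteq> (\<lambda>_. 0)" if "w \<in> gaps S"
        using that s w(1) gaps_eq by (auto simp: ray_comb_zero)
      ultimately show ?thesis using w by blast
    qed
    show "w = w' \<and> n = n'" if "w \<in> fundamental \<inter> S \<union> gaps S" "w' \<in> fundamental \<inter> S \<union> gaps S"
      "w + ray_comb e n = w' + ray_comb e n'" for w w' n n'
      using that gaps_fund by (intro fundamental_unique) auto
  qed (use fin \<iota> msg_eq in simp_all)
qed

text \<open>In dimension one, subtracting \<open>e\<close> repeatedly leads from any element of \<open>S\<close> to a unique element of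
  the Apery set, so all layers are full.\<close>

lemma layered_of_one_ray:
  fixes \<iota> :: "'d \<Rightarrow> nat"
  assumes one: "CARD('d) = 1"
    and fin: "finite (msg S)" and e_msg: "range e \<subseteq> msg S"
    and med: "msg S - range e = Ap S (range e) - {0}" and \<iota>: "inj \<iota>"
  shows "layered_semigroup S e (Ap S (range e)) {} \<iota>"
proof (unfold_locales)
  obtain i where i: "UNIV = {i :: 'd}" using one card_1_singletonE by blast
  have comb: "ray_comb e n = n i *s e i" for n by (simp add: ray_comb_def i)
  have n_eq: "n = (\<lambda>_. n i)" for n :: "'d \<Rightarrow> nat" using i by (metis UNIV_I singletonD)
  show "add_submonoid S" by (rule submonoid)
  show "0 \<in> Ap S (range e)" by (rule zero_in_Ap)
  show "\<exists>w n. s = w + ray_comb e n \<and> (w \<in> Ap S (range e) \<or> w \<in> {} \<and> n \<noteq> (\<lambda>_. 0))" if "s \<in> S" for s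
    using that
  proof (induction "vsum s" arbitrary: s rule: less_induct)
    case less
    show ?case
    proof (cases "s \<in> Ap S (range e)")
      case True
      thus ?thesis by (intro exI[of _ s] exI[of _ "\<lambda>_. 0"]) (simp add: ray_comb_zero)
    next
      case False
      then obtain j t where t: "t \<in> S" "s = e j + t" using less.prems by (auto simp: Ap_iff)
      have "vsum t < vsum s" using e_nonzero[of j] vsum_eq_0_iff[of "e j"] by (simp add: t(2) vsum_add)
      then obtain w n where w: "t = w + ray_comb e n" "w \<in> Ap S (range e)" using less.hyps t(1) by blast
      have "s = w + ray_comb e (\<lambda>k. n k + unit_fun j k)"
        by (simp add: t(2) w(1) ray_comb_add ray_comb_unit ac_simps)
      thus ?thesis using w(2) by blast
    qed
  qed
  have le: "n i \<le> n' i" if h: "w \<in> Ap S (range e)" "w' \<in> Ap S (range e)" "w + ray_comb e n = w' + ray_comb e n'" for w w' n n'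
  proof (rule ccontr)
    assume "\<not> n i \<le> n' i"
    then obtain k where k: "n i = n' i + Suc k" by (metis add_Suc_right less_imp_Suc_add not_le)
    have "w' + n' i *s e i = w + (n' i *s e i + (e i + k *s e i))"
      using h(3) unfolding comb k by (simp add: vec_eq_iff algebra_simps)
    hence "w' = e i + (w + k *s e i)" by (simp add: vec_eq_iff algebra_simps)
    moreover have "w + k *s e i \<in> S"
      using h(1) by (intro S_add add_submonoid_smult[OF submonoid e_S]) (simp add: Ap_iff)
    ultimately show False using h(2) unfolding Ap_iff by blast
  qed
  show "w = w' \<and> n = n'" if h: "w \<in> Ap S (range e) \<union> {}" "w' \<in> Ap S (range e) \<union> {}"
    "w + ray_comb e n = w' + ray_comb e n'" for w w' n n'
  proof -
    have "n i = n' i" using le[of w w' n n'] le[of w' w n' n] h by (intro antisym) simp_all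
    hence "n = n'" using n_eq[of n] n_eq[of n'] by metis
    thus ?thesis using h(3) by simp
  qed
  show "msg S = range e \<union> (Ap S (range e) - {0}) \<union> {h + e i | h i. h \<in> {}}"
    using med e_msg by blast
qed (use fin \<iota> in simp_all)

end

theorem theorem4p7:
  fixes S :: "(nat ^ 'd::finite) set" and a :: "nat \<Rightarrow> nat ^ 'd" and m :: nat
  assumes "affine_semigroup S"
    and "simplicial S"
    and "buchsbaum_semigroup TYPE('k::field) S"
    and "maximal_embedding_dimension S"
    and "inj_on a {1..CARD('d) + m}"
    and "msg S = a ` {1..CARD('d)} \<union> a ` {CARD('d) + 1..CARD('d) + m}"
    and "extremal_rays S (a ` {1..CARD('d)})"
    and "C_semigroup S"
  shows "real (mu TYPE('k) S) =
    1 / 2 * (real m * (real m + 1) + real CARD('d) * (real CARD('d) - 1) * real (genus S))"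
proof -
  have S: "add_submonoid S" by (rule affine_semigroup_submonoid[OF assms(1)])
  have rank: "group_rank (group_of S) = CARD('d)" using assms(2) by (auto simp: simplicial_def)
  have "inj_on a {1..CARD('d)}" by (rule inj_on_subset[OF assms(5)]) auto
  hence card_rays: "card (a ` {1..CARD('d)}) = CARD('d)" by (simp add: card_image)
  obtain b c where b: "ray_basis S b c" "range b = a ` {1..CARD('d)}"
    using ray_basis_exists[OF S rank assms(7) card_rays] by blast
  obtain e L where cone: "simplicial_cone S e L" and e: "range e = minimal_extremal_rays S" "range e \<subseteq> msg S"
    using ray_basis.simplicial_cone_exists[OF b(1)] assms(7) b(2) by metis
  interpret simplicial_cone S e L by (rule cone)
  have med: "msg S - range e = Ap S (range e) - {0}"
    using assms(4) by (simp add: maximal_embedding_dimension_def e(1))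
  have "{1..CARD('d)} \<union> {CARD('d) + 1..CARD('d) + m} = {1..CARD('d) + m}" by auto
  hence msg_a: "msg S = a ` {1..CARD('d) + m}" using assms(6) by (metis image_Un)
  hence fin: "finite (msg S)" and card_msg: "card (msg S) = CARD('d) + m"
    using assms(5) by (simp_all add: card_image)
  have "inj e" by (rule injI) (metis L_e zero_neq_one)
  hence "card (range e) = CARD('d)" by (simp add: card_image)
  hence card_Y: "card (msg S - range e) = m"
    using card_msg e(2) card_Diff_subset[of "range e" "msg S"] by simp
  have fin_gaps: "finite (gaps S)" using assms(8) by (simp add: C_semigroup_def)
  obtain \<iota> :: "'d \<Rightarrow> nat" where \<iota>: "inj \<iota>" using finite_imp_inj_to_nat_seg[OF finite[of "UNIV :: 'd set"]] by blast
  show ?thesis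
  proof (cases "CARD('d) \<ge> 2")
    case True
    have "layered_semigroup S e (fundamental \<inter> S) (gaps S) \<iota>"
      using buchsbaum_gap_shift[OF fin_gaps True assms(3)] by (intro layered_of_gap_shift fin e(2) med \<iota>)
    from layered_semigroup.mu_formula[OF this, where 'k = 'k]
    show ?thesis unfolding layered_semigroup.Y_def[OF \<open>layered_semigroup S e (fundamental \<inter> S) (gaps S) \<iota>\<close>]
      card_Y genus_def .
  next
    case False
    hence one: "CARD('d) = 1" using zero_less_card_finite[where 'a = 'd] by linarith
    have layered: "layered_semigroup S e (Ap S (range e)) {} \<iota>"
      by (rule layered_of_one_ray[OF one fin e(2) med \<iota>])
    from layered_semigroup.mu_formula[OF layered, where 'k = 'k]
    show ?thesis unfolding layered_semigroup.Y_def[OF layered] card_Y by (simp add: one)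
  qed
qed

end
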